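(* Let $m\ge1$, let $M$ be one of the diagram monoids below, and let $V$ be a nonzero finite-dimensional $\mathbb CM$-module on which no element of $M$ apart from $1$ acts as the identity. Let $b(n)$ be the number of indecomposable direct summands of $V^{\otimes n}$, counted with multiplicity. (a) If $M=pRo_m$, $TL_m$ or $Mo_m$ (planar rook, Temperley–Lieb, Motzkin monoid), then, as $n\to\infty$, $$b(n)\sim(\dim V)^n.$$ (b) If $M=Ro_m$, $Br_m$, $RoBr_m$ or $Pa_m$ (rook, Brauer, rook Brauer, partition monoid), then, as $n\to\infty$, $$b(n)\sim\sum_{z=0}^{\lfloor m/2\rfloor}\frac{1}{(m-2z)!\,z!\,2^z}\cdot(\dim V)^n.$$
   Context: Modules are unital finite-dimensional left modules; $V^{\otimes n}$ carries the diagonal action of $M$. $f(n)\sim g(n)$ means $f(n)/g(n)\to1$. The partition monoid $Pa_m$ consists of all set partitions of $\{1,\dots,m\}\sqcup\{1',\dots,m'\}$ ($m$ top and $m$ bottom vertices), drawn as diagrams; the product $xy$ stacks $x$ on top of $y$, identifies the bottom vertices of $x$ with the top vertices of $y$, and discards components not connected to the top or bottom boundary. Submonoids: $RoBr_m$ (all blocks of size $\le2$); $Br_m$ (all blocks of size exactly $2$); $Ro_m$ (all blocks of size $\le2$ and each block of size $2$ contains one top and one bottom vertex). $Mo_m$, $TL_m$, $pRo_m$ consist of the planar diagrams (drawable without crossings inside the rectangle) in $RoBr_m$, $Br_m$, $Ro_m$ respectively. *)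

theory Defs
  imports
    "HOL-Analysis.Analysis"
    "HOL-Library.Function_Algebras"
    "HOL-Library.Landau_Symbols"
    "HOL-Library.Disjoint_Sets"
    "HOL-Algebra.Group"
begin

section \<open>Diagram monoids\<close>

datatype vertex = Top nat | Bot nat

definition vertices :: "nat \<Rightarrow> vertex set" where
  "vertices m = Top ` {1..m} \<union> Bot ` {1..m}"

type_synonym diagram = "vertex set set"

text \<open>
  To multiply two diagrams, the first is drawn above the second on three rows of vertices, the
  bottom row of the first being identified with the top row of the second. Two outer vertices
  lie in the same block of the product iff they are connected in the stack; components that stay
  in the middle row leave no trace.
\<close>

datatype stack_vertex = Upper nat | Middle nat | Lower nat

fun upper_half :: "vertex \<Rightarrow> stack_vertex" where
  "upper_half (Top i) = Upper i"
| "upper_half (Bot i) = Middle i"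

fun lower_half :: "vertex \<Rightarrow> stack_vertex" where
  "lower_half (Top i) = Middle i"
| "lower_half (Bot i) = Lower i"

fun outer :: "vertex \<Rightarrow> stack_vertex" where
  "outer (Top i) = Upper i"
| "outer (Bot i) = Lower i"

definition stack_edges :: "diagram \<Rightarrow> diagram \<Rightarrow> (stack_vertex \<times> stack_vertex) set" where
  "stack_edges x y =
     (\<Union>B\<in>x. (upper_half ` B) \<times> (upper_half ` B)) \<union> (\<Union>B\<in>y. (lower_half ` B) \<times> (lower_half ` B))"

definition diagram_mult :: "nat \<Rightarrow> diagram \<Rightarrow> diagram \<Rightarrow> diagram" where
  "diagram_mult m x y =
     vertices m // {(u, v). u \<in> vertices m \<and> v \<in> vertices m \<and>
                            (outer u, outer v) \<in> (stack_edges x y)\<^sup>*}"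

definition partition_monoid :: "nat \<Rightarrow> diagram monoid" where
  "partition_monoid m =
     \<lparr>carrier = {x. partition_on (vertices m) x},
      mult = diagram_mult m,
      one = (\<lambda>i. {Top i, Bot i}) ` {1..m}\<rparr>"

definition rook_brauer_monoid :: "nat \<Rightarrow> diagram monoid" where
  "rook_brauer_monoid m =
     (partition_monoid m)\<lparr>carrier := {x \<in> carrier (partition_monoid m). \<forall>B\<in>x. card B \<le> 2}\<rparr>"

definition brauer_monoid :: "nat \<Rightarrow> diagram monoid" where
  "brauer_monoid m =
     (partition_monoid m)\<lparr>carrier := {x \<in> carrier (partition_monoid m). \<forall>B\<in>x. card B = 2}\<rparr>"

definition rook_monoid :: "nat \<Rightarrow> diagram monoid" where
  "rook_monoid m =
     (partition_monoid m)\<lparr>carrier := {x \<in> carrier (partition_monoid m).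
        \<forall>B\<in>x. card B \<le> 2 \<and> (card B = 2 \<longrightarrow> (\<exists>i j. B = {Top i, Bot j}))}\<rparr>"

text \<open>
  A diagram is planar if it can be drawn without crossings: the blocks are represented by pairwise
  disjoint path-connected subsets of the rectangle \<open>[0, m + 1] \<times> [0, 1]\<close>. Each of these
  contains the vertices of its block and otherwise stays in the interior of the rectangle.
\<close>

fun position :: "vertex \<Rightarrow> real \<times> real" where
  "position (Top i) = (real i, 1)"
| "position (Bot i) = (real i, 0)"

definition planar_diagram :: "nat \<Rightarrow> diagram \<Rightarrow> bool" where
  "planar_diagram m x \<longleftrightarrow>
     (\<exists>D :: vertex set \<Rightarrow> (real \<times> real) set.
        (\<forall>B\<in>x. path_connected (D B) \<and> position ` B \<subseteq> D B \<and>
               D B \<subseteq> position ` B \<union> {0<..<real m + 1} \<times> {0<..<1}) \<and>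
        (\<forall>B\<in>x. \<forall>C\<in>x. B \<noteq> C \<longrightarrow> D B \<inter> D C = {}))"

definition motzkin_monoid :: "nat \<Rightarrow> diagram monoid" where
  "motzkin_monoid m =
     (rook_brauer_monoid m)\<lparr>carrier := {x \<in> carrier (rook_brauer_monoid m). planar_diagram m x}\<rparr>"

definition temperley_lieb_monoid :: "nat \<Rightarrow> diagram monoid" where
  "temperley_lieb_monoid m =
     (brauer_monoid m)\<lparr>carrier := {x \<in> carrier (brauer_monoid m). planar_diagram m x}\<rparr>"

definition planar_rook_monoid :: "nat \<Rightarrow> diagram monoid" where
  "planar_rook_monoid m =
     (rook_monoid m)\<lparr>carrier := {x \<in> carrier (rook_monoid m). planar_diagram m x}\<rparr>"


section \<open>Modules over complex monoid algebras\<close>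

text \<open>
  A finite-dimensional left module over the monoid algebra of \<open>M\<close>, given as a complex vector space
  together with a linear action of the monoid. The vector space is the whole type \<open>'v\<close>.
\<close>

locale monoid_module = vector_space sc
  for sc :: "complex \<Rightarrow> 'v::ab_group_add \<Rightarrow> 'v" +
  fixes M :: "('a, 'b) monoid_scheme"
    and act :: "'a \<Rightarrow> 'v \<Rightarrow> 'v"
  assumes finite_dimensional: "\<exists>B. finite B \<and> span B = UNIV"
    and act_linear: "x \<in> carrier M \<Longrightarrow> Vector_Spaces.linear sc sc (act x)"
    and act_one: "act \<one>\<^bsub>M\<^esub> v = v"
    and act_mult: "x \<in> carrier M \<Longrightarrow> y \<in> carrier M \<Longrightarrow> act (x \<otimes>\<^bsub>M\<^esub> y) v = act x (act y v)"

definition submodule ::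
  "(complex \<Rightarrow> 'v::ab_group_add \<Rightarrow> 'v) \<Rightarrow> ('a, 'b) monoid_scheme \<Rightarrow> ('a \<Rightarrow> 'v \<Rightarrow> 'v) \<Rightarrow> 'v set \<Rightarrow> bool" where
  "submodule sc M act W \<longleftrightarrow>
     module.subspace sc W \<and> (\<forall>x\<in>carrier M. \<forall>w\<in>W. act x w \<in> W)"

definition indecomposable ::
  "(complex \<Rightarrow> 'v::ab_group_add \<Rightarrow> 'v) \<Rightarrow> ('a, 'b) monoid_scheme \<Rightarrow> ('a \<Rightarrow> 'v \<Rightarrow> 'v) \<Rightarrow> 'v set \<Rightarrow> bool" where
  "indecomposable sc M act W \<longleftrightarrow>
     submodule sc M act W \<and> W \<noteq> {0} \<and>
     \<not> (\<exists>W\<^sub>1 W\<^sub>2. submodule sc M act W\<^sub>1 \<and> submodule sc M act W\<^sub>2 \<and> W\<^sub>1 \<noteq> {0} \<and> W\<^sub>2 \<noteq> {0} \<and>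
               bij_betw (\<lambda>(u, v). u + v) (W\<^sub>1 \<times> W\<^sub>2) W)"

definition indecomposable_decomposition ::
  "(complex \<Rightarrow> 'v::ab_group_add \<Rightarrow> 'v) \<Rightarrow> ('a, 'b) monoid_scheme \<Rightarrow> ('a \<Rightarrow> 'v \<Rightarrow> 'v) \<Rightarrow> 'v set \<Rightarrow>
   nat \<Rightarrow> (nat \<Rightarrow> 'v set) \<Rightarrow> bool" where
  "indecomposable_decomposition sc M act W k U \<longleftrightarrow>
     (\<forall>i<k. indecomposable sc M act (U i)) \<and>
     bij_betw (\<lambda>u. \<Sum>i<k. u i) (\<Pi>\<^sub>E i\<in>{..<k}. U i) W"

text \<open>
  The number of indecomposable direct summands, counted with multiplicity. By the Krull-Schmidt
  theorem it does not depend on the choice of the decomposition.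
\<close>

definition num_indecomposable_summands ::
  "(complex \<Rightarrow> 'v::ab_group_add \<Rightarrow> 'v) \<Rightarrow> ('a, 'b) monoid_scheme \<Rightarrow> ('a \<Rightarrow> 'v \<Rightarrow> 'v) \<Rightarrow> 'v set \<Rightarrow> nat" where
  "num_indecomposable_summands sc M act W =
     (SOME k. \<exists>U. indecomposable_decomposition sc M act W k U)"


section \<open>Tensor powers\<close>

text \<open>
  The tensor \<open>v\<^sub>1 \<otimes> \<dots> \<otimes> v\<^sub>n\<close> is represented by the multilinear form
  \<open>(f\<^sub>1, \<dots>, f\<^sub>n) \<mapsto> f\<^sub>1 v\<^sub>1 * \<dots> * f\<^sub>n v\<^sub>n\<close> on the dual space, extended by zero to lists that are not
  \<open>n\<close>-tuples of linear functionals. Since functionals separate points, this identifies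
  the algebraic tensor power with the span of these forms. A linear map \<open>g\<close> acts diagonally
  by precomposing every functional with \<open>g\<close>.
\<close>

type_synonym 'v tensor = "('v \<Rightarrow> complex) list \<Rightarrow> complex"

definition tensor_scale :: "complex \<Rightarrow> 'v tensor \<Rightarrow> 'v tensor" where
  "tensor_scale c t = (\<lambda>fs. c * t fs)"

definition pure_tensor ::
  "(complex \<Rightarrow> 'v::ab_group_add \<Rightarrow> 'v) \<Rightarrow> 'v list \<Rightarrow> 'v tensor" where
  "pure_tensor sc vs = (\<lambda>fs.
     if length fs = length vs \<and> (\<forall>f\<in>set fs. Vector_Spaces.linear sc (*) f)
     then \<Prod>i<length vs. (fs ! i) (vs ! i) else 0)"

definition tensor_power ::
  "(complex \<Rightarrow> 'v::ab_group_add \<Rightarrow> 'v) \<Rightarrow> nat \<Rightarrow> 'v tensor set" where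
  "tensor_power sc n = module.span tensor_scale (pure_tensor sc ` {vs. length vs = n})"

definition tensor_act ::
  "(complex \<Rightarrow> 'v::ab_group_add \<Rightarrow> 'v) \<Rightarrow> ('a \<Rightarrow> 'v \<Rightarrow> 'v) \<Rightarrow> 'a \<Rightarrow> 'v tensor \<Rightarrow> 'v tensor" where
  "tensor_act sc act x t = (\<lambda>fs.
     if \<forall>f\<in>set fs. Vector_Spaces.linear sc (*) f then t (map (\<lambda>f. f \<circ> act x) fs) else 0)"

lemma vector_space_tensor: "vector_space (tensor_scale :: complex \<Rightarrow> 'v tensor \<Rightarrow> 'v tensor)"
  by unfold_locales (auto simp: tensor_scale_def fun_eq_iff algebra_simps)

lemma linear_tensor_act:
  "Vector_Spaces.linear tensor_scale tensor_scale (tensor_act sc act x)"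
  using vector_space_tensor
  by (auto simp: Vector_Spaces.linear_def module_hom_def module_hom_axioms_def module_iff_vector_space
      tensor_act_def tensor_scale_def fun_eq_iff)

context monoid_module
begin

lemma tensor_act_pure_tensor:
  assumes "x \<in> carrier M"
  shows "tensor_act sc act x (pure_tensor sc vs) = pure_tensor sc (map (act x) vs)"
proof
  fix fs
  have "Vector_Spaces.linear sc (*) (f \<circ> act x)" if "Vector_Spaces.linear sc (*) f" for f
    using Vector_Spaces.linear_compose[OF act_linear[OF assms] that] .
  then show "tensor_act sc act x (pure_tensor sc vs) fs = pure_tensor sc (map (act x) vs) fs"
    by (auto simp: tensor_act_def pure_tensor_def)
qed

lemma submodule_tensor_power:
  "submodule tensor_scale M (tensor_act sc act) (tensor_power sc n)"
proof -
  interpret T: vector_space "tensor_scale :: complex \<Rightarrow> 'v tensor \<Rightarrow> 'v tensor"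
    by (rule vector_space_tensor)
  have "tensor_act sc act x w \<in> tensor_power sc n"
    if "x \<in> carrier M" "w \<in> tensor_power sc n" for x w
  proof -
    interpret L: Vector_Spaces.linear tensor_scale tensor_scale "tensor_act sc act x"
      by (rule linear_tensor_act)
    have "tensor_act sc act x w
        \<in> T.span (tensor_act sc act x ` pure_tensor sc ` {vs. length vs = n})"
      using that(2) unfolding tensor_power_def L.span_image by blast
    also have "\<dots> \<subseteq> tensor_power sc n"
      unfolding tensor_power_def
      by (rule T.span_mono) (auto simp: tensor_act_pure_tensor that(1))
    finally show ?thesis .
  qed
  then show ?thesis
    by (auto simp: submodule_def tensor_power_def T.subspace_span)
qed

end

end

theory Submission
  imports
    Defs
    "HOL-Library.Poly_Mapping"
    "HOL-Combinatorics.Perm"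
    "HOL-Combinatorics.Permutations"
    "HOL-Computational_Algebra.Fundamental_Theorem_Algebra"
begin

text \<open>
  Let \<open>G\<close> be the group of units (a symmetric group \<open>S\<^sub>l\<close>, with \<open>l = 0\<close> in the planar
  case) and \<open>I\<close> the ideal of the other elements. If \<open>x\<close> acts bijectively on \<open>V\<close>, then some power of
  \<open>x\<close> acts as the identity and \<open>x\<close> is a unit; so every \<open>x \<in> I\<close> has rank at most
  \<open>(dim V - 1)\<^sup>n\<close> on \<open>V\<^sup>\<otimes>\<^sup>n\<close>. By Maschke's theorem an indecomposable summand
  on which \<open>I\<close> acts as zero is a simple \<open>G\<close>-module, and one on which \<open>I\<close> does not act as zero has
  dimension at most twice the sum of the ranks of the elements of \<open>I\<close> on it. Hence \<open>b(n)\<close> is the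
  length of \<open>V\<^sup>\<otimes>\<^sup>n\<close> as a \<open>G\<close>-module, up to \<open>O((dim V - 1)\<^sup>n)\<close>.

  The length of a \<open>G\<close>-module \<open>W\<close> is \<open>\<Sum>\<^sub>e dim (e W) / d\<^sub>e\<close>, for a complete set of orthogonal
  primitive idempotents \<open>e\<close> of the group algebra, where \<open>d\<^sub>e = |G| e(1)\<close>. For \<open>W = V\<^sup>\<otimes>\<^sup>n\<close> the
  dimension of \<open>e W\<close> is \<open>\<Sum>\<^sub>g e(g) \<chi>(g)\<^sup>n\<close>, and \<open>|\<chi>(g)| < dim V\<close> unless \<open>g\<close> acts as a
  scalar, in which case \<open>g\<close> is central; so the length is asymptotic to the number of idempotents
  divided by \<open>|G|\<close>, times \<open>(dim V)\<^sup>n\<close> (for \<open>l \<le> 2\<close> the group is abelian and all \<open>d\<^sub>e\<close> are \<open>1\<close>).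

  For \<open>S\<^sub>n\<close> the idempotents can be chosen real and symmetric (fixed by \<open>g \<mapsto> g\<^sup>-\<^sup>1\<close>), refining
  those of \<open>S\<^sub>n\<^sub>-\<^sub>1\<close>: each \<open>g \<in> S\<^sub>n\<close> is conjugate to its inverse under \<open>S\<^sub>n\<^sub>-\<^sub>1\<close>, so the
  centraliser of \<open>S\<^sub>n\<^sub>-\<^sub>1\<close> in the group algebra consists of symmetric elements and is commutative.
  Computing \<open>\<Sum>\<^sub>g \<tau>(a g\<^sup>-\<^sup>1 b g\<^sup>-\<^sup>1)\<close>, with \<open>\<tau>\<close> the coefficient of \<open>1\<close>, for \<open>a = b = 1\<close> in two
  ways shows that the number of idempotents is the number of solutions of \<open>g\<^sup>2 = 1\<close>.
\<close>

section \<open>Traces, direct sums and eigenvectors\<close>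

text \<open>The constant in (b) is the number of \<open>g\<close> in \<open>S_m\<close> with
  \<open>g^2 = 1\<close>, divided by \<open>m!\<close>: exactly
  \<open>m! / ((m - 2z)! z! 2^z)\<close> of these \<open>g\<close> have \<open>z\<close> two-cycles.
  A complete set of orthogonal primitive idempotents has as many members as the degrees of the
  irreducible modules add up to, so the count is the Frobenius-Schur theorem for a group all of
  whose irreducible modules are real; symmetry of the idempotents is the form in which realness
  enters. The length formula holds because, on a simple module \<open>S\<close>, every
  \<open>e\<close> that does not kill \<open>S\<close> has rank 1 and \<open>d_e = dim S\<close>;
  the ranks add up to \<open>dim S\<close>, so the formula gives 1. The obstacle is that modules
  over the monoid are not semisimple, while characters see only \<open>G\<close>. The length over
  \<open>G\<close> bridges the gap: it is additive over a decomposition over the monoid, each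
  summand contributes at least 1, and the excess is bounded by ranks of elements of
  \<open>I\<close>, which are additive as well. Both bounds concern an arbitrary decomposition,
  hence also the one picked by the choice operator.\<close>

locale complex_vector_space = vector_space scale
  for scale :: "complex \<Rightarrow> 'b::ab_group_add \<Rightarrow> 'b" (infixr \<open>\<cdot>\<close> 75)
begin

section \<open>Finite-dimensional subspaces, frames and traces\<close>

text \<open>Tensor powers are subspaces of an infinite-dimensional function space and operators are
  total functions on it. Finite dimension, and below linearity, are therefore properties relative to
  a subspace \<open>U\<close>.\<close>

definition fin_dim :: "'b set \<Rightarrow> bool" where
  "fin_dim U \<longleftrightarrow> subspace U \<and> (\<exists>B. finite B \<and> U \<subseteq> span B)"

lemma fin_dim_subspace: "fin_dim U \<Longrightarrow> subspace U"
  by (simp add: fin_dim_def)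

lemma fin_dim_mono: "fin_dim U \<Longrightarrow> subspace S \<Longrightarrow> S \<subseteq> U \<Longrightarrow> fin_dim S"
  by (auto simp: fin_dim_def)

lemma fin_dim_basis:
  assumes "fin_dim U"
  obtains B where "finite B" "independent B" "span B = U" "card B = dim U" "B \<subseteq> U"
proof -
  obtain A where A: "finite A" "U \<subseteq> span A" using assms by (auto simp: fin_dim_def)
  obtain B where B: "B \<subseteq> U" "independent B" "U \<subseteq> span B" "card B = dim U"
    using basis_exists[of U] by blast
  have "finite B" using independent_span_bound[of A B] A B by auto
  moreover have "span B = U"
    using B span_minimal[of B U] fin_dim_subspace[OF assms] by blast
  ultimately show ?thesis using that B by blast
qed

definition lin_on :: "'b set \<Rightarrow> ('b \<Rightarrow> 'b) \<Rightarrow> bool" where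
  "lin_on U T \<longleftrightarrow> (\<forall>u\<in>U. \<forall>v\<in>U. T (u + v) = T u + T v) \<and> (\<forall>c. \<forall>u\<in>U. T (c \<cdot> u) = c \<cdot> T u)"

definition functional_on :: "'b set \<Rightarrow> ('b \<Rightarrow> complex) \<Rightarrow> bool" where
  "functional_on U f \<longleftrightarrow> (\<forall>u\<in>U. \<forall>v\<in>U. f (u + v) = f u + f v) \<and> (\<forall>c. \<forall>u\<in>U. f (c \<cdot> u) = c * f u)"

lemma lin_on_mono: "lin_on U T \<Longrightarrow> S \<subseteq> U \<Longrightarrow> lin_on S T"
  unfolding lin_on_def by blast

lemma lin_on_linear: "Vector_Spaces.linear (\<cdot>) (\<cdot>) T \<Longrightarrow> lin_on U T"
  by (simp add: lin_on_def Vector_Spaces.linear_iff)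

lemma lin_on_id: "lin_on U (\<lambda>x. x)"
  by (simp add: lin_on_def)

lemma lin_on_scale: "lin_on U S \<Longrightarrow> lin_on U (\<lambda>u. c \<cdot> S u)"
  by (simp add: lin_on_def scale_right_distrib mult.commute)

lemma lin_on_sum:
  assumes "\<And>i. i \<in> I \<Longrightarrow> lin_on U (S i)"
  shows "lin_on U (\<lambda>u. \<Sum>i\<in>I. S i u)"
  using assms by (simp add: lin_on_def sum.distrib scale_sum_right)

lemma lin_on_compose:
  assumes "lin_on U S" "lin_on U' T" "S ` U \<subseteq> U'"
  shows "lin_on U (\<lambda>u. T (S u))"
  using assms by (simp add: lin_on_def image_subset_iff)

lemma lin_on_0: "lin_on U T \<Longrightarrow> subspace U \<Longrightarrow> T 0 = 0"
proof -
  assume a: "lin_on U T" "subspace U"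
  then have "T (0 \<cdot> 0) = 0 \<cdot> T 0" using subspace_0[OF a(2)] unfolding lin_on_def by blast
  then show ?thesis by simp
qed

lemma functional_on_0: "functional_on U f \<Longrightarrow> subspace U \<Longrightarrow> f 0 = 0"
proof -
  assume a: "functional_on U f" "subspace U"
  then have "f (0 \<cdot> 0) = 0 * f 0" using subspace_0[OF a(2)] unfolding functional_on_def by blast
  then show ?thesis by simp
qed

lemma lin_on_apply_sum:
  assumes "lin_on U T" "subspace U" "\<And>i. i \<in> I \<Longrightarrow> x i \<in> U"
  shows "T (\<Sum>i\<in>I. c i \<cdot> x i) = (\<Sum>i\<in>I. c i \<cdot> T (x i))"
  using assms(3)
proof (induction I rule: infinite_finite_induct)
  case (insert j I)
  have "(\<Sum>i\<in>I. c i \<cdot> x i) \<in> U" "c j \<cdot> x j \<in> U"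
    using insert assms(2) by (auto intro!: subspace_sum subspace_scale)
  then show ?case using insert assms(1) by (simp add: lin_on_def)
qed (use lin_on_0 assms in auto)

lemma lin_on_apply_sum':
  assumes "lin_on U T" "subspace U" "\<And>i. i \<in> I \<Longrightarrow> x i \<in> U"
  shows "T (\<Sum>i\<in>I. x i) = (\<Sum>i\<in>I. T (x i))"
  using lin_on_apply_sum[OF assms(1,2), of I x "\<lambda>_. 1"] assms(3) by simp

lemma functional_on_apply_sum:
  assumes "functional_on U T" "subspace U" "\<And>i. i \<in> I \<Longrightarrow> x i \<in> U"
  shows "T (\<Sum>i\<in>I. c i \<cdot> x i) = (\<Sum>i\<in>I. c i * T (x i))"
  using assms(3)
proof (induction I rule: infinite_finite_induct)
  case (insert j I)
  have "(\<Sum>i\<in>I. c i \<cdot> x i) \<in> U" "c j \<cdot> x j \<in> U"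
    using insert assms(2) by (auto intro!: subspace_sum subspace_scale)
  then show ?case using insert assms(1) by (simp add: functional_on_def)
qed (use functional_on_0 assms in auto)

lemma subspace_image_lin_on:
  assumes "lin_on U T" "subspace U"
  shows "subspace (T ` U)"
proof (rule subspaceI)
  show "0 \<in> T ` U" using lin_on_0[OF assms] subspace_0[OF assms(2)] by force
next
  fix x y assume "x \<in> T ` U" "y \<in> T ` U"
  then obtain u v where "x = T u" "y = T v" "u \<in> U" "v \<in> U" by auto
  then show "x + y \<in> T ` U"
    using assms(1) subspace_add[OF assms(2), of u v] image_eqI[of "x + y" T "u + v" U] by (simp add: lin_on_def)
next
  fix c x assume "x \<in> T ` U"
  then obtain u where u: "x = T u" "u \<in> U" by auto
  then have "c \<cdot> x = T (c \<cdot> u)" using assms by (simp add: lin_on_def)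
  then show "c \<cdot> x \<in> T ` U" using u subspace_scale[OF assms(2)] by blast
qed

lemma fin_dim_image:
  assumes "lin_on U T" "fin_dim U"
  shows "fin_dim (T ` U)" "dim (T ` U) \<le> dim U"
proof -
  obtain B where B: "finite B" "independent B" "span B = U" "card B = dim U" "B \<subseteq> U"
    using fin_dim_basis[OF assms(2)] .
  have "T ` U \<subseteq> span (T ` B)"
  proof
    fix x assume "x \<in> T ` U"
    then obtain u where u: "x = T u" "u \<in> U" by auto
    have "u = (\<Sum>b\<in>B. representation B u b \<cdot> b)"
      using sum_representation_eq[OF B(2) _ B(1) order_refl] u B by simp
    with u have "x = (\<Sum>b\<in>B. representation B u b \<cdot> T b)"
      using lin_on_apply_sum[OF assms(1) fin_dim_subspace[OF assms(2)], of B "\<lambda>b. b" "representation B u"] u B(5)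
      by auto
    also have "\<dots> \<in> span (T ` B)" by (intro span_sum span_scale span_base imageI)
    finally show "x \<in> span (T ` B)" .
  qed
  then show "fin_dim (T ` U)" "dim (T ` U) \<le> dim U"
    using subspace_image_lin_on[OF assms(1) fin_dim_subspace[OF assms(2)]] B
      dim_le_card[of "T ` U" "T ` B"] card_image_le[of B T]
    by (auto simp: fin_dim_def)
qed

text \<open>The identity of \<open>U\<close> written as a sum of rank-one maps. The
  \<open>b i\<close> may be dependent: this identity alone makes the sum of the
  \<open>\<phi> i (T (b i))\<close> the trace of \<open>T\<close>. The index type is free, so that
  pairs (for direct sums) and words (for tensor powers) can serve as indices.\<close>

definition frame :: "'b set \<Rightarrow> 'i set \<Rightarrow> ('i \<Rightarrow> 'b) \<Rightarrow> ('i \<Rightarrow> 'b \<Rightarrow> complex) \<Rightarrow> bool" where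
  "frame U I b \<phi> \<longleftrightarrow> finite I \<and> subspace U \<and> b ` I \<subseteq> U \<and> (\<forall>i\<in>I. functional_on U (\<phi> i)) \<and>
     (\<forall>u\<in>U. u = (\<Sum>i\<in>I. \<phi> i u \<cdot> b i))"

lemma frame_basis:
  assumes "finite B" "independent B"
  shows "frame (span B) B (\<lambda>b. b) (\<lambda>b u. representation B u b)"
  using assms
  by (auto simp: frame_def functional_on_def representation_add representation_scale
      sum_representation_eq intro: span_base)

lemma frame_exists:
  assumes "fin_dim U"
  obtains I :: "'b set" and b \<phi> where "frame U I b \<phi>"
proof -
  obtain B where "finite B" "independent B" "span B = U" "card B = dim U" "B \<subseteq> U"
    using fin_dim_basis[OF assms] .
  then show ?thesis using that[of B] frame_basis[of B] by simp
qed

text \<open>Expanding \<open>X (b i)\<close> and \<open>Y (b' j)\<close> in the other frame turns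
  both sides into the same double sum. For \<open>U = U'\<close> and one map the identity, this says
  that the trace does not depend on the frame.\<close>

lemma frame_trace_commute:
  assumes "frame U I b \<phi>" "frame U' J b' \<phi>'"
    and X: "lin_on U X" "X ` U \<subseteq> U'" and Y: "lin_on U' Y" "Y ` U' \<subseteq> U"
  shows "(\<Sum>i\<in>I. \<phi> i (Y (X (b i)))) = (\<Sum>j\<in>J. \<phi>' j (X (Y (b' j))))"
proof -
  have s: "subspace U" "subspace U'" using assms by (auto simp: frame_def)
  have bI: "b i \<in> U" if "i \<in> I" for i using assms(1) that by (auto simp: frame_def)
  have bJ: "b' i \<in> U'" if "i \<in> J" for i using assms(2) that by (auto simp: frame_def)
  have "\<phi> i (Y (X (b i))) = (\<Sum>j\<in>J. \<phi>' j (X (b i)) * \<phi> i (Y (b' j)))" if i: "i \<in> I" for i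
  proof -
    have "X (b i) = (\<Sum>j\<in>J. \<phi>' j (X (b i)) \<cdot> b' j)"
      using assms(2) X bI[OF i] unfolding frame_def by blast
    then have "Y (X (b i)) = (\<Sum>j\<in>J. \<phi>' j (X (b i)) \<cdot> Y (b' j))"
      using lin_on_apply_sum[OF Y(1) s(2), of J b' "\<lambda>j. \<phi>' j (X (b i))"] bJ by simp
    moreover have "functional_on U (\<phi> i)" using assms(1) i by (auto simp: frame_def)
    ultimately show ?thesis
      using functional_on_apply_sum[OF _ s(1), of "\<phi> i" J "\<lambda>j. Y (b' j)" "\<lambda>j. \<phi>' j (X (b i))"] bJ Y
      by (simp add: image_subset_iff)
  qed
  moreover have "\<phi>' j (X (Y (b' j))) = (\<Sum>i\<in>I. \<phi> i (Y (b' j)) * \<phi>' j (X (b i)))" if j: "j \<in> J" for j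
  proof -
    have "Y (b' j) = (\<Sum>i\<in>I. \<phi> i (Y (b' j)) \<cdot> b i)"
      using assms(1) Y bJ[OF j] unfolding frame_def by blast
    then have "X (Y (b' j)) = (\<Sum>i\<in>I. \<phi> i (Y (b' j)) \<cdot> X (b i))"
      using lin_on_apply_sum[OF X(1) s(1), of I b "\<lambda>i. \<phi> i (Y (b' j))"] bI by simp
    moreover have "functional_on U' (\<phi>' j)" using assms(2) j by (auto simp: frame_def)
    ultimately show ?thesis
      using functional_on_apply_sum[OF _ s(2), of "\<phi>' j" I "\<lambda>j. X (b j)" "\<lambda>i. \<phi> i (Y (b' j))"] bI X
      by (simp add: image_subset_iff)
  qed
  ultimately have "(\<Sum>i\<in>I. \<phi> i (Y (X (b i)))) = (\<Sum>i\<in>I. \<Sum>j\<in>J. \<phi>' j (X (b i)) * \<phi> i (Y (b' j)))"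
    and "(\<Sum>j\<in>J. \<phi>' j (X (Y (b' j)))) = (\<Sum>j\<in>J. \<Sum>i\<in>I. \<phi> i (Y (b' j)) * \<phi>' j (X (b i)))"
    by auto
  then show ?thesis using sum.swap by (simp add: mult.commute)
qed

lemma frame_fin_dim:
  assumes "frame U I b \<phi>"
  shows "fin_dim U"
proof -
  have "u \<in> span (b ` I)" if "u \<in> U" for u
  proof -
    have "u = (\<Sum>i\<in>I. \<phi> i u \<cdot> b i)" using assms that unfolding frame_def by blast
    also have "\<dots> \<in> span (b ` I)"
      by (intro span_sum span_scale span_base imageI)
    finally show ?thesis .
  qed
  then show ?thesis using assms by (auto simp: fin_dim_def frame_def)
qed

text \<open>Factor \<open>P\<close> into a map onto its image followed by the inclusion, and swap
  the factors: the trace becomes that of the identity on the image, where each basis vector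
  contributes 1.\<close>

lemma frame_trace_idempotent:
  assumes f: "frame U I b \<phi>" and P: "lin_on U P" "P ` U \<subseteq> U" "\<And>u. u \<in> U \<Longrightarrow> P (P u) = P u"
  shows "(\<Sum>i\<in>I. \<phi> i (P (b i))) = of_nat (dim (P ` U))"
proof -
  have PU: "fin_dim (P ` U)" using fin_dim_image(1)[OF P(1) frame_fin_dim[OF f]] .
  obtain B where B: "finite B" "independent B" "span B = P ` U" "card B = dim (P ` U)" "B \<subseteq> P ` U"
    using fin_dim_basis[OF PU] .
  have "(\<Sum>i\<in>I. \<phi> i (P (b i))) = (\<Sum>c\<in>B. representation B (P c) c)"
    using frame_trace_commute[OF f, of "P ` U" B "\<lambda>b. b" "\<lambda>b u. representation B u b" P "\<lambda>x. x"]
      frame_basis[OF B(1,2)] P lin_on_id by (simp add: B(3))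
  also have "\<dots> = (\<Sum>c\<in>B. 1)"
  proof (rule sum.cong[OF refl])
    fix c assume c: "c \<in> B"
    then have "c \<in> P ` U" using B(3) span_base by blast
    then have "P c = c" using P by auto
    then show "representation B (P c) c = 1" using representation_basis[OF B(2) c] by simp
  qed
  finally show ?thesis using B by simp
qed

lemma frame_trace_id: "frame U I b \<phi> \<Longrightarrow> (\<Sum>i\<in>I. \<phi> i (b i)) = of_nat (dim U)"
  using frame_trace_idempotent[of U I b \<phi> "\<lambda>x. x"] lin_on_id by simp

lemma dim_mono_fin:
  assumes "fin_dim U" "subspace S" "S \<subseteq> U"
  shows "dim S \<le> dim U"
proof -
  obtain B where B: "finite B" "independent B" "span B = U" "card B = dim U" "B \<subseteq> U"
    using fin_dim_basis[OF assms(1)] .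
  then show ?thesis using dim_le_card[of S B] assms by auto
qed

lemma dim_strict_mono_fin:
  assumes "fin_dim U" "subspace S" "S \<subset> U"
  shows "dim S < dim U"
proof -
  have S: "fin_dim S" using fin_dim_mono[OF assms(1,2)] assms(3) by blast
  obtain B where B: "finite B" "independent B" "span B = S" "card B = dim S" "B \<subseteq> S"
    using fin_dim_basis[OF S] .
  obtain x where x: "x \<in> U" "x \<notin> S" using assms by blast
  have "independent (insert x B)" using independent_insertI B x by auto
  moreover have "span (insert x B) \<subseteq> U"
    using span_minimal[of "insert x B" U] x B assms span_superset[of B] fin_dim_subspace by auto
  ultimately have "card (insert x B) \<le> dim U"
    using dim_mono_fin[OF assms(1) subspace_span[of "insert x B"]]
      dim_span_eq_card_independent[of "insert x B"] by simp
  moreover have "x \<notin> B" using x B span_base by blast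
  ultimately show ?thesis using B by simp
qed

lemma dim_eq_0_fin: "fin_dim U \<Longrightarrow> dim U = 0 \<longleftrightarrow> U = {0}"
proof -
  assume U: "fin_dim U"
  obtain B where B: "finite B" "independent B" "span B = U" "card B = dim U" "B \<subseteq> U"
    using fin_dim_basis[OF U] .
  show ?thesis
  proof
    assume "dim U = 0"
    then have "B = {}" using B by simp
    then show "U = {0}" using B by simp
  next
    assume "U = {0}"
    then have "B \<subseteq> {0}" using B span_superset[of B] by simp
    moreover have "0 \<notin> B" using B(2) dependent_zero by blast
    ultimately have "B = {}" by blast
    then show "dim U = 0" using B by simp
  qed
qed

section \<open>Direct sums\<close>

text \<open>Bijectivity of the summation map on extensional families, in the shape used by
  \<open>indecomposable_decomposition\<close>.\<close>

definition direct_sum :: "'i set \<Rightarrow> ('i \<Rightarrow> 'b set) \<Rightarrow> 'b set \<Rightarrow> bool" where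
  "direct_sum I U W \<longleftrightarrow> bij_betw (\<lambda>u. \<Sum>i\<in>I. u i) (Pi\<^sub>E I U) W"

lemma direct_sum_unique:
  assumes "direct_sum I U W" "\<And>i. i \<in> I \<Longrightarrow> u i \<in> U i" "\<And>i. i \<in> I \<Longrightarrow> v i \<in> U i"
    and "(\<Sum>i\<in>I. u i) = (\<Sum>i\<in>I. v i)" "i \<in> I"
  shows "u i = v i"
proof -
  have "inj_on (\<lambda>u. \<Sum>i\<in>I. u i) (Pi\<^sub>E I U)"
    using assms(1) by (simp add: direct_sum_def bij_betw_def)
  moreover have "restrict u I \<in> Pi\<^sub>E I U" "restrict v I \<in> Pi\<^sub>E I U"
    using assms by auto
  moreover have "(\<Sum>i\<in>I. restrict u I i) = (\<Sum>i\<in>I. restrict v I i)" using assms(4) by simp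
  ultimately have "restrict u I = restrict v I" by (blast dest: inj_onD)
  then show ?thesis using assms(5) by (metis restrict_apply')
qed

lemma direct_sum_sum_mem:
  assumes "direct_sum I U W" "\<And>i. i \<in> I \<Longrightarrow> u i \<in> U i"
  shows "(\<Sum>i\<in>I. u i) \<in> W"
proof -
  have "restrict u I \<in> Pi\<^sub>E I U" using assms by auto
  then have "(\<Sum>i\<in>I. restrict u I i) \<in> W"
    using assms(1) unfolding direct_sum_def bij_betw_def by blast
  then show ?thesis by simp
qed

lemma direct_sum_projections:
  assumes "direct_sum I U W" "subspace W" "\<And>i. i \<in> I \<Longrightarrow> subspace (U i)"
  obtains \<pi> where "\<And>i w. i \<in> I \<Longrightarrow> w \<in> W \<Longrightarrow> \<pi> i w \<in> U i"
    and "\<And>w. w \<in> W \<Longrightarrow> w = (\<Sum>i\<in>I. \<pi> i w)"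
    and "\<And>i. i \<in> I \<Longrightarrow> lin_on W (\<pi> i)"
proof
  let ?s = "\<lambda>u. \<Sum>i\<in>I. u i"
  define \<pi> where "\<pi> i w = inv_into (Pi\<^sub>E I U) ?s w i" for i w
  have im: "?s ` (Pi\<^sub>E I U) = W" using assms(1) by (simp add: direct_sum_def bij_betw_def)
  show *: "\<pi> i w \<in> U i" if "i \<in> I" "w \<in> W" for i w
    using inv_into_into[of w ?s "Pi\<^sub>E I U"] that unfolding im \<pi>_def by (auto simp: PiE_iff)
  show **: "w = (\<Sum>i\<in>I. \<pi> i w)" if "w \<in> W" for w
    using f_inv_into_f[of w ?s "Pi\<^sub>E I U"] that unfolding im \<pi>_def by simp
  show "lin_on W (\<pi> i)" if i: "i \<in> I" for i
    unfolding lin_on_def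
  proof (intro conjI ballI allI)
    fix u v assume uv: "u \<in> W" "v \<in> W"
    then have uv': "u + v \<in> W" using subspace_add[OF assms(2)] by blast
    have "(\<Sum>i\<in>I. \<pi> i (u + v)) = (\<Sum>i\<in>I. \<pi> i u + \<pi> i v)"
      using **[OF uv(1)] **[OF uv(2)] **[OF uv'] by (simp add: sum.distrib)
    moreover have "\<pi> i u + \<pi> i v \<in> U i" if "i \<in> I" for i
      using *[OF that] uv subspace_add[OF assms(3)[OF that]] by blast
    ultimately show "\<pi> i (u + v) = \<pi> i u + \<pi> i v"
      using direct_sum_unique[OF assms(1), of "\<lambda>i. \<pi> i (u + v)" "\<lambda>i. \<pi> i u + \<pi> i v"] *[OF _ uv'] i
      by blast
  next
    fix c u assume u: "u \<in> W"
    then have u': "c \<cdot> u \<in> W" using subspace_scale[OF assms(2)] by blast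
    have "(\<Sum>i\<in>I. \<pi> i (c \<cdot> u)) = (\<Sum>i\<in>I. c \<cdot> \<pi> i u)"
      using **[OF u] **[OF u'] by (simp add: scale_sum_right[symmetric])
    moreover have "c \<cdot> \<pi> i u \<in> U i" if "i \<in> I" for i
      using *[OF that] u subspace_scale[OF assms(3)[OF that]] by blast
    ultimately show "\<pi> i (c \<cdot> u) = c \<cdot> \<pi> i u"
      using direct_sum_unique[OF assms(1), of "\<lambda>i. \<pi> i (c \<cdot> u)" "\<lambda>i. c \<cdot> \<pi> i u"] *[OF _ u'] i
      by blast
  qed
qed

lemma direct_sum_subset:
  assumes "finite I" "direct_sum I U W" "\<And>i. i \<in> I \<Longrightarrow> subspace (U i)" "i \<in> I"
  shows "U i \<subseteq> W"
proof
  fix u assume u: "u \<in> U i"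
  have "(\<Sum>j\<in>I. if j = i then u else 0) \<in> W"
    using assms u by (intro direct_sum_sum_mem[OF assms(2)]) (auto intro: subspace_0)
  then show "u \<in> W" using assms by simp
qed

lemma direct_sum_proj_component:
  assumes I: "finite I" and W: "direct_sum I U W" and U: "\<And>i. i \<in> I \<Longrightarrow> subspace (U i)"
    and p: "\<And>i w. i \<in> I \<Longrightarrow> w \<in> W \<Longrightarrow> \<pi> i w \<in> U i" "\<And>w. w \<in> W \<Longrightarrow> w = (\<Sum>i\<in>I. \<pi> i w)"
    and i: "i \<in> I" and u: "u \<in> U i"
  shows "\<pi> i u = u"
proof -
  have uW: "u \<in> W" using direct_sum_subset[OF I W U i] u by blast
  have "(\<Sum>j\<in>I. \<pi> j u) = (\<Sum>j\<in>I. if j = i then u else 0)"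
    using p(2)[OF uW] I i by simp
  moreover have "(if j = i then u else 0) \<in> U j" if "j \<in> I" for j
    using u subspace_0[OF U[OF that]] by simp
  ultimately have "\<pi> i u = (if i = i then u else 0)"
    using direct_sum_unique[OF W, of "\<lambda>j. \<pi> j u" "\<lambda>j. if j = i then u else 0" i] p(1)[OF _ uW] i
    by blast
  then show ?thesis by simp
qed

text \<open>Bases of the summands, with coordinates read off after projecting, form a frame of
  \<open>W\<close> indexed by pairs; the trace of the identity counts the pairs.\<close>

lemma dim_direct_sum:
  assumes I: "finite I" and W: "direct_sum I U W" "fin_dim W" and U: "\<And>i. i \<in> I \<Longrightarrow> subspace (U i)"
  shows "dim W = (\<Sum>i\<in>I. dim (U i))"
proof -
  note sW = fin_dim_subspace[OF W(2)]
  obtain \<pi> where p: "\<And>i w. i \<in> I \<Longrightarrow> w \<in> W \<Longrightarrow> \<pi> i w \<in> U i"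
    "\<And>w. w \<in> W \<Longrightarrow> w = (\<Sum>i\<in>I. \<pi> i w)" "\<And>i. i \<in> I \<Longrightarrow> lin_on W (\<pi> i)"
    using direct_sum_projections[OF W(1) sW U] by metis
  have fU: "fin_dim (U i)" if "i \<in> I" for i
    using fin_dim_mono[OF W(2) U[OF that] direct_sum_subset[OF I W(1) U that]] .
  have "\<exists>B. finite B \<and> independent B \<and> span B = U i \<and> card B = dim (U i)" if "i \<in> I" for i
    using fin_dim_basis[OF fU[OF that]] by metis
  then obtain B where B: "finite (B i)" "independent (B i)" "span (B i) = U i" "card (B i) = dim (U i)"
    if "i \<in> I" for i by metis
  let ?b = "\<lambda>(i, b). b" and ?\<phi> = "\<lambda>(i, b) w. representation (B i) (\<pi> i w) b"
  have BW: "b \<in> U i" if "i \<in> I" "b \<in> B i" for i b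
    using B(3)[OF that(1)] that(2) span_base by blast
  have "frame W (Sigma I B) ?b ?\<phi>"
    unfolding frame_def
  proof (intro conjI ballI)
    show "finite (Sigma I B)" using I B by auto
    show "?b ` Sigma I B \<subseteq> W" using BW direct_sum_subset[OF I W(1) U] by auto
    show "functional_on W (?\<phi> x)" if x: "x \<in> Sigma I B" for x
    proof -
      obtain i b where ib: "x = (i, b)" "i \<in> I" "b \<in> B i" using x by auto
      show ?thesis
        using p(1)[OF ib(2)] p(3)[OF ib(2)] B[OF ib(2)] ib(1)
        by (auto simp: functional_on_def lin_on_def representation_add representation_scale)
    qed
    show "w = (\<Sum>x\<in>Sigma I B. ?\<phi> x w \<cdot> ?b x)" if w: "w \<in> W" for w
    proof -
      have "(\<Sum>x\<in>Sigma I B. ?\<phi> x w \<cdot> ?b x) = (\<Sum>i\<in>I. \<Sum>b\<in>B i. representation (B i) (\<pi> i w) b \<cdot> b)"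
        using I B by (subst sum.Sigma) (auto intro!: sum.cong)
      also have "\<dots> = (\<Sum>i\<in>I. \<pi> i w)"
        using p(1)[OF _ w] B by (intro sum.cong refl sum_representation_eq) auto
      finally show ?thesis using p(2)[OF w] by simp
    qed
  qed (rule sW)
  from frame_trace_id[OF this] have "of_nat (dim W) = (\<Sum>x\<in>Sigma I B. ?\<phi> x (?b x))"
    by (rule sym)
  also have "\<dots> = (\<Sum>i\<in>I. \<Sum>b\<in>B i. representation (B i) (\<pi> i b) b)"
    using I B by (subst sum.Sigma) (auto intro!: sum.cong)
  also have "\<dots> = (\<Sum>i\<in>I. \<Sum>b\<in>B i. 1)"
  proof (intro sum.cong refl)
    fix i b assume ib: "i \<in> I" "b \<in> B i"
    have "\<pi> i b = b"
      using direct_sum_proj_component[OF I W(1) U p(1,2) ib(1) BW[OF ib]] .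
    then show "representation (B i) (\<pi> i b) b = 1"
      using representation_basis[OF B(2)[OF ib(1)] ib(2)] by simp
  qed
  also have "\<dots> = of_nat (\<Sum>i\<in>I. dim (U i))" using B by simp
  finally show ?thesis by (simp only: of_nat_eq_iff)
qed

lemma direct_sum_image:
  assumes W: "direct_sum I U W" "subspace W" and U: "\<And>i. i \<in> I \<Longrightarrow> subspace (U i)" "finite I"
    and T: "lin_on W T" "\<And>i. i \<in> I \<Longrightarrow> T ` U i \<subseteq> U i"
  shows "direct_sum I (\<lambda>i. T ` U i) (T ` W)"
  unfolding direct_sum_def bij_betw_def
proof
  have "Pi\<^sub>E I (\<lambda>i. T ` U i) \<subseteq> Pi\<^sub>E I U" using T(2) by (intro PiE_mono) auto
  then show "inj_on (\<lambda>u. \<Sum>i\<in>I. u i) (Pi\<^sub>E I (\<lambda>i. T ` U i))"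
    using W(1) inj_on_subset unfolding direct_sum_def bij_betw_def by blast
  have UW: "U i \<subseteq> W" if "i \<in> I" for i using direct_sum_subset[OF U(2) W(1) U(1) that] .
  show "(\<lambda>u. \<Sum>i\<in>I. u i) ` (Pi\<^sub>E I (\<lambda>i. T ` U i)) = T ` W"
  proof (intro equalityI subsetI)
    fix x assume "x \<in> (\<lambda>u. \<Sum>i\<in>I. u i) ` (Pi\<^sub>E I (\<lambda>i. T ` U i))"
    then obtain u where u: "u \<in> Pi\<^sub>E I (\<lambda>i. T ` U i)" "x = (\<Sum>i\<in>I. u i)" by auto
    then have "\<forall>i\<in>I. \<exists>v. v \<in> U i \<and> u i = T v" by (auto simp: PiE_iff)
    then obtain v where v: "\<And>i. i \<in> I \<Longrightarrow> v i \<in> U i" "\<And>i. i \<in> I \<Longrightarrow> u i = T (v i)" by metis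
    have "v i \<in> W" if "i \<in> I" for i using v(1)[OF that] UW[OF that] by blast
    from lin_on_apply_sum'[OF T(1) W(2), of I v, OF this] have "x = T (\<Sum>i\<in>I. v i)"
      using v(2) u(2) by simp
    then show "x \<in> T ` W" using direct_sum_sum_mem[OF W(1), of v] v by blast
  next
    fix x assume "x \<in> T ` W"
    then obtain w where w: "w \<in> W" "x = T w" by blast
    then obtain u where u: "u \<in> Pi\<^sub>E I U" "w = (\<Sum>i\<in>I. u i)"
      using W(1) unfolding direct_sum_def bij_betw_def by blast
    then have "x = (\<Sum>i\<in>I. T (u i))"
      using lin_on_apply_sum'[OF T(1) W(2), of I u] UW w by (auto simp: PiE_iff)
    then have "x = (\<Sum>i\<in>I. restrict (\<lambda>i. T (u i)) I i)" by simp
    moreover have "restrict (\<lambda>i. T (u i)) I \<in> Pi\<^sub>E I (\<lambda>i. T ` U i)" using u by (auto simp: PiE_iff)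
    ultimately show "x \<in> (\<lambda>u. \<Sum>i\<in>I. u i) ` (Pi\<^sub>E I (\<lambda>i. T ` U i))" by blast
  qed
qed

lemma dim_image_direct_sum:
  assumes "finite I" "direct_sum I U W" "fin_dim W" "\<And>i. i \<in> I \<Longrightarrow> subspace (U i)"
    and "lin_on W T" "\<And>i. i \<in> I \<Longrightarrow> T ` U i \<subseteq> U i"
  shows "dim (T ` W) = (\<Sum>i\<in>I. dim (T ` U i))"
proof (rule dim_direct_sum[OF assms(1)])
  show "direct_sum I (\<lambda>i. T ` U i) (T ` W)"
    using direct_sum_image[OF assms(2) fin_dim_subspace[OF assms(3)] assms(4,1,5,6)] .
  show "fin_dim (T ` W)" using fin_dim_image(1)[OF assms(5,3)] .
  show "subspace (T ` U i)" if "i \<in> I" for i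
    using subspace_image_lin_on[OF lin_on_mono[OF assms(5) direct_sum_subset[OF assms(1,2,4) that]] assms(4)[OF that]] .
qed

lemma projection_exists:
  assumes "fin_dim U" "subspace X" "X \<subseteq> U"
  obtains p where "lin_on U p" "p ` U \<subseteq> X" "\<And>x. x \<in> X \<Longrightarrow> p x = x"
proof -
  obtain B where B: "finite B" "independent B" "span B = X" "card B = dim X" "B \<subseteq> X"
    using fin_dim_basis[OF fin_dim_mono[OF assms]] .
  obtain B' where B': "B \<subseteq> B'" "B' \<subseteq> U" "independent B'" "U \<subseteq> span B'"
    using maximal_independent_subset_extend[of B U] B assms(3) by blast
  have sU: "span B' = U" using B' span_minimal[OF B'(2) fin_dim_subspace[OF assms(1)]] by blast
  show ?thesis
  proof
    let ?p = "\<lambda>u. \<Sum>b\<in>B. representation B' u b \<cdot> b"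
    show "lin_on U ?p"
      using B'(3) sU
      by (simp add: lin_on_def representation_add representation_scale scale_left_distrib
          sum.distrib scale_sum_right)
    show "?p ` U \<subseteq> X"
    proof clarify
      fix u show "?p u \<in> X" unfolding B(3)[symmetric] by (intro span_sum span_scale span_base)
    qed
    show "?p x = x" if "x \<in> X" for x
    proof -
      have "representation B' x = representation B x"
        using representation_extend[OF B'(3) _ B'(1)] that B(3) by simp
      then show ?thesis using sum_representation_eq[OF B(2) _ B(1) order_refl, of x] that B(3) by simp
    qed
  qed
qed

section \<open>Kernels, linear relations and eigenvectors\<close>

lemma dim_ker_image_bound:
  assumes U: "fin_dim U" and T: "lin_on U T"
  shows "dim U \<le> dim {u \<in> U. T u = 0} + dim (T ` U)"
proof -
  let ?K = "{u \<in> U. T u = 0}"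
  note sU = fin_dim_subspace[OF U]
  have sK: "subspace ?K"
    using T sU lin_on_0[OF T sU] by (auto simp: subspace_def lin_on_def)
  obtain B where B: "finite B" "independent B" "span B = ?K" "card B = dim ?K" "B \<subseteq> ?K"
    using fin_dim_basis[OF fin_dim_mono[OF U sK]] by blast
  obtain C where C: "finite C" "independent C" "span C = T ` U" "card C = dim (T ` U)" "C \<subseteq> T ` U"
    using fin_dim_basis[OF fin_dim_image(1)[OF T U]] .
  obtain g where g: "\<And>c. c \<in> C \<Longrightarrow> g c \<in> U" "\<And>c. c \<in> C \<Longrightarrow> T (g c) = c"
    using C(5) by (metis (no_types, lifting) f_inv_into_f inv_into_into subsetD)
  have "U \<subseteq> span (B \<union> g ` C)"
  proof
    fix u assume u: "u \<in> U"
    let ?v = "\<Sum>c\<in>C. representation C (T u) c \<cdot> g c"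
    have "T u = (\<Sum>c\<in>C. representation C (T u) c \<cdot> c)"
      using sum_representation_eq[OF C(2) _ C(1) order_refl] u C(3) by simp
    also have "\<dots> = T ?v"
      using lin_on_apply_sum[OF T sU, of C g] g by simp
    finally have Tv: "T u = T ?v" .
    have vU: "?v \<in> U" using g by (intro subspace_sum subspace_scale sU) auto
    have "u - ?v \<in> U" using subspace_diff[OF sU u vU] .
    moreover have "T (u - ?v) = 0"
    proof -
      have "T u = T (u - ?v) + T ?v" using T \<open>u - ?v \<in> U\<close> vU unfolding lin_on_def
        by (metis diff_add_cancel)
      then show ?thesis using Tv by simp
    qed
    ultimately have "u - ?v \<in> span B" using B(3) by blast
    then have "u - ?v \<in> span (B \<union> g ` C)" using span_mono[of B "B \<union> g ` C"] by blast
    moreover have "?v \<in> span (B \<union> g ` C)"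
      by (intro span_sum span_scale span_base) auto
    ultimately show "u \<in> span (B \<union> g ` C)" using span_add by fastforce
  qed
  then have "dim U \<le> card (B \<union> g ` C)" using dim_le_card B C by blast
  also have "\<dots> \<le> card B + card C"
    using card_Un_le[of B "g ` C"] card_image_le[OF C(1), of g] by linarith
  finally show ?thesis using B C by simp
qed

lemma linear_relation:
  assumes "fin_dim U" "\<And>i. i < n \<Longrightarrow> x i \<in> U" "dim U < n"
  obtains c where "(\<Sum>i<n. c i \<cdot> x i) = 0" "\<exists>i<n. c i \<noteq> 0"
proof (cases "inj_on x {..<n}")
  case True
  obtain B where B: "finite B" "independent B" "span B = U" "card B = dim U" "B \<subseteq> U"
    using fin_dim_basis[OF assms(1)] .
  have "dependent (x ` {..<n})"
    using independent_span_bound[OF B(1), of "x ` {..<n}"] assms B card_image[OF True] by force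
  then obtain u where u: "\<exists>v\<in>x ` {..<n}. u v \<noteq> 0" "(\<Sum>v\<in>x ` {..<n}. u v \<cdot> v) = 0"
    using dependent_finite[of "x ` {..<n}"] by auto
  have "(\<Sum>i<n. u (x i) \<cdot> x i) = 0"
    using u(2) by (simp add: sum.reindex[OF True])
  then show ?thesis using that[of "\<lambda>i. u (x i)"] u(1) by auto
next
  case False
  then obtain i j where ij: "i < n" "j < n" "i \<noteq> j" "x i = x j" by (auto simp: inj_on_def)
  let ?c = "\<lambda>k. if k = i then 1 else if k = j then -1 else (0 :: complex)"
  have "(\<Sum>k<n. ?c k \<cdot> x k) = (\<Sum>k<n. (if k = i then x i else 0) - (if k = j then x j else 0))"
    using ij by (intro sum.cong) auto
  also have "\<dots> = 0" using ij by (simp add: sum_subtractf)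
  finally have "(\<Sum>k<n. ?c k \<cdot> x k) = 0" .
  moreover have "?c i \<noteq> 0" by simp
  ultimately show ?thesis using that[of ?c] ij(1) by blast
qed

text \<open>A linear relation among \<open>v, T v, T^2 v, ...\<close> is a nonzero polynomial
  \<open>p\<close> with \<open>p(T) v = 0\<close>. Roots are split off one at a time; if
  \<open>p = (X - z) q\<close>, then either \<open>q(T) v\<close> is an eigenvector for
  \<open>z\<close>, or it is 0 and \<open>q\<close> takes the place of \<open>p\<close>.\<close>

lemma eigenvector_exists:
  assumes J: "fin_dim J" "J \<noteq> {0}" and T: "lin_on J T" "T ` J \<subseteq> J"
  obtains c v where "v \<in> J" "v \<noteq> 0" "T v = c \<cdot> v"
proof -
  note sJ = fin_dim_subspace[OF J(1)]
  obtain v where v: "v \<in> J" "v \<noteq> 0" using J sJ subspace_0 by blast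
  define x where "x i = (T ^^ i) v" for i
  have xJ: "x i \<in> J" for i
    unfolding x_def using v T by (induction i) auto
  obtain c where c: "(\<Sum>i<Suc (dim J). c i \<cdot> x i) = 0" "\<exists>i<Suc (dim J). c i \<noteq> 0"
    using linear_relation[OF J(1), of "Suc (dim J)" x] xJ by blast
  \<comment> \<open>\<open>E N p\<close> is \<open>p(T) v\<close> whenever
    \<open>degree p \<le> N\<close>; the bound \<open>N\<close> drops by one together with the
    degree.\<close>
  define E where "E N p = (\<Sum>i\<le>N. coeff p i \<cdot> x i)" for N p
  have EJ: "E N p \<in> J" for N p
    unfolding E_def using xJ by (intro subspace_sum subspace_scale sJ)
  have "\<exists>c v. v \<in> J \<and> v \<noteq> 0 \<and> T v = c \<cdot> v" if "degree p = d" "p \<noteq> 0" "E N p = 0" "d \<le> N" for d p N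
    using that
  proof (induction d arbitrary: p N)
    case 0
    then obtain a where a: "p = [:a:]" using degree_eq_zeroE by blast
    have "E N p = (\<Sum>i\<le>N. if i = 0 then a \<cdot> x 0 else 0)"
      unfolding E_def a by (intro sum.cong) (auto simp: coeff_pCons split: nat.splits)
    then have "a \<cdot> v = 0" using 0 by (simp add: x_def)
    then show ?case using a 0 v by simp
  next
    case (Suc d)
    then obtain N' where N': "N = Suc N'" by (cases N) auto
    have "\<not> constant (poly p)" using Suc.prems by (simp add: constant_degree)
    then obtain z where "poly p z = 0" using fundamental_theorem_of_algebra by blast
    then obtain q where q: "p = [:- z, 1:] * q" using poly_eq_0_iff_dvd by (metis dvd_def)
    have q0: "q \<noteq> 0" using q Suc.prems by auto
    then have dq: "degree q = d" using q Suc.prems by (simp add: degree_mult_eq del: mult_pCons_left)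
    have p: "p = pCons 0 q - smult z q" using q by simp
    have "E N p = (\<Sum>i\<le>N. coeff (pCons 0 q) i \<cdot> x i) - (\<Sum>i\<le>N. coeff (smult z q) i \<cdot> x i)"
      unfolding E_def p by (simp only: coeff_diff scale_left_diff_distrib sum_subtractf)
    also have "(\<Sum>i\<le>N. coeff (pCons 0 q) i \<cdot> x i) = (\<Sum>i\<le>N'. coeff q i \<cdot> T (x i))"
      unfolding N' sum.atMost_Suc_shift by (simp add: x_def)
    also have "\<dots> = T (E N' q)"
      unfolding E_def using lin_on_apply_sum[OF T(1) sJ, of "{..N'}" x "coeff q"] xJ by simp
    also have "(\<Sum>i\<le>N. coeff (smult z q) i \<cdot> x i) = z \<cdot> E N' q"
      using Suc.prems dq unfolding N' E_def by (simp add: scale_sum_right coeff_eq_0)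
    finally have T: "T (E N' q) = z \<cdot> E N' q" using Suc.prems by simp
    show ?case
    proof (cases "E N' q = 0")
      case True
      then show ?thesis using Suc.IH[OF dq q0] Suc.prems N' by simp
    next
      case False
      then show ?thesis using T EJ by blast
    qed
  qed note * = this
  define p where "p = (\<Sum>i\<le>dim J. monom (c i) i)"
  have cp: "coeff p i = (if i \<le> dim J then c i else 0)" for i
    unfolding p_def by (simp add: coeff_sum)
  have "p \<noteq> 0" using c(2) cp by (metis coeff_0 less_Suc_eq_le)
  moreover have "degree p \<le> dim J" by (intro degree_le) (simp add: cp)
  moreover have "E (dim J) p = 0" using c(1) by (simp add: E_def cp lessThan_Suc_atMost)
  ultimately show ?thesis using * that by blast
qed

end

context complex_vector_space
begin

lemma direct_sumI:
  assumes "\<And>i. i \<in> I \<Longrightarrow> subspace (U i)"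
    and zero: "\<And>u i. (\<And>i. i \<in> I \<Longrightarrow> u i \<in> U i) \<Longrightarrow> (\<Sum>i\<in>I. u i) = 0 \<Longrightarrow> i \<in> I \<Longrightarrow> u i = 0"
    and mem: "\<And>u. (\<And>i. i \<in> I \<Longrightarrow> u i \<in> U i) \<Longrightarrow> (\<Sum>i\<in>I. u i) \<in> W"
    and ex: "\<And>w. w \<in> W \<Longrightarrow> \<exists>u. (\<forall>i\<in>I. u i \<in> U i) \<and> w = (\<Sum>i\<in>I. u i)"
  shows "direct_sum I U W"
  unfolding direct_sum_def bij_betw_def
proof
  show "inj_on (\<lambda>u. \<Sum>i\<in>I. u i) (Pi\<^sub>E I U)"
  proof (rule inj_onI)
    fix u v assume uv: "u \<in> Pi\<^sub>E I U" "v \<in> Pi\<^sub>E I U" "(\<Sum>i\<in>I. u i) = (\<Sum>i\<in>I. v i)"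
    show "u = v"
    proof (rule PiE_ext[OF uv(1,2)])
      fix i assume i: "i \<in> I"
      have "u j - v j \<in> U j" if "j \<in> I" for j
        using subspace_diff[OF assms(1)[OF that]] uv that by (auto simp: PiE_iff)
      then have "u i - v i = 0"
        using zero[of "\<lambda>i. u i - v i" i] uv(3) i by (simp add: sum_subtractf)
      then show "u i = v i" by simp
    qed
  qed
  show "(\<lambda>u. \<Sum>i\<in>I. u i) ` (Pi\<^sub>E I U) = W"
  proof (intro equalityI subsetI)
    fix x assume "x \<in> (\<lambda>u. \<Sum>i\<in>I. u i) ` (Pi\<^sub>E I U)"
    then show "x \<in> W" using mem by (auto simp: PiE_iff)
  next
    fix w assume "w \<in> W"
    then obtain u where u: "\<forall>i\<in>I. u i \<in> U i" "w = (\<Sum>i\<in>I. u i)" using ex by blast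
    then have "restrict u I \<in> Pi\<^sub>E I U" "w = (\<Sum>i\<in>I. restrict u I i)" by auto
    then show "w \<in> (\<lambda>u. \<Sum>i\<in>I. u i) ` (Pi\<^sub>E I U)" by blast
  qed
qed

lemma bij_betw_sumI:
  assumes "subspace A" "subspace B" "A \<inter> B = {0}" "A \<subseteq> U" "B \<subseteq> U" "subspace U"
    and "\<And>u. u \<in> U \<Longrightarrow> \<exists>a\<in>A. \<exists>b\<in>B. u = a + b"
  shows "bij_betw (\<lambda>(u, v). u + v) (A \<times> B) U"
  unfolding bij_betw_def
proof
  show "inj_on (\<lambda>(u, v). u + v) (A \<times> B)"
  proof (rule inj_onI, clarify)
    fix a b a' b' assume ab: "a \<in> A" "b \<in> B" "a' \<in> A" "b' \<in> B" "a + b = a' + b'"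
    then have e: "a - a' = b' - b" by (simp add: algebra_simps)
    then have "a - a' \<in> A \<inter> B" using ab subspace_diff assms(1,2) by (metis IntI)
    then show "a = a' \<and> b = b'" using e assms(3) by simp
  qed
  show "(\<lambda>(u, v). u + v) ` (A \<times> B) = U"
    using assms(4,5,7) subspace_add[OF assms(6)] by (auto simp: image_iff subset_iff)
qed

lemma bij_betw_sumD:
  assumes "subspace A" "subspace B" "bij_betw (\<lambda>(u, v). u + v) (A \<times> B) U"
  shows "A \<inter> B = {0}" "A \<subseteq> U" "B \<subseteq> U" "\<And>u. u \<in> U \<Longrightarrow> \<exists>a\<in>A. \<exists>b\<in>B. u = a + b"
    "\<And>a b. a \<in> A \<Longrightarrow> b \<in> B \<Longrightarrow> a + b \<in> U" "\<And>a b. a \<in> A \<Longrightarrow> b \<in> B \<Longrightarrow> a + b = 0 \<Longrightarrow> a = 0 \<and> b = 0"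
proof -
  have inj: "inj_on (\<lambda>(u, v). u + v) (A \<times> B)" and im: "(\<lambda>(u, v). u + v) ` (A \<times> B) = U"
    using assms(3) by (auto simp: bij_betw_def)
  note z = subspace_0[OF assms(1)] subspace_0[OF assms(2)]
  show mem: "a + b \<in> U" if "a \<in> A" "b \<in> B" for a b using im that by force
  show "A \<subseteq> U" using mem[OF _ z(2)] by auto
  show "B \<subseteq> U" using mem[OF z(1)] by auto
  show "\<exists>a\<in>A. \<exists>b\<in>B. u = a + b" if "u \<in> U" for u using im that by force
  show zero: "a = 0 \<and> b = 0" if "a \<in> A" "b \<in> B" "a + b = 0" for a b
    using inj_onD[OF inj, of "(a, b)" "(0, 0)"] that z by simp
  show "A \<inter> B = {0}"
  proof (intro equalityI subsetI)
    fix x assume "x \<in> A \<inter> B"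
    then have "x \<in> A" "- x \<in> B" using subspace_neg[OF assms(2)] by auto
    then show "x \<in> {0}" using zero[of x "- x"] by simp
  qed (use z in auto)
qed

text \<open>The kernel is cut down by one operator at a time; the rank of the next operator on the
  smaller space is at most its rank on \<open>U\<close>. The subspace claim is carried along for the
  induction.\<close>

lemma dim_le_common_kernel:
  assumes "finite F" "fin_dim U" "\<And>t. t \<in> F \<Longrightarrow> lin_on U t"
  shows "dim U \<le> dim {u \<in> U. \<forall>t\<in>F. t u = 0} + (\<Sum>t\<in>F. dim (t ` U)) \<and>
    subspace {u \<in> U. \<forall>t\<in>F. t u = 0}"
  using assms(1,3)
proof (induction F rule: finite_induct)
  case empty
  then show ?case using fin_dim_subspace[OF assms(2)] by simp
next
  case (insert t F)
  let ?K = "{u \<in> U. \<forall>t\<in>F. t u = 0}"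
  have IH: "dim U \<le> dim ?K + (\<Sum>t\<in>F. dim (t ` U))" "subspace ?K" using insert by auto
  have fK: "fin_dim ?K" using fin_dim_mono[OF assms(2) IH(2)] by blast
  have lK: "lin_on ?K t" using insert.prems[of t] lin_on_mono[of U t ?K] by auto
  have eq: "{u \<in> U. \<forall>s\<in>insert t F. s u = 0} = {u \<in> ?K. t u = 0}" by auto
  have "dim ?K \<le> dim {u \<in> ?K. t u = 0} + dim (t ` ?K)" by (rule dim_ker_image_bound[OF fK lK])
  also have "dim (t ` ?K) \<le> dim (t ` U)"
  proof (rule dim_mono_fin)
    show "fin_dim (t ` U)" using fin_dim_image(1)[OF insert.prems assms(2)] by simp
    show "subspace (t ` ?K)" by (rule subspace_image_lin_on[OF lK IH(2)])
  qed auto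
  finally have "dim U \<le> dim {u \<in> ?K. t u = 0} + (\<Sum>t\<in>insert t F. dim (t ` U))"
    using IH insert.hyps by simp
  moreover have "subspace {u \<in> ?K. t u = 0}"
    using IH(2) lK lin_on_0[OF lK IH(2)] unfolding subspace_def lin_on_def by auto
  ultimately show ?case unfolding eq by blast
qed

lemma dim_span_UNION_le:
  assumes "finite F" "\<And>t. t \<in> F \<Longrightarrow> fin_dim (X t)"
  shows "dim (span (\<Union>t\<in>F. X t)) \<le> (\<Sum>t\<in>F. dim (X t))"
proof -
  have "\<forall>t\<in>F. \<exists>B. finite B \<and> span B = X t \<and> card B = dim (X t)"
    using fin_dim_basis[OF assms(2)] by metis
  then obtain B where B: "\<forall>t\<in>F. finite (B t) \<and> span (B t) = X t \<and> card (B t) = dim (X t)"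
    unfolding bchoice_iff by (rule exE)
  have "(\<Union>t\<in>F. X t) \<subseteq> span (\<Union>t\<in>F. B t)"
  proof
    fix x assume "x \<in> (\<Union>t\<in>F. X t)"
    then obtain t where t: "t \<in> F" "x \<in> span (B t)" using B by auto
    then show "x \<in> span (\<Union>t\<in>F. B t)" using span_mono[of "B t" "\<Union>t\<in>F. B t"] by blast
  qed
  then have "span (\<Union>t\<in>F. X t) \<subseteq> span (\<Union>t\<in>F. B t)" by (intro span_minimal) auto
  then have "dim (span (\<Union>t\<in>F. X t)) \<le> card (\<Union>t\<in>F. B t)"
    using assms(1) B by (intro dim_le_card) auto
  also have "\<dots> \<le> (\<Sum>t\<in>F. card (B t))" by (rule card_UN_le[OF assms(1)])
  also have "\<dots> = (\<Sum>t\<in>F. dim (X t))" using B by simp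
  finally show ?thesis .
qed

end

section \<open>The group algebra of the symmetric group\<close>

unbundle permutation_syntax

section \<open>Finitary permutations as an additive group\<close>

text \<open>The product of \<open>Poly_Mapping\<close> is convolution over an additive monoid.
  Writing permutations additively makes \<open>nat perm \<Rightarrow>\<^sub>0 complex\<close> the
  group algebra; \<open>group_add\<close> does not impose commutativity.\<close>

instantiation perm :: (type) group_add
begin

definition zero_perm :: "'a perm" where "zero_perm = 1"
definition plus_perm :: "'a perm \<Rightarrow> 'a perm \<Rightarrow> 'a perm" where "plus_perm f g = f * g"
definition uminus_perm :: "'a perm \<Rightarrow> 'a perm" where "uminus_perm f = inverse f"
definition minus_perm :: "'a perm \<Rightarrow> 'a perm \<Rightarrow> 'a perm" where "minus_perm f g = f * inverse g"

instance
  by standard (simp_all add: zero_perm_def plus_perm_def uminus_perm_def minus_perm_def mult.assoc)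

end

lemma apply_0 [simp]: "0 \<langle>$\<rangle> a = a"
  by (simp add: zero_perm_def)

lemma apply_plus [simp]: "(f + g) \<langle>$\<rangle> a = f \<langle>$\<rangle> (g \<langle>$\<rangle> a)"
  by (simp add: plus_perm_def apply_times)

lemma affected_0 [simp]: "affected 0 = {}"
  by (simp add: zero_perm_def)

lemma affected_uminus [simp]: "affected (- f) = affected f"
  by (simp add: uminus_perm_def)

lemma affected_plus: "affected (f + g) \<subseteq> affected f \<union> affected g"
  by (simp add: plus_perm_def)

definition sym_grp :: "nat \<Rightarrow> nat perm set" where
  "sym_grp n = {p. affected p \<subseteq> {1..n}}"

lemma sym_grp_0 [simp]: "0 \<in> sym_grp n"
  by (simp add: sym_grp_def)

lemma sym_grp_uminus [simp]: "- p \<in> sym_grp n \<longleftrightarrow> p \<in> sym_grp n"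
  by (simp add: sym_grp_def)

lemma sym_grp_plus: "p \<in> sym_grp n \<Longrightarrow> q \<in> sym_grp n \<Longrightarrow> p + q \<in> sym_grp n"
  using affected_plus[of p q] by (auto simp: sym_grp_def)

lemma sym_grp_mono: "m \<le> n \<Longrightarrow> sym_grp m \<subseteq> sym_grp n"
  unfolding sym_grp_def by (auto simp: subset_iff)

lemma bij_betw_sym_grp_permutes: "bij_betw apply (sym_grp n) {p. p permutes {1..n}}"
proof (rule bij_betwI')
  show "apply p = apply q \<longleftrightarrow> p = q" for p q :: "nat perm"
    by (auto intro: perm_eqI)
  show "apply p \<in> {p. p permutes {1..n}}" if "p \<in> sym_grp n" for p
  proof -
    have "apply p x = x" if "x \<notin> {1..n}" for x
      using that \<open>p \<in> sym_grp n\<close> in_affected[of x p] unfolding sym_grp_def by blast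
    moreover have "bij (apply p)" by simp
    ultimately show ?thesis by (auto simp: permutes_def bij_iff)
  qed
  show "\<exists>p\<in>sym_grp n. q = apply p" if "q \<in> {p. p permutes {1..n}}" for q
  proof -
    have q: "q permutes {1..n}" using that by simp
    have a: "{a. q a \<noteq> a} \<subseteq> {1..n}" using q by (auto simp: permutes_def)
    then have "finite {a. q a \<noteq> a}" using finite_subset by blast
    then have "apply (Perm q) = q" using Perm_inverse permutes_bij[OF q] by auto
    then show ?thesis using a
      by (intro bexI[of _ "Perm q"]) (auto simp: sym_grp_def in_affected)
  qed
qed

lemma finite_sym_grp [simp]: "finite (sym_grp n)"
  using bij_betw_finite[OF bij_betw_sym_grp_permutes[of n]] finite_permutations[of "{1..n}"] by simp

lemma bij_betw_sym_grp_add: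
  assumes "h \<in> sym_grp n"
  shows "bij_betw (\<lambda>g. g + h) (sym_grp n) (sym_grp n)" "bij_betw (\<lambda>g. h + g) (sym_grp n) (sym_grp n)"
proof -
  show "bij_betw (\<lambda>g. g + h) (sym_grp n) (sym_grp n)"
    using assms by (intro bij_betwI[of _ _ _ "\<lambda>g. g - h"])
      (auto simp: sym_grp_plus add.assoc diff_conv_add_uminus simp del: add_uminus_conv_diff)
  show "bij_betw (\<lambda>g. h + g) (sym_grp n) (sym_grp n)"
    using assms by (intro bij_betwI[of _ _ _ "\<lambda>g. - h + g"])
      (auto simp: sym_grp_plus add.assoc[symmetric])
qed

section \<open>Conjugating a permutation to its inverse\<close>

text \<open>On each cycle, the reflection about a base point conjugates \<open>g\<close> to its
  inverse. Taking \<open>a\<close> as the base point of its own cycle makes the reflection fix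
  \<open>a\<close>.\<close>

lemma conjugate_to_inverse_fixing:
  fixes g :: "'a perm"
  obtains h where "h \<langle>$\<rangle> a = a" "affected h \<subseteq> affected g" "h + g - h = - g"
proof -
  \<comment> \<open>\<open>b x\<close> is the base point of the cycle of \<open>x\<close>: the point
    \<open>a\<close> on the cycle of \<open>a\<close>, an arbitrary choice on the others.\<close>
  define b where "b x = (let R = orbit g x in if a \<in> R then a else SOME y. y \<in> R)" for x
  have b_orbit: "b x \<in> orbit g x" for x
    using someI[of "\<lambda>y. y \<in> orbit g x", OF in_orbit_self] by (simp add: b_def Let_def)
  have b_cong: "b y = b x" if "y \<in> orbit g x" for x y
    using orbit_equiv[OF that] by (simp add: b_def)
  have b_a: "b a = a" by (simp add: b_def)
  have b_pow: "b ((g ^ n) \<langle>$\<rangle> x) = b x" "b ((inverse g ^ n) \<langle>$\<rangle> x) = b x" for n x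
  proof -
    show "b ((g ^ n) \<langle>$\<rangle> x) = b x" by (rule b_cong) (rule apply_power_self_in_orbit)
    show "b ((inverse g ^ n) \<langle>$\<rangle> x) = b x"
      using b_cong apply_power_self_in_orbit[of "inverse g" n x] by (simp only: orbit_inverse)
  qed
  have ex: "\<exists>n. (g ^ n) \<langle>$\<rangle> (b x) = x" for x
  proof -
    have "x \<in> orbit g (b x)" unfolding orbit_equiv[OF b_orbit] by (rule in_orbit_self)
    then show ?thesis by (elim in_orbitE) (rule exI, erule sym)
  qed
  define k where "k x = (SOME n. (g ^ n) \<langle>$\<rangle> (b x) = x)" for x
  have k: "(g ^ k x) \<langle>$\<rangle> (b x) = x" for x
    unfolding k_def using someI_ex[OF ex] .
  define h where "h x = (inverse g ^ k x) \<langle>$\<rangle> (b x)" for x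
  \<comment> \<open>The exponent \<open>k x\<close> is an arbitrary choice. Two exponents that reach
    the same point from the base point also do so backwards, so the value of \<open>h\<close> does
    not depend on it.\<close>
  have h: "h ((g ^ n) \<langle>$\<rangle> (b x)) = (inverse g ^ n) \<langle>$\<rangle> (b x)" for n x
  proof -
    let ?y = "(g ^ n) \<langle>$\<rangle> (b x)"
    have bb: "b ?y = b x" using b_pow(1)[of n "b x"] b_cong[OF b_orbit, of x] by (rule trans)
    have "(g ^ k ?y) \<langle>$\<rangle> (b x) = (g ^ n) \<langle>$\<rangle> (b x)" using k[of ?y] unfolding bb .
    then have "(inverse g ^ k ?y) \<langle>$\<rangle> (b x) = (inverse g ^ n) \<langle>$\<rangle> (b x)"
      by (simp add: apply_power_eq_iff)
    then show ?thesis unfolding h_def bb .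
  qed
  \<comment> \<open>On a single cycle \<open>g^-1\<close> agrees with the power of \<open>g\<close>
    whose exponent is the length of the cycle minus one. So a value of \<open>h\<close>, given by
    backward steps, can be rewritten in forward steps and fed into \<open>h\<close> again.\<close>
  have inv_pow: "\<exists>m. \<forall>y\<in>orbit g x. (inverse g ^ n) \<langle>$\<rangle> y = (g ^ m) \<langle>$\<rangle> y" for n x
  proof -
    let ?m = "(order g x - 1) * n"
    have ord: "order g y = order g x" if "y \<in> orbit g x" for y
      using orbit_equiv[OF that] by (simp only: order_def comp_def)
    have 1: "(inverse g) \<langle>$\<rangle> y = (g ^ (order g x - 1)) \<langle>$\<rangle> y" if "y \<in> orbit g x" for y
      by (simp only: apply_inverse_eq_apply_power_order_minus_one ord[OF that])
    have "(inverse g ^ n) \<langle>$\<rangle> y = (g ^ ((order g x - 1) * n)) \<langle>$\<rangle> y" if "y \<in> orbit g x" for y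
    proof (induction n)
      case (Suc n)
      have "(inverse g ^ Suc n) \<langle>$\<rangle> y = inverse g \<langle>$\<rangle> ((inverse g ^ n) \<langle>$\<rangle> y)"
        by (simp only: power_Suc apply_times comp_def)
      also have "\<dots> = inverse g \<langle>$\<rangle> ((g ^ ((order g x - 1) * n)) \<langle>$\<rangle> y)" by (simp only: Suc)
      also have "\<dots> = (g ^ (order g x - 1)) \<langle>$\<rangle> ((g ^ ((order g x - 1) * n)) \<langle>$\<rangle> y)"
        by (rule 1) (use apply_power_self_in_orbit[of g _ y] orbit_equiv[OF that] in blast)
      also have "\<dots> = (g ^ ((order g x - 1) * Suc n)) \<langle>$\<rangle> y"
        by (simp only: apply_sequence power_add[symmetric] mult_Suc_right)
      finally show ?case .
    qed simp
    then show ?thesis by (intro exI ballI)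
  qed
  have hh: "h (h x) = x" for x
  proof -
    obtain m where m: "\<And>y. y \<in> orbit g (b x) \<Longrightarrow> (inverse g ^ k x) \<langle>$\<rangle> y = (g ^ m) \<langle>$\<rangle> y"
      using inv_pow by metis
    have hx: "h x = (g ^ m) \<langle>$\<rangle> (b x)" using m[of "b x"] by (simp add: h_def)
    then have "h (h x) = (inverse g ^ m) \<langle>$\<rangle> (b x)" using h by simp
    also have "b x = (inverse g ^ k x) \<langle>$\<rangle> x"
    proof -
      have "(inverse g ^ k x) \<langle>$\<rangle> x = (inverse g ^ k x) \<langle>$\<rangle> ((g ^ k x) \<langle>$\<rangle> (b x))" using k by simp
      also have "\<dots> = b x" by (simp add: apply_sequence perm_power_inverse)
      finally show ?thesis by simp
    qed
    also have "\<dots> = (g ^ m) \<langle>$\<rangle> x" using m k[of x] by (metis apply_power_self_in_orbit)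
    also have "(inverse g ^ m) \<langle>$\<rangle> \<dots> = x" by (simp add: apply_sequence perm_power_inverse)
    finally show ?thesis .
  qed
  have hfix: "h x = x" if "x \<notin> affected g" for x
  proof -
    have "orbit g x = {x}" using that not_in_affected_iff_orbit_eq_singleton by metis
    then have "b x = x" using b_orbit by auto
    moreover have "(inverse g ^ n) \<langle>$\<rangle> x = x" for n
      using \<open>orbit g x = {x}\<close> apply_power_self_in_orbit[of "inverse g" n x] by simp
    ultimately show ?thesis by (simp add: h_def)
  qed
  have "bij h" using hh by (intro bijI') metis+
  moreover have fin: "finite {x. h x \<noteq> x}" using hfix finite_subset[of "{x. h x \<noteq> x}" "affected g"] by auto
  ultimately have ap: "apply (Perm h) = h" by (simp add: Perm_inverse)
  have "h (g \<langle>$\<rangle> (h x)) = inverse g \<langle>$\<rangle> x" for x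
  proof -
    obtain m where m: "(inverse g ^ k x) \<langle>$\<rangle> (b x) = (g ^ m) \<langle>$\<rangle> (b x)"
      using inv_pow in_orbit_self by metis
    have hx: "h x = (g ^ m) \<langle>$\<rangle> (b x)" using m by (simp add: h_def)
    then have "g \<langle>$\<rangle> (h x) = (g ^ Suc m) \<langle>$\<rangle> (b x)" by (simp add: apply_times)
    then have "h (g \<langle>$\<rangle> (h x)) = (inverse g ^ Suc m) \<langle>$\<rangle> (b x)" using h by metis
    also have "\<dots> = inverse g \<langle>$\<rangle> ((inverse g ^ m) \<langle>$\<rangle> (b x))" by (simp add: apply_times)
    also have "(inverse g ^ m) \<langle>$\<rangle> (b x) = h (h x)" using h hx by simp
    finally show ?thesis using hh by simp
  qed
  then have "Perm h + g + Perm h = - g"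
    by (intro perm_eqI) (simp add: ap uminus_perm_def)
  moreover have "- Perm h = Perm h"
  proof -
    have "Perm h + Perm h = 0" by (intro perm_eqI) (simp add: ap hh)
    then show ?thesis by (simp add: minus_unique)
  qed
  ultimately have "Perm h + g - Perm h = - g" by (metis diff_conv_add_uminus)
  moreover have "h a = a"
    using h[of 0 a] b_a by simp
  moreover have "affected (Perm h) \<subseteq> affected g"
    using hfix by (intro subsetI) (metis ap in_affected)
  ultimately show ?thesis
    using that[of "Perm h"] by (simp add: ap)
qed

text \<open>\<open>S_n\<close> is the stabiliser of the point \<open>n + 1\<close> in
  \<open>S_(n+1)\<close>, so the fixed point is taken to be \<open>Suc n\<close>.\<close>

lemma sym_grp_conjugate_inverse:
  assumes "g \<in> sym_grp (Suc n)"
  obtains h where "h \<in> sym_grp n" "h + g - h = - g"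
proof -
  obtain h where h: "h \<langle>$\<rangle> (Suc n) = Suc n" "affected h \<subseteq> affected g" "h + g - h = - g"
    using conjugate_to_inverse_fixing .
  then have "Suc n \<notin> affected h" by (simp add: in_affected)
  then have "h \<in> sym_grp n"
    using h(2) assms unfolding sym_grp_def by (auto simp: subset_iff le_Suc_eq)
  then show ?thesis using that h by blast
qed

section \<open>The group algebra, its transposition and its conjugation\<close>

type_synonym galg = "nat perm \<Rightarrow>\<^sub>0 complex"

abbreviation coef :: "galg \<Rightarrow> nat perm \<Rightarrow> complex" where "coef \<equiv> Poly_Mapping.lookup"

abbreviation delta :: "nat perm \<Rightarrow> galg" where "delta g \<equiv> Poly_Mapping.single g 1"

abbreviation scalar :: "complex \<Rightarrow> galg" where "scalar c \<equiv> Poly_Mapping.single 0 c"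

lemma galg_induct [case_names single add]:
  fixes a :: galg
  assumes "\<And>g c. P (Poly_Mapping.single g c)" "\<And>a b. P a \<Longrightarrow> P b \<Longrightarrow> P (a + b)"
  shows "P a"
proof (induction a rule: update_induct)
  case const
  then show ?case using assms(1)[of 0 0] by simp
next
  case (update f g c)
  have "Poly_Mapping.update g c f = Poly_Mapping.single g c + f"
    using update(1) by (intro poly_mapping_eqI)
      (auto simp: lookup_update lookup_add lookup_single when_def in_keys_iff)
  then show ?case using assms update by simp
qed

lemma lookup_single_times:
  fixes b :: galg
  shows "coef (Poly_Mapping.single g c * b) k = c * coef b (- g + k)"
proof (induction b rule: galg_induct)
  case (single h d)
  have "g + h = k \<longleftrightarrow> h = - g + k" by (metis add.assoc add.left_neutral left_minus right_minus)
  then show ?case by (simp add: mult_single lookup_single when_def)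
qed (simp add: algebra_simps lookup_add)

lemma lookup_times_single:
  fixes b :: galg
  shows "coef (b * Poly_Mapping.single g c) k = coef b (k - g) * c"
proof (induction b rule: galg_induct)
  case (single h d)
  have "h + g = k \<longleftrightarrow> h = k - g" by (metis add_diff_cancel diff_add_cancel)
  then show ?case by (simp add: mult_single lookup_single when_def)
qed (simp add: algebra_simps lookup_add)

lemma scalar_commute: "scalar c * a = a * scalar c"
  by (intro poly_mapping_eqI) (simp add: lookup_single_times lookup_times_single)

lemma lookup_scalar_times [simp]: "coef (scalar c * a) g = c * coef a g"
  by (simp add: lookup_single_times)

lemma scalar_mult_right: "a * (scalar c * b) = scalar c * (a * b :: galg)"
  by (metis mult.assoc scalar_commute)

lemma scalar_scalar: "scalar c * (scalar d * b) = scalar (c * d) * (b :: galg)"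
  by (simp add: mult.assoc[symmetric] mult_single)

lemma scalar_1: "scalar 1 = 1" by simp

text \<open>All the algebras \<open>C[S_n]\<close> sit inside one algebra of finitely supported
  functions on finitary permutations. The inclusions between them are literal, and an idempotent of
  \<open>C[S_n]\<close> is one of \<open>C[S_(n+1)]\<close> as it stands.\<close>

definition subalg :: "nat \<Rightarrow> galg set" where
  "subalg n = {a. \<forall>g. g \<notin> sym_grp n \<longrightarrow> coef a g = 0}"

lemma subalg_single [simp]: "g \<in> sym_grp n \<Longrightarrow> Poly_Mapping.single g c \<in> subalg n"
  by (auto simp: subalg_def lookup_single when_def)

lemma subalg_0 [simp]: "0 \<in> subalg n" and subalg_1 [simp]: "1 \<in> subalg n"
  using subalg_single[of 0 n 0] subalg_single[of 0 n 1] by auto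

lemma subalg_add [simp]: "a \<in> subalg n \<Longrightarrow> b \<in> subalg n \<Longrightarrow> a + b \<in> subalg n"
  by (auto simp: subalg_def lookup_add)

lemma subalg_sum [simp]: "(\<And>i. i \<in> I \<Longrightarrow> f i \<in> subalg n) \<Longrightarrow> (\<Sum>i\<in>I. f i) \<in> subalg n"
  by (induction I rule: infinite_finite_induct) auto

lemma subalg_expand:
  assumes "a \<in> subalg n"
  shows "a = (\<Sum>g\<in>sym_grp n. Poly_Mapping.single g (coef a g))"
proof (rule poly_mapping_eqI)
  fix k
  have "coef (\<Sum>g\<in>sym_grp n. Poly_Mapping.single g (coef a g)) k
      = (\<Sum>g\<in>sym_grp n. if g = k then coef a k else 0)"
    by (auto simp: lookup_sum lookup_single when_def intro!: sum.cong)
  then show "coef a k = coef (\<Sum>g\<in>sym_grp n. Poly_Mapping.single g (coef a g)) k"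
    using assms by (auto simp: subalg_def)
qed

lemma subalg_mult [simp]:
  assumes "a \<in> subalg n" "b \<in> subalg n"
  shows "a * b \<in> subalg n"
proof -
  have "a * b = (\<Sum>g\<in>sym_grp n. Poly_Mapping.single g (coef a g) * b)"
    using subalg_expand[OF assms(1)] by (metis sum_distrib_right)
  also have "\<dots> = (\<Sum>g\<in>sym_grp n. \<Sum>h\<in>sym_grp n. Poly_Mapping.single (g + h) (coef a g * coef b h))"
    by (subst subalg_expand[OF assms(2)]) (simp add: sum_distrib_left mult_single)
  also have "\<dots> \<in> subalg n" by (intro subalg_sum subalg_single sym_grp_plus)
  finally show ?thesis .
qed

lemma subalg_mono: "m \<le> n \<Longrightarrow> subalg m \<subseteq> subalg n"
  using sym_grp_mono by (fastforce simp: subalg_def)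

interpretation galg: complex_vector_space "\<lambda>c a :: galg. scalar c * a"
  by unfold_locales (simp_all add: distrib_left distrib_right single_add scalar_scalar scalar_1)

lemma galg_fin_dim: "galg.fin_dim (subalg n)"
  unfolding galg.fin_dim_def
proof (intro conjI exI)
  show "galg.subspace (subalg n)"
    by (rule galg.subspaceI) auto
  show "finite (delta ` sym_grp n)" by simp
  show "subalg n \<subseteq> galg.span (delta ` sym_grp n)"
  proof
    fix a assume "a \<in> subalg n"
    then have "a = (\<Sum>g\<in>sym_grp n. scalar (coef a g) * delta g)"
      using subalg_expand[of a n] by (simp add: mult_single)
    also have "\<dots> \<in> galg.span (delta ` sym_grp n)"
      by (intro galg.span_sum galg.span_scale galg.span_base imageI)
    finally show "a \<in> galg.span (delta ` sym_grp n)" .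
  qed
qed

text \<open>The linear anti-automorphism \<open>g \<mapsto> g^-1\<close>. Composed with
  \<open>galg_conj\<close> it is the adjoint for the inner product in which the permutations are
  orthonormal.\<close>

definition galg_transpose :: "galg \<Rightarrow> galg" where
  "galg_transpose a = Poly_Mapping.map_key uminus a"

definition galg_conj :: "galg \<Rightarrow> galg" where
  "galg_conj a = Poly_Mapping.map cnj a"

lemma lookup_galg_transpose [simp]: "coef (galg_transpose a) g = coef a (- g)"
  by (simp add: galg_transpose_def map_key.rep_eq inj_def)

lemma lookup_galg_conj [simp]: "coef (galg_conj a) g = cnj (coef a g)"
  by (simp add: galg_conj_def map.rep_eq when_def)

lemma galg_transpose_add [simp]: "galg_transpose (a + b) = galg_transpose a + galg_transpose b"
  and galg_transpose_0 [simp]: "galg_transpose 0 = 0"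
  and galg_conj_add [simp]: "galg_conj (a + b) = galg_conj a + galg_conj b"
  and galg_conj_conj [simp]: "galg_conj (galg_conj a) = a"
  by (auto intro!: poly_mapping_eqI simp: lookup_add lookup_minus)

lemma galg_transpose_single [simp]: "galg_transpose (Poly_Mapping.single g c) = Poly_Mapping.single (- g) c"
  and galg_conj_single [simp]: "galg_conj (Poly_Mapping.single g c) = Poly_Mapping.single g (cnj c)"
  by (auto intro!: poly_mapping_eqI simp: lookup_single when_def)

lemma galg_transpose_mult [simp]: "galg_transpose (a * b) = galg_transpose b * galg_transpose a"
proof (induction a rule: galg_induct)
  case (single g c)
  then show ?case
    by (induction b rule: galg_induct) (simp_all add: mult_single distrib_left distrib_right minus_add mult.commute)
qed (simp add: distrib_left distrib_right)

lemma galg_conj_mult [simp]: "galg_conj (a * b) = galg_conj a * galg_conj b"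
proof (induction a rule: galg_induct)
  case (single g c)
  then show ?case
    by (induction b rule: galg_induct) (simp_all add: mult_single distrib_left distrib_right)
qed (simp add: distrib_left distrib_right)

lemma galg_transpose_sum: "galg_transpose (\<Sum>i\<in>I. f i) = (\<Sum>i\<in>I. galg_transpose (f i))"
  by (induction I rule: infinite_finite_induct) auto

lemma subalg_conj [simp]: "a \<in> subalg n \<Longrightarrow> galg_conj a \<in> subalg n"
  by (auto simp: subalg_def)

lemma lookup_mult_0:
  assumes "a \<in> subalg n"
  shows "coef (a * b) 0 = (\<Sum>g\<in>sym_grp n. coef a g * coef b (- g))"
proof -
  have "coef (a * b) 0 = coef (\<Sum>g\<in>sym_grp n. Poly_Mapping.single g (coef a g) * b) 0"
    using subalg_expand[OF assms] by (metis sum_distrib_right)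
  then show ?thesis by (simp add: lookup_sum lookup_single_times)
qed

lemma lookup_mult_0_commute: "coef (a * b) 0 = coef (b * a :: galg) 0"
proof (induction a rule: galg_induct)
  case (single g c)
  show ?case by (simp add: lookup_single_times lookup_times_single)
qed (simp add: distrib_left distrib_right lookup_add)

text \<open>The coefficient of 1 in \<open>a\<close> times its adjoint is the sum of the
  \<open>|a(g)|^2\<close>. This positivity is the source of all later statements that a coefficient
  or a product does not vanish.\<close>

lemma lookup_norm_pos:
  assumes "a \<in> subalg n" "a \<noteq> 0"
  obtains r where "r > 0" "coef (a * galg_transpose (galg_conj a)) 0 = complex_of_real r"
proof
  let ?r = "\<Sum>g\<in>sym_grp n. (cmod (coef a g))\<^sup>2"
  show "coef (a * galg_transpose (galg_conj a)) 0 = complex_of_real ?r"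
    by (simp add: lookup_mult_0[OF assms(1)] complex_norm_square del: of_real_power)
  obtain g where "coef a g \<noteq> 0" using assms(2) by (metis lookup_zero poly_mapping_eqI)
  moreover have "g \<in> sym_grp n" using calculation assms(1) by (auto simp: subalg_def)
  ultimately show "?r > 0" by (intro sum_pos2[of _ g]) auto
qed

section \<open>Real symmetric primitive idempotents\<close>

text \<open>The last clause, \<open>e A e = C e\<close>, is primitivity over the complex numbers.
  Reality and symmetry make \<open>e\<close> equal to \<open>e\<close> times its adjoint, so that
  its coefficient of 1 is positive.\<close>

definition primitive :: "nat \<Rightarrow> galg \<Rightarrow> bool" where
  "primitive n e \<longleftrightarrow> e \<in> subalg n \<and> e \<noteq> 0 \<and> e * e = e \<and> galg_transpose e = e \<and> galg_conj e = e \<and>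
     (\<forall>a\<in>subalg n. \<exists>c. e * a * e = scalar c * e)"

lemma scalar_eq_0_iff: "scalar c * (a :: galg) = 0 \<longleftrightarrow> c = 0 \<or> a = 0"
  by (fact galg.scale_eq_0_iff)

lemma delta_add: "delta g * delta h = delta (g + h)"
  by (simp add: mult_single)

lemma delta_uminus_add: "delta (- (g + h)) = delta (- h) * delta (- g)"
  by (simp only: minus_add delta_add)

lemma primitive_coef_uminus:
  assumes "primitive n e"
  shows "coef e (- g) = coef e g"
  using assms lookup_galg_transpose[of e g] by (simp add: primitive_def)

lemma primitive_coef_0:
  assumes "primitive n e"
  obtains r where "r > 0" "coef e 0 = complex_of_real r"
  using lookup_norm_pos[of e n] assms by (auto simp: primitive_def)

lemma primitive_coef_0_neq: "primitive n e \<Longrightarrow> coef e 0 \<noteq> 0"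
  using primitive_coef_0[of n e] by fastforce

text \<open>The scalar is found by comparing coefficients of 1. These are invariant under cyclic
  shifts, so \<open>e g e\<close> has the same one as \<open>e e g = e g\<close>, namely
  \<open>e(g^-1) = e(g)\<close>.\<close>

lemma primitive_sandwich:
  assumes e: "primitive n e" and g: "g \<in> sym_grp n"
  shows "e * delta g * e = scalar (coef e g / coef e 0) * e"
proof -
  have ee: "e * e = e" using e by (simp add: primitive_def)
  obtain c where c: "e * delta g * e = scalar c * e"
    using e subalg_single[OF g] unfolding primitive_def by blast
  have "coef (e * delta g * e) 0 = coef (e * (e * delta g)) 0"
    by (rule lookup_mult_0_commute)
  also have "\<dots> = coef e (- g)" by (simp add: mult.assoc[symmetric] ee lookup_times_single)
  finally have "c * coef e 0 = coef e g"
    by (simp add: c primitive_coef_uminus[OF e])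
  then have "c = coef e g / coef e 0" using primitive_coef_0_neq[OF e] by (simp add: field_simps)
  then show ?thesis using c by simp
qed

text \<open>The sum is central in the group algebra; on a simple module \<open>S\<close> with \<open>e S \<noteq> 0\<close> it acts as this scalar.\<close>

lemma primitive_average:
  assumes e: "primitive n e"
  shows "(\<Sum>h\<in>sym_grp n. delta h * e * delta (- h)) * e = scalar (1 / coef e 0) * e"
proof -
  have ee: "e * e = e" and en: "e \<in> subalg n" using e by (simp_all add: primitive_def)
  have "(\<Sum>h\<in>sym_grp n. delta h * e * delta (- h)) * e
      = (\<Sum>h\<in>sym_grp n. delta h * (e * delta (- h) * e))"
    by (simp add: sum_distrib_right mult.assoc)
  also have "\<dots> = (\<Sum>h\<in>sym_grp n. scalar (1 / coef e 0) * (Poly_Mapping.single h (coef e h) * e))"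
  proof (intro sum.cong refl)
    fix h assume "h \<in> sym_grp n"
    then have "delta h * (e * delta (- h) * e) = delta h * (scalar (coef e h / coef e 0) * e)"
      using primitive_sandwich[OF e, of "- h"] primitive_coef_uminus[OF e] by simp
    also have "\<dots> = scalar (1 / coef e 0) * (Poly_Mapping.single h (coef e h) * e)"
      by (simp add: mult.assoc[symmetric] mult_single)
    finally show "delta h * (e * delta (- h) * e)
      = scalar (1 / coef e 0) * (Poly_Mapping.single h (coef e h) * e)" .
  qed
  also have "\<dots> = scalar (1 / coef e 0) * ((\<Sum>h\<in>sym_grp n. Poly_Mapping.single h (coef e h)) * e)"
    by (simp add: sum_distrib_left sum_distrib_right)
  finally show ?thesis using subalg_expand[OF en] ee by simp
qed

section \<open>Counting the idempotents\<close>

definition sq_form :: "nat \<Rightarrow> galg \<Rightarrow> galg \<Rightarrow> complex" where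
  "sq_form n a b = (\<Sum>g\<in>sym_grp n. coef (a * delta (- g) * b * delta (- g)) 0)"

lemma sq_form_sum: "sq_form n (\<Sum>i\<in>I. f i) (\<Sum>j\<in>J. h j) = (\<Sum>i\<in>I. \<Sum>j\<in>J. sq_form n (f i) (h j))"
proof -
  have "sq_form n (\<Sum>i\<in>I. f i) (\<Sum>j\<in>J. h j)
      = (\<Sum>g\<in>sym_grp n. \<Sum>i\<in>I. \<Sum>j\<in>J. coef (f i * delta (- g) * h j * delta (- g)) 0)"
    unfolding sq_form_def
    by (intro sum.cong refl) (simp add: sum_distrib_left sum_distrib_right lookup_sum, rule sum.swap)
  also have "\<dots> = (\<Sum>i\<in>I. \<Sum>g\<in>sym_grp n. \<Sum>j\<in>J. coef (f i * delta (- g) * h j * delta (- g)) 0)"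
    by (rule sum.swap)
  also have "\<dots> = (\<Sum>i\<in>I. \<Sum>j\<in>J. sq_form n (f i) (h j))"
    unfolding sq_form_def by (intro sum.cong refl sum.swap)
  finally show ?thesis .
qed

text \<open>If \<open>c\<close> is a permutation \<open>h\<close>, the substitution
  \<open>g \<mapsto> g + h\<close> cancels \<open>h\<close> in front of the first
  \<open>delta\<close> and leaves a factor \<open>- h\<close> behind \<open>b\<close>. The general
  case follows by linearity in \<open>c\<close>.\<close>

lemma sq_form_shift:
  assumes "c \<in> subalg n"
  shows "sq_form n (a * c) b = sq_form n a (b * galg_transpose c)"
proof -
  have single: "sq_form n (a * Poly_Mapping.single h d) b = sq_form n a (b * Poly_Mapping.single (- h) d)"
    if h: "h \<in> sym_grp n" for h d
  proof -
    have "sq_form n (a * Poly_Mapping.single h d) b =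
      (\<Sum>g\<in>sym_grp n. coef (a * Poly_Mapping.single h d * delta (- (g + h)) * b * delta (- (g + h))) 0)"
      unfolding sq_form_def
      using sum.reindex_bij_betw[OF bij_betw_sym_grp_add(1)[OF h], symmetric] .
    also have "\<dots> = (\<Sum>g\<in>sym_grp n. coef (a * delta (- g) * (b * Poly_Mapping.single (- h) d) * delta (- g)) 0)"
    proof (intro sum.cong refl)
      fix g
      have "a * Poly_Mapping.single h d * delta (- (g + h)) * b * delta (- (g + h))
         = a * (Poly_Mapping.single h d * delta (- h)) * delta (- g) * b * delta (- h) * delta (- g)"
        by (simp only: delta_uminus_add mult.assoc)
      also have "Poly_Mapping.single h d * delta (- h) = scalar d" by (simp add: mult_single)
      also have "a * scalar d * delta (- g) * b * delta (- h) * delta (- g)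
          = a * delta (- g) * (b * (scalar d * delta (- h))) * delta (- g)"
        by (simp add: mult.assoc scalar_mult_right scalar_commute[symmetric])
      also have "scalar d * delta (- h) = Poly_Mapping.single (- h) d" by (simp add: mult_single)
      finally show "coef (a * Poly_Mapping.single h d * delta (- (g + h)) * b * delta (- (g + h))) 0
          = coef (a * delta (- g) * (b * Poly_Mapping.single (- h) d) * delta (- g)) 0" by simp
    qed
    finally show ?thesis by (simp add: sq_form_def)
  qed
  \<comment> \<open>The singleton index set \<open>{0}\<close> on the idle side turns the double-sum
    formula into linearity in one argument.\<close>
  have "sq_form n (a * c) b = (\<Sum>h\<in>sym_grp n. sq_form n (a * Poly_Mapping.single h (coef c h)) b)"
    using sq_form_sum[of n "\<lambda>h. a * Poly_Mapping.single h (coef c h)" "sym_grp n" "\<lambda>_. b" "{0::nat}"]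
      subalg_expand[OF assms] by (simp add: sum_distrib_left[symmetric])
  also have "\<dots> = (\<Sum>h\<in>sym_grp n. sq_form n a (b * Poly_Mapping.single (- h) (coef c h)))"
    using single by (intro sum.cong) auto
  also have "\<dots> = sq_form n a (b * (\<Sum>h\<in>sym_grp n. Poly_Mapping.single (- h) (coef c h)))"
    using sq_form_sum[of n "\<lambda>_. a" "{0::nat}" "\<lambda>h. b * Poly_Mapping.single (- h) (coef c h)" "sym_grp n"]
    by (simp add: sum_distrib_left[symmetric])
  also have "(\<Sum>h\<in>sym_grp n. Poly_Mapping.single (- h) (coef c h)) = galg_transpose c"
    by (subst (2) subalg_expand[OF assms]) (simp add: galg_transpose_sum)
  finally show ?thesis .
qed

definition primitive_family :: "nat \<Rightarrow> galg set \<Rightarrow> bool" where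
  "primitive_family n E \<longleftrightarrow> finite E \<and> (\<forall>e\<in>E. primitive n e) \<and>
     (\<forall>e\<in>E. \<forall>f\<in>E. e \<noteq> f \<longrightarrow> e * f = 0) \<and> \<Sum>E = 1"

text \<open>
  Since \<open>e\<close>, \<open>f\<close> are fixed by transposition, \<^term>\<open>sq_form n e f\<close> vanishes when \<open>e f = 0\<close>; so the
  value at \<open>(1, 1)\<close>, which counts the solutions of \<open>g\<^sup>2 = 1\<close>, is the sum of the diagonal values.
\<close>

lemma card_primitive_family:
  assumes "primitive_family n E"
  shows "card E = card {g \<in> sym_grp n. g + g = 0}"
proof -
  have fin: "finite E" and E: "\<And>e. e \<in> E \<Longrightarrow> primitive n e" "\<Sum>E = 1"
    and orth: "\<And>e f. e \<in> E \<Longrightarrow> f \<in> E \<Longrightarrow> e \<noteq> f \<Longrightarrow> e * f = 0"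
    using assms by (auto simp: primitive_family_def)
  have off: "sq_form n e f = 0" if "e \<in> E" "f \<in> E" "e \<noteq> f" for e f
  proof -
    have "sq_form n e f = sq_form n (e * e) f" using E(1)[OF that(1)] by (simp add: primitive_def)
    also have "\<dots> = sq_form n e (f * galg_transpose e)"
      using E(1)[OF that(1)] by (intro sq_form_shift) (simp add: primitive_def)
    also have "f * galg_transpose e = 0"
      using E(1)[OF that(1)] orth[OF that(2,1)] that(3) by (simp add: primitive_def)
    finally show ?thesis by (simp add: sq_form_def)
  qed
  \<comment> \<open>By the sandwich formula each summand is \<open>e(g) e(g^-1) / e(1)\<close>, and
    the \<open>e(g) e(g^-1)\<close> add up to the coefficient of 1 in
    \<open>e e = e\<close>.\<close>
  have diag: "sq_form n e e = 1" if "e \<in> E" for e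
  proof -
    note e = E(1)[OF that]
    have ee: "e * e = e" and en: "e \<in> subalg n" using e by (simp_all add: primitive_def)
    have "sq_form n e e = (\<Sum>g\<in>sym_grp n. coef e g * coef e (- g) / coef e 0)"
      unfolding sq_form_def
    proof (intro sum.cong refl)
      fix g assume "g \<in> sym_grp n"
      then have "e * delta (- g) * e = scalar (coef e g / coef e 0) * e"
        using primitive_sandwich[OF e, of "- g"] primitive_coef_uminus[OF e] by simp
      then have "e * delta (- g) * e * delta (- g) = scalar (coef e g / coef e 0) * (e * delta (- g))"
        by (simp add: mult.assoc)
      then show "coef (e * delta (- g) * e * delta (- g)) 0 = coef e g * coef e (- g) / coef e 0"
        by (simp add: lookup_times_single primitive_coef_uminus[OF e])
    qed
    also have "\<dots> = coef (e * e) 0 / coef e 0"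
      by (simp add: lookup_mult_0[OF en] sum_divide_distrib)
    finally show ?thesis using ee primitive_coef_0_neq[OF e] by simp
  qed
  have "of_nat (card E) = (\<Sum>e\<in>E. \<Sum>f\<in>E. if f = e then 1 else (0::complex))"
    using fin by simp
  also have "\<dots> = (\<Sum>e\<in>E. \<Sum>f\<in>E. sq_form n e f)"
    using off diag by (intro sum.cong) auto
  also have "\<dots> = sq_form n 1 1" using sq_form_sum[of n "\<lambda>e. e" E "\<lambda>e. e" E] E(2) by simp
  also have "\<dots> = (\<Sum>g\<in>sym_grp n. if g + g = 0 then 1 else 0)"
    unfolding sq_form_def
  proof (intro sum.cong refl)
    fix g :: "nat perm"
    have "- g + - g = 0 \<longleftrightarrow> g + g = 0" by (metis minus_add neg_equal_0_iff_equal)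
    then show "coef (1 * delta (- g) * 1 * delta (- g)) 0 = (if g + g = 0 then 1 else 0)"
      by (simp add: delta_add lookup_single when_def)
  qed
  also have "\<dots> = of_nat (card {g \<in> sym_grp n. g + g = 0})"
    by (simp add: sum.If_cases Int_def)
  finally show ?thesis by (simp only: of_nat_eq_iff)
qed

section \<open>Refining an idempotent from \<open>S_n\<close> to \<open>S_(n+1)\<close>\<close>

locale primitive_step =
  fixes n e
  assumes prim: "primitive n e"
begin

lemma e: "e * e = e" "e \<in> subalg n" "galg_transpose e = e" "galg_conj e = e" "e \<noteq> 0"
  using prim by (simp_all add: primitive_def)

lemma e_Suc: "e \<in> subalg (Suc n)"
  using e(2) subalg_mono[of n "Suc n"] by auto

definition corner :: "galg set" where
  "corner = {b \<in> subalg (Suc n). e * b = b \<and> b * e = b}"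

lemma corner_mult: "a \<in> corner \<Longrightarrow> b \<in> corner \<Longrightarrow> a * b \<in> corner"
  by (auto simp: corner_def mult.assoc) (metis mult.assoc)

lemma corner_conj: "a \<in> corner \<Longrightarrow> galg_conj a \<in> corner"
  using galg_conj_mult[of e a] galg_conj_mult[of a e] by (auto simp: corner_def e)

lemma corner_subspace: "galg.subspace corner"
  by (rule galg.subspaceI)
    (auto simp: corner_def distrib_left distrib_right scalar_mult_right mult.assoc subalg_mult)

text \<open>The sum \<open>z\<close> of the \<open>S_n\<close>-conjugates of \<open>b\<close>
  commutes with \<open>C[S_n]\<close>, and primitivity of \<open>e\<close> recovers \<open>b\<close>
  as \<open>e(1) z e\<close>. The coefficients of \<open>z\<close> are constant on the
  \<open>S_n\<close>-orbits of conjugation, which are closed under inversion by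
  \<open>sym_grp_conjugate_inverse\<close>; hence \<open>z\<close> is symmetric. Transposing
  \<open>e(1) z e\<close> gives \<open>e(1) e z\<close>, which is the same element.\<close>

lemma corner_transpose:
  assumes b: "b \<in> corner"
  shows "galg_transpose b = b"
proof -
  have bN: "b \<in> subalg (Suc n)" and be: "b * e = b" "e * b = b" using b by (auto simp: corner_def)
  define z where "z = (\<Sum>h\<in>sym_grp n. delta h * b * delta (- h))"
  have zN: "z \<in> subalg (Suc n)"
    unfolding z_def using bN sym_grp_mono[of n "Suc n"]
    by (intro subalg_sum subalg_mult subalg_single) auto
  have "z * e = (\<Sum>h\<in>sym_grp n. delta h * b * (e * delta (- h) * e))"
    by (simp add: z_def sum_distrib_right mult.assoc) (simp add: be mult.assoc[symmetric])
  also have "\<dots> = (\<Sum>h\<in>sym_grp n. scalar (1 / coef e 0) * (Poly_Mapping.single h (coef e h) * b))"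
  proof (intro sum.cong refl)
    fix h assume "h \<in> sym_grp n"
    then have "e * delta (- h) * e = scalar (coef e h / coef e 0) * e"
      using primitive_sandwich[OF prim, of "- h"] primitive_coef_uminus[OF prim] by simp
    then have "delta h * b * (e * delta (- h) * e) = scalar (coef e h / coef e 0) * (delta h * (b * e))"
      by (simp add: scalar_mult_right mult.assoc)
    also have "\<dots> = scalar (1 / coef e 0) * (Poly_Mapping.single h (coef e h) * b)"
      by (simp add: be mult.assoc[symmetric] mult_single)
    finally show "delta h * b * (e * delta (- h) * e)
      = scalar (1 / coef e 0) * (Poly_Mapping.single h (coef e h) * b)" .
  qed
  also have "\<dots> = scalar (1 / coef e 0) * (e * b)"
    by (subst (3) subalg_expand[OF e(2)]) (simp add: sum_distrib_left sum_distrib_right)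
  finally have ze: "scalar (coef e 0) * (z * e) = b"
    using primitive_coef_0_neq[OF prim] be by (simp add: scalar_scalar)
  have conj_z: "delta k * z * delta (- k) = z" if k: "k \<in> sym_grp n" for k
  proof -
    have "delta k * z * delta (- k) = (\<Sum>h\<in>sym_grp n. delta (k + h) * b * delta (- (k + h)))"
      by (simp only: z_def sum_distrib_left sum_distrib_right delta_uminus_add delta_add[symmetric] mult.assoc)
    also have "\<dots> = z" unfolding z_def
      using sum.reindex_bij_betw[OF bij_betw_sym_grp_add(2)[OF k]] .
    finally show ?thesis .
  qed
  then have "delta k * z = z * delta k" if "k \<in> sym_grp n" for k
  proof -
    have "delta k * z * delta (- k) * delta k = z * delta k" using conj_z[OF that] by simp
    then show ?thesis by (simp add: mult.assoc delta_add)
  qed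
  then have "Poly_Mapping.single k c * z = z * Poly_Mapping.single k c" if "k \<in> sym_grp n" for k c
  proof -
    have "Poly_Mapping.single k c = scalar c * delta k" by (simp add: mult_single)
    then show ?thesis
      using \<open>\<And>k. k \<in> sym_grp n \<Longrightarrow> delta k * z = z * delta k\<close>[OF that] by (simp add: mult.assoc scalar_mult_right)
  qed
  then have ez: "e * z = z * e"
    by (subst (1 2) subalg_expand[OF e(2)]) (simp add: sum_distrib_left sum_distrib_right)
  have "galg_transpose z = z"
  proof (rule poly_mapping_eqI)
    fix g
    show "coef (galg_transpose z) g = coef z g"
    proof (cases "g \<in> sym_grp (Suc n)")
      case True
      then obtain h where h: "h \<in> sym_grp n" "h + g - h = - g" by (rule sym_grp_conjugate_inverse)
      have "coef z (- g) = coef (delta h * z * delta (- h)) (h + g - h)"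
        using conj_z[OF h(1)] h(2) by simp
      also have "\<dots> = coef z (- h + ((h + g - h) - - h))"
        by (simp add: lookup_times_single lookup_single_times)
      also have "- h + ((h + g - h) - - h) = g"
        by (simp add: diff_conv_add_uminus add.assoc del: add_uminus_conv_diff)
      finally show ?thesis by simp
    next
      case False
      then show ?thesis using zN by (simp add: subalg_def)
    qed
  qed
  then have "galg_transpose (scalar (coef e 0) * (z * e)) = scalar (coef e 0) * (e * z)"
    by (simp add: e scalar_commute[symmetric])
  then show ?thesis using ze ez by simp
qed

text \<open>Transposition reverses products but fixes every element of the corner, products
  included.\<close>

lemma corner_commute:
  assumes "a \<in> corner" "b \<in> corner"
  shows "a * b = b * a"
  using corner_transpose[OF corner_mult[OF assms]] corner_transpose[OF assms(1)] corner_transpose[OF assms(2)]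
  by simp

definition part :: "galg \<Rightarrow> galg set" where
  "part f = {b \<in> corner. f * b = b}"

lemma part_subspace: "galg.subspace (part f)"
  using corner_subspace unfolding galg.subspace_def part_def
  by (auto simp: distrib_left scalar_mult_right)

lemma part_fin_dim: "galg.fin_dim (part f)"
  by (rule galg.fin_dim_mono[OF galg_fin_dim[of "Suc n"] part_subspace]) (auto simp: part_def corner_def)

text \<open>In the commutative corner, let \<open>J\<close> be a nonzero ideal of least dimension
  below \<open>f\<close>. An eigenspace in \<open>J\<close> of a corner element is again an ideal,
  so every corner element acts on \<open>J\<close> as a scalar. Any real idempotent in
  \<open>J\<close> is then primitive in the larger group algebra, and a multiple of
  \<open>conj(b) b\<close> is one.\<close>

lemma exists_primitive:
  assumes f: "f \<in> corner" "f * f = f" "f \<noteq> 0"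
  obtains f1 where "primitive (Suc n) f1" "f1 \<in> corner" "f * f1 = f1"
proof -
  let ?P = "\<lambda>J. galg.subspace J \<and> J \<subseteq> part f \<and> J \<noteq> {0} \<and> (\<forall>x\<in>corner. \<forall>b\<in>J. x * b \<in> J)"
  have "?P (part f)"
  proof (intro conjI ballI part_subspace order_refl)
    have "f \<in> part f" using f by (simp add: part_def)
    then show "part f \<noteq> {0}" using f(3) by auto
    show "x * b \<in> part f" if "x \<in> corner" "b \<in> part f" for x b
    proof -
      have "f * (x * b) = x * (f * b)" using corner_commute[OF f(1) that(1)] by (metis mult.assoc)
      then show ?thesis using that corner_mult by (auto simp: part_def)
    qed
  qed
  then obtain J where J: "?P J" and min: "\<And>K. ?P K \<Longrightarrow> galg.dim J \<le> galg.dim K"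
    using ex_has_least_nat[of ?P "part f" galg.dim] by blast
  then have sJ: "galg.subspace J" and Jf: "J \<subseteq> part f" and J0: "J \<noteq> {0}"
    and Jinv: "\<And>x b. x \<in> corner \<Longrightarrow> b \<in> J \<Longrightarrow> x * b \<in> J" by blast+
  have fJ: "galg.fin_dim J" using galg.fin_dim_mono[OF part_fin_dim sJ Jf] .
  have Jc: "J \<subseteq> corner" using Jf by (auto simp: part_def)
  have eig: "\<exists>c. \<forall>b\<in>J. x * b = scalar c * b" if x: "x \<in> corner" for x
  proof -
    have lin: "galg.lin_on J ((*) x)" by (simp add: galg.lin_on_def distrib_left scalar_mult_right)
    have im: "(*) x ` J \<subseteq> J" using Jinv[OF x] by auto
    obtain c v where v: "v \<in> J" "v \<noteq> 0" "x * v = scalar c * v"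
      using galg.eigenvector_exists[OF fJ J0 lin im] .
    let ?K = "{b \<in> J. x * b = scalar c * b}"
    have sK: "galg.subspace ?K"
    proof (rule galg.subspaceI)
      show "scalar d * b \<in> ?K" if "b \<in> ?K" for d b
      proof -
        have "x * (scalar d * b) = scalar d * (x * b)" by (rule scalar_mult_right)
        also have "\<dots> = scalar d * (scalar c * b)" using that by simp
        also have "\<dots> = scalar c * (scalar d * b)" by (rule scalar_mult_right)
        finally show ?thesis using that galg.subspace_scale[OF sJ, of b d] by simp
      qed
    qed (use galg.subspace_0[OF sJ] galg.subspace_add[OF sJ] in \<open>auto simp: distrib_left\<close>)
    have "?P ?K"
    proof (intro conjI ballI sK)
      show "?K \<subseteq> part f" using Jf by blast
      show "?K \<noteq> {0}" using v by blast
      show "y * b \<in> ?K" if "y \<in> corner" "b \<in> ?K" for y b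
      proof -
        have "x * (y * b) = y * (x * b)" using corner_commute[OF x that(1)] by (metis mult.assoc)
        also have "\<dots> = y * (scalar c * b)" using that(2) by simp
        also have "\<dots> = scalar c * (y * b)" by (rule scalar_mult_right)
        finally show ?thesis using that Jinv by blast
      qed
    qed
    then have "galg.dim J \<le> galg.dim ?K" by (rule min)
    then have "?K = J" using galg.dim_strict_mono_fin[OF fJ sK] by force
    then show ?thesis by blast
  qed
  obtain b where b: "b \<in> J" "b \<noteq> 0" using J0 galg.subspace_0[OF sJ] by blast
  have bc: "b \<in> corner" "galg_conj b \<in> corner" using b Jc corner_conj by auto
  \<comment> \<open>\<open>r\<close> is real and symmetric, and the coefficients of 1 in
    \<open>r\<close> and in \<open>r r\<close> are both positive, each being a squared norm. So the
    scalar in \<open>r r = c r\<close> is real and nonzero, and \<open>r / c\<close> is an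
    idempotent.\<close>
  define r where "r = galg_conj b * b"
  have rJ: "r \<in> J" unfolding r_def using Jinv[OF bc(2) b(1)] .
  then have rc: "r \<in> corner" using Jc by blast
  have r_conj: "galg_conj r = r" unfolding r_def using corner_commute[OF bc] by simp
  have bN: "b \<in> subalg (Suc n)" "r \<in> subalg (Suc n)" using bc rc by (auto simp: corner_def)
  obtain s where s: "s > 0" "coef r 0 = complex_of_real s"
    using lookup_norm_pos[OF bN(1) b(2)] corner_transpose[OF bc(2)] corner_commute[OF bc] unfolding r_def by metis
  then have r0: "r \<noteq> 0" by auto
  obtain c where c: "r * r = scalar c * r" using eig[OF rc] rJ by blast
  obtain t where t: "t > 0" "coef (r * r) 0 = complex_of_real t"
    using lookup_norm_pos[OF bN(2) r0] corner_transpose[OF rc] r_conj by metis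
  then have cr: "c = complex_of_real (t / s)" using s c by (simp add: field_simps)
  then have c0: "c \<noteq> 0" using s t by simp
  define f1 where "f1 = scalar (1 / c) * r"
  have f1J: "f1 \<in> J" unfolding f1_def using galg.subspace_scale[OF sJ rJ] .
  then have f1c: "f1 \<in> corner" and ff1: "f * f1 = f1" using Jf by (auto simp: part_def)
  have f11: "f1 * f1 = f1"
  proof -
    have "f1 * f1 = scalar (1 / c) * (f1 * r)" unfolding f1_def by (rule scalar_mult_right)
    also have "f1 * r = scalar (1 / c) * (scalar c * r)" unfolding f1_def by (simp add: mult.assoc c)
    finally show ?thesis using c0 unfolding f1_def by (simp add: scalar_scalar)
  qed
  have f10: "f1 \<noteq> 0" unfolding f1_def using c0 r0 by (simp add: scalar_eq_0_iff)
  have "galg_conj f1 = f1" unfolding f1_def by (simp add: r_conj cr)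
  moreover have "galg_transpose f1 = f1" using corner_transpose[OF f1c] .
  moreover have "\<exists>c. f1 * a * f1 = scalar c * f1" if a: "a \<in> subalg (Suc n)" for a
  proof -
    have "e * a * e \<in> corner" unfolding corner_def
      using a e_Suc e(1) by (auto simp: mult.assoc) (metis mult.assoc)
    then obtain k where k: "e * a * e * f1 = scalar k * f1" using eig f1J by blast
    have ef: "f1 * e = f1" "e * f1 = f1" using f1c by (auto simp: corner_def)
    have "f1 * a * f1 = (f1 * e) * a * (e * f1)" by (simp only: ef)
    also have "\<dots> = f1 * (e * a * e * f1)" by (simp only: mult.assoc)
    also have "\<dots> = scalar k * (f1 * f1)" unfolding k by (rule scalar_mult_right)
    also have "f1 * f1 = f1" by (rule f11)
    finally show ?thesis by blast
  qed
  moreover have "f1 \<in> subalg (Suc n)" using f1c by (simp add: corner_def)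
  ultimately have "primitive (Suc n) f1" using f11 f10 by (simp add: primitive_def)
  then show ?thesis using that f1c ff1 by blast
qed

text \<open>Splitting off a primitive \<open>f1\<close> below \<open>f\<close> leaves the idempotent
  \<open>f - f1\<close>, whose ideal no longer contains \<open>f1\<close>; the dimension of
  \<open>part\<close> drops.\<close>

lemma primitive_decomposition:
  assumes "f \<in> corner" "f * f = f"
  shows "\<exists>F. finite F \<and> (\<forall>a\<in>F. primitive (Suc n) a \<and> a \<in> corner \<and> f * a = a) \<and>
     (\<forall>a\<in>F. \<forall>b\<in>F. a \<noteq> b \<longrightarrow> a * b = 0) \<and> \<Sum>F = f"
  using assms
proof (induction "galg.dim (part f)" arbitrary: f rule: less_induct)
  case less
  show ?case
  proof (cases "f = 0")
    case True
    then show ?thesis by (intro exI[of _ "{}"]) simp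
  next
    case False
    obtain f1 where f1: "primitive (Suc n) f1" "f1 \<in> corner" "f * f1 = f1"
      using exists_primitive[OF less.prems False] .
    have f1': "f1 * f1 = f1" "f1 * f = f1" "f1 \<noteq> 0"
      using f1 corner_commute[OF less.prems(1) f1(2)] by (auto simp: primitive_def)
    let ?g = "f - f1"
    have g: "?g \<in> corner" "?g * ?g = ?g" "f * ?g = ?g" "?g * f1 = 0" "f1 * ?g = 0"
      using galg.subspace_diff[OF corner_subspace less.prems(1) f1(2)] f1 f1' less.prems(2)
      by (simp_all add: algebra_simps)
    have sub: "part ?g \<subset> part f"
    proof
      show "part ?g \<subseteq> part f"
        unfolding part_def using g(3) by (auto simp: mult.assoc[symmetric]) (metis mult.assoc)
      have "f1 \<in> part f" using f1 by (simp add: part_def)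
      moreover have "f1 \<notin> part ?g" using g(4) f1'(3) by (simp add: part_def)
      ultimately show "part ?g \<noteq> part f" by blast
    qed
    then have "galg.dim (part ?g) < galg.dim (part f)"
      using galg.dim_strict_mono_fin[OF part_fin_dim part_subspace] by blast
    from less.hyps[OF this g(1,2)] obtain F where F': "finite F \<and>
      (\<forall>a\<in>F. primitive (Suc n) a \<and> a \<in> corner \<and> ?g * a = a) \<and>
      (\<forall>a\<in>F. \<forall>b\<in>F. a \<noteq> b \<longrightarrow> a * b = 0) \<and> \<Sum>F = ?g" by (rule exE)
    have F: "finite F" "\<And>a. a \<in> F \<Longrightarrow> primitive (Suc n) a \<and> a \<in> corner \<and> ?g * a = a"
      "\<And>a b. a \<in> F \<Longrightarrow> b \<in> F \<Longrightarrow> a \<noteq> b \<Longrightarrow> a * b = 0" "\<Sum>F = ?g"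
      using F' by simp_all
    have fa: "f1 * a = 0" "a * f1 = 0" "f * a = a" if "a \<in> F" for a
    proof -
      have ga: "?g * a = a" and ac: "a \<in> corner" using F(2)[OF that] by auto
      have "f1 * (?g * a) = 0" unfolding mult.assoc[symmetric] g(5) by simp
      then show "f1 * a = 0" unfolding ga .
      then show "a * f1 = 0" using corner_commute[OF ac f1(2)] by simp
      have "f * (?g * a) = ?g * a" unfolding mult.assoc[symmetric] g(3) ..
      then show "f * a = a" unfolding ga .
    qed
    have "f1 \<notin> F" using fa(1) f1'(1,3) by auto
    then have "\<Sum>(insert f1 F) = f" using F(1,4) by simp
    moreover have "\<forall>a\<in>insert f1 F. \<forall>b\<in>insert f1 F. a \<noteq> b \<longrightarrow> a * b = 0" using fa F(3) by auto
    moreover have "\<forall>a\<in>insert f1 F. primitive (Suc n) a \<and> a \<in> corner \<and> f * a = a"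
      using f1 F(2) fa(3) by auto
    ultimately show ?thesis using F(1) by (intro exI[of _ "insert f1 F"]) simp
  qed
qed

end

text \<open>Each idempotent of \<open>C[S_n]\<close> is decomposed inside its corner of
  \<open>C[S_(n+1)]\<close>. Pieces \<open>a\<close> of \<open>e\<close> and \<open>b\<close> of
  \<open>f\<close> are orthogonal for \<open>e \<noteq> f\<close>, since
  \<open>a b = a e f b\<close>.\<close>

lemma primitive_family_exists: "\<exists>E. primitive_family n E"
proof (induction n)
  case 0
  have "sym_grp 0 = {0}" by (auto simp: sym_grp_def zero_perm_def)
  then have "a = scalar (coef a 0)" if "a \<in> subalg 0" for a
    using subalg_expand[OF that] by simp
  then have "\<forall>a\<in>subalg 0. \<exists>c. 1 * a * 1 = scalar c * 1" by (metis mult_1 mult_1_right)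
  moreover have "galg_transpose 1 = 1" "galg_conj 1 = 1" using galg_transpose_single[of 0 1] galg_conj_single[of 0 1] by simp_all
  ultimately have "primitive 0 1" unfolding primitive_def by simp
  then show ?case by (intro exI[of _ "{1}"]) (simp add: primitive_family_def)
next
  case (Suc n)
  then obtain E where E: "finite E" "\<And>e. e \<in> E \<Longrightarrow> primitive n e" "\<Sum>E = 1"
    "\<And>e f. e \<in> E \<Longrightarrow> f \<in> E \<Longrightarrow> e \<noteq> f \<Longrightarrow> e * f = 0"
    by (auto simp: primitive_family_def)
  let ?Q = "\<lambda>e F. finite F \<and> (\<forall>a\<in>F. primitive (Suc n) a \<and> e * a = a \<and> a * e = a) \<and>
     (\<forall>a\<in>F. \<forall>b\<in>F. a \<noteq> b \<longrightarrow> a * b = 0) \<and> \<Sum>F = e"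
  have "\<exists>F. ?Q e F" if "e \<in> E" for e
  proof -
    interpret primitive_step n e by standard (rule E(2)[OF that])
    have "e \<in> corner" "e * e = e" using e e_Suc by (auto simp: corner_def)
    from primitive_decomposition[OF this] obtain F where "finite F \<and>
      (\<forall>a\<in>F. primitive (Suc n) a \<and> a \<in> corner \<and> e * a = a) \<and>
      (\<forall>a\<in>F. \<forall>b\<in>F. a \<noteq> b \<longrightarrow> a * b = 0) \<and> \<Sum>F = e" by (rule exE)
    then have "?Q e F" unfolding corner_def by simp
    then show ?thesis by (rule exI)
  qed
  then have "\<forall>e\<in>E. \<exists>F. ?Q e F" by simp
  then obtain F where FQ: "\<forall>e\<in>E. ?Q e (F e)" unfolding bchoice_iff by (rule exE)
  have F1: "finite (F e)" "\<Sum>(F e) = e" if "e \<in> E" for e using FQ that by simp_all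
  have F2: "primitive (Suc n) a" "e * a = a" "a * e = a" if "e \<in> E" "a \<in> F e" for e a
    using FQ that by simp_all
  have F3: "a * b = 0" if "e \<in> E" "a \<in> F e" "b \<in> F e" "a \<noteq> b" for e a b
    using FQ that by simp
  have orth: "a * b = 0" if "e \<in> E" "f \<in> E" "a \<in> F e" "b \<in> F f" "e \<noteq> f" for e f a b
  proof -
    have "a * b = (a * e) * (f * b)" by (simp only: F2[OF that(1,3)] F2[OF that(2,4)])
    also have "\<dots> = a * (e * f) * b" by (simp only: mult.assoc)
    also have "e * f = 0" using E(4) that by blast
    finally show ?thesis by simp
  qed
  have "F e \<inter> F f = {}" if "e \<in> E" "f \<in> E" "e \<noteq> f" for e f
  proof (rule ccontr)
    assume "F e \<inter> F f \<noteq> {}"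
    then obtain a where a: "a \<in> F e" "a \<in> F f" by blast
    then have "a * a = 0" using orth[OF that(1,2) _ _ that(3)] by blast
    moreover have "a * a = a" "a \<noteq> 0" using F2(1)[OF that(1) a(1)] by (simp_all add: primitive_def)
    ultimately show False by simp
  qed
  then have "\<Sum>(\<Union>e\<in>E. F e) = (\<Sum>e\<in>E. \<Sum>(F e))"
    using E(1) F1(1) by (intro sum.UNION_disjoint) auto
  also have "\<dots> = \<Sum>E" using F1(2) by simp
  finally have "\<Sum>(\<Union>e\<in>E. F e) = 1" using E(3) by simp
  moreover have "a * b = 0" if ab: "a \<in> (\<Union>e\<in>E. F e)" "b \<in> (\<Union>e\<in>E. F e)" "a \<noteq> b" for a b
  proof -
    obtain e f where "e \<in> E" "f \<in> E" "a \<in> F e" "b \<in> F f" using ab by blast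
    then show ?thesis using orth F3 ab(3) by (cases "e = f") blast+
  qed
  moreover have "finite (\<Union>e\<in>E. F e)" using E(1) F1(1) by simp
  ultimately have "primitive_family (Suc n) (\<Union>e\<in>E. F e)"
    using F2(1) unfolding primitive_family_def by blast
  then show ?case by (rule exI)
qed

section \<open>The number of solutions of \<open>g^2 = 1\<close>\<close>

definition involutions :: "'a set \<Rightarrow> ('a \<Rightarrow> 'a) set" where
  "involutions A = {p. p permutes A \<and> p \<circ> p = id}"

lemma finite_involutions: "finite A \<Longrightarrow> finite (involutions A)"
  using finite_permutations[of A] by (auto simp: involutions_def intro: finite_subset)

text \<open>The second part collects the involutions that swap \<open>a\<close> with some
  \<open>b\<close>; undoing the swap leaves an involution fixing both \<open>a\<close> and
  \<open>b\<close>.\<close>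

lemma involutions_insert:
  assumes "a \<notin> A"
  shows "involutions (insert a A) =
    involutions A \<union> (\<Union>b\<in>A. (\<lambda>p. Transposition.transpose a b \<circ> p) ` involutions (A - {b}))"
proof (intro equalityI subsetI)
  fix p assume "p \<in> involutions (insert a A)"
  then have p: "p permutes insert a A" and pp: "\<And>x. p (p x) = x"
    by (auto simp: involutions_def fun_eq_iff)
  show "p \<in> involutions A \<union> (\<Union>b\<in>A. (\<lambda>p. Transposition.transpose a b \<circ> p) ` involutions (A - {b}))"
  proof (cases "p a = a")
    case True
    then have "p permutes A" using p permutes_superset[OF p, of A] by auto
    then show ?thesis using pp by (auto simp: involutions_def fun_eq_iff)
  next
    case False
    let ?b = "p a"
    have bA: "?b \<in> A" using False permutes_in_image[OF p, of a] by auto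
    have pb: "p ?b = a" using pp .
    let ?q = "Transposition.transpose a ?b \<circ> p"
    have "?q permutes insert a A"
      using permutes_compose[OF p permutes_swap_id[of a "insert a A" ?b]] bA by simp
    moreover have "?q x = x" if "x \<in> insert a A - (A - {?b})" for x
      using that pb assms by (auto simp: Transposition.transpose_def)
    ultimately have "?q permutes A - {?b}" by (rule permutes_superset)
    moreover have "?q (?q x) = x" for x
    proof -
      have "p x = p y \<longleftrightarrow> x = y" for x y using pp by metis
      moreover have "p x \<noteq> a \<and> p x \<noteq> ?b" if "x \<noteq> a" "x \<noteq> ?b" using that pp by metis
      ultimately show ?thesis using pp pb False by (auto simp: Transposition.transpose_def)
    qed
    ultimately have "?q \<in> involutions (A - {?b})" by (auto simp: involutions_def fun_eq_iff)
    moreover have "p = Transposition.transpose a ?b \<circ> ?q" by (simp add: fun_eq_iff)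
    ultimately show ?thesis using bA by blast
  qed
next
  fix p assume "p \<in> involutions A \<union> (\<Union>b\<in>A. (\<lambda>p. Transposition.transpose a b \<circ> p) ` involutions (A - {b}))"
  then consider "p \<in> involutions A"
    | b q where "b \<in> A" "q \<in> involutions (A - {b})" "p = Transposition.transpose a b \<circ> q" by blast
  then show "p \<in> involutions (insert a A)"
  proof cases
    case 1
    then show ?thesis using permutes_subset[of p A "insert a A"] by (auto simp: involutions_def)
  next
    case 2
    have q: "q permutes A - {b}" and qq: "\<And>x. q (q x) = x"
      using 2(2) by (auto simp: involutions_def fun_eq_iff)
    have "q permutes insert a A" using permutes_subset[OF q] by auto
    then have "p permutes insert a A"
      using permutes_compose[OF _ permutes_swap_id[of a "insert a A" b]] 2 by simp
    moreover have "p (p x) = x" for x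
    proof -
      have "q a = a" "q b = b" using permutes_not_in[OF q] assms by auto
      moreover have "q x \<noteq> a \<and> q x \<noteq> b" if "x \<noteq> a" "x \<noteq> b" using that qq calculation by metis
      ultimately show ?thesis using qq 2 by (auto simp: Transposition.transpose_def)
    qed
    ultimately show ?thesis by (auto simp: involutions_def fun_eq_iff)
  qed
qed

lemma card_involutions_insert:
  assumes A: "finite A" "a \<notin> A"
  shows "card (involutions (insert a A)) =
    card (involutions A) + (\<Sum>b\<in>A. card (involutions (A - {b})))"
proof -
  have val: "(Transposition.transpose a b \<circ> p) a = b" if "p \<in> involutions (A - {b})" for b p
    using that A(2) permutes_not_in[of p "A - {b}" a] by (auto simp: involutions_def)
  have inj: "inj_on (\<lambda>p. Transposition.transpose a b \<circ> p) S" for b and S :: "('a \<Rightarrow> 'a) set"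
    by (rule inj_onI) (metis comp_assoc transpose_comp_involutory id_comp)
  have fin: "finite (involutions (A - {b}))" for b using finite_involutions A by blast
  have "card (\<Union>b\<in>A. (\<lambda>p. Transposition.transpose a b \<circ> p) ` involutions (A - {b}))
      = (\<Sum>b\<in>A. card ((\<lambda>p. Transposition.transpose a b \<circ> p) ` involutions (A - {b})))"
  proof (rule card_UN_disjoint)
    show "\<forall>b\<in>A. \<forall>c\<in>A. b \<noteq> c \<longrightarrow> (\<lambda>p. Transposition.transpose a b \<circ> p) ` involutions (A - {b}) \<inter>
        (\<lambda>p. Transposition.transpose a c \<circ> p) ` involutions (A - {c}) = {}"
    proof (intro ballI impI)
      fix b c assume bc: "b \<in> A" "c \<in> A" "b \<noteq> c"
      show "(\<lambda>p. Transposition.transpose a b \<circ> p) ` involutions (A - {b}) \<inter>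
        (\<lambda>p. Transposition.transpose a c \<circ> p) ` involutions (A - {c}) = {}"
      proof (rule ccontr)
        assume "\<not> ?thesis"
        then obtain p q where pq: "p \<in> involutions (A - {b})" "q \<in> involutions (A - {c})"
          "Transposition.transpose a b \<circ> p = Transposition.transpose a c \<circ> q" by blast
        then show False using val[OF pq(1)] val[OF pq(2)] bc(3) by simp
      qed
    qed
  qed (use A fin in auto)
  moreover have "involutions A \<inter> (\<Union>b\<in>A. (\<lambda>p. Transposition.transpose a b \<circ> p) ` involutions (A - {b})) = {}"
  proof (rule ccontr)
    assume "\<not> ?thesis"
    then obtain p b where p: "p \<in> involutions A" "b \<in> A" "p a = b" using val by blast
    then have "p a = a" using permutes_not_in[of p A a] A(2) by (auto simp: involutions_def)
    then show False using p A by simp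
  qed
  ultimately show ?thesis
    unfolding involutions_insert[OF A(2)]
    using A fin finite_involutions[OF A(1)] inj by (subst card_Un_disjoint) (auto simp: card_image)
qed

text \<open>The value 0 for \<open>2 * z > n\<close> lets sums for different \<open>n\<close> run
  over a common range. It also keeps the recursion below true at \<open>n = 2 * z\<close>, where
  truncated subtraction would produce a spurious term.\<close>

definition involution_term :: "nat \<Rightarrow> nat \<Rightarrow> real" where
  "involution_term n z = (if 2 * z \<le> n then 1 / (fact (n - 2 * z) * fact z * 2 ^ z) else 0)"

lemma involution_term_0: "involution_term n 0 = 1 / fact n"
  by (simp add: involution_term_def)

text \<open>Write \<open>n + 2\<close> as \<open>(n - 2 z) + 2 (z + 1)\<close>: the first part
  cancels against \<open>(n - 2 z)!\<close>, the second against the last factors of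
  \<open>(z + 1)!\<close> and \<open>2^(z + 1)\<close>.\<close>

lemma involution_term_rec:
  "real (n + 2) * involution_term (n + 2) (Suc z) = involution_term (n + 1) (Suc z) + involution_term n z"
proof -
  consider "2 * z > n" | "2 * z = n" | k where "n = Suc k + 2 * z"
    by (metis Suc_diff_Suc add.commute diff_add_inverse le_add_diff_inverse less_imp_Suc_add nat_neq_iff not_less)
  then show ?thesis
  proof cases
    case 3
    have f: "fact (Suc k) = real (Suc k) * fact k" by simp
    have z: "fact (Suc z) = real (Suc z) * fact z" by simp
    have "n + 2 - 2 * Suc z = Suc k" "n + 1 - 2 * Suc z = k" "n - 2 * z = Suc k" using 3 by auto
    then have e: "involution_term (n + 2) (Suc z) = 1 / (fact (Suc k) * fact (Suc z) * 2 ^ Suc z)"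
      "involution_term (n + 1) (Suc z) = 1 / (fact k * fact (Suc z) * 2 ^ Suc z)"
      "involution_term n z = 1 / (fact (Suc k) * fact z * 2 ^ z)"
      using 3 by (simp_all add: involution_term_def del: fact_Suc)
    show ?thesis unfolding e f z using 3
      by (simp add: divide_simps del: fact_Suc of_nat_Suc) (simp add: algebra_simps)
  next
    case 2
    have f: "fact (Suc z) = real (Suc z) * fact z" by simp
    have e: "involution_term (n + 2) (Suc z) = 1 / (fact (Suc z) * 2 ^ Suc z)"
      "involution_term (n + 1) (Suc z) = 0" "involution_term n z = 1 / (fact z * 2 ^ z)"
      using 2 by (auto simp: involution_term_def simp del: fact_Suc)
    show ?thesis unfolding e f using 2
      by (simp add: divide_simps del: fact_Suc of_nat_Suc) (simp add: algebra_simps)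
  qed (auto simp: involution_term_def)
qed

definition involution_sum :: "nat \<Rightarrow> real" where
  "involution_sum n = (\<Sum>z = 0..n div 2. 1 / (fact (n - 2 * z) * fact z * 2 ^ z))"

lemma involution_sum_eq:
  assumes "n div 2 \<le> K"
  shows "involution_sum n = (\<Sum>z\<le>K. involution_term n z)"
proof -
  have "involution_sum n = (\<Sum>z\<in>{0..n div 2}. involution_term n z)"
    unfolding involution_sum_def by (intro sum.cong) (auto simp: involution_term_def)
  also have "\<dots> = (\<Sum>z\<le>K. involution_term n z)"
    using assms by (intro sum.mono_neutral_left) (auto simp: involution_term_def)
  finally show ?thesis .
qed

text \<open>This is the recurrence \<open>I(n + 2) = I(n + 1) + (n + 1) I(n)\<close> for the number
  of involutions, divided by \<open>(n + 1)!\<close>.\<close>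

lemma involution_sum_rec:
  "real (n + 2) * involution_sum (n + 2) = involution_sum (n + 1) + involution_sum n"
proof -
  have "real (n + 2) * involution_sum (n + 2)
      = real (n + 2) * involution_term (n + 2) 0 + (\<Sum>z\<le>n + 1. real (n + 2) * involution_term (n + 2) (Suc z))"
  proof -
    have "involution_sum (n + 2) = (\<Sum>z\<le>Suc (n + 1). involution_term (n + 2) z)"
      by (rule involution_sum_eq) simp
    also have "\<dots> = involution_term (n + 2) 0 + (\<Sum>z\<le>n + 1. involution_term (n + 2) (Suc z))"
      by (rule sum.atMost_Suc_shift)
    finally show ?thesis by (simp only: distrib_left sum_distrib_left)
  qed
  also have "real (n + 2) * involution_term (n + 2) 0 = involution_term (n + 1) 0"
    by (simp add: involution_term_0 divide_simps del: of_nat_Suc)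
  also have "(\<Sum>z\<le>n + 1. real (n + 2) * involution_term (n + 2) (Suc z))
      = (\<Sum>z\<le>n + 1. involution_term (n + 1) (Suc z)) + (\<Sum>z\<le>n + 1. involution_term n z)"
    unfolding involution_term_rec by (rule sum.distrib)
  also have "(\<Sum>z\<le>n + 1. involution_term n z) = involution_sum n"
    by (rule involution_sum_eq[symmetric]) simp
  also have "involution_term (n + 1) 0 + ((\<Sum>z\<le>n + 1. involution_term (n + 1) (Suc z)) + involution_sum n)
      = involution_sum (n + 1) + involution_sum n"
  proof -
    have "involution_sum (n + 1) = (\<Sum>z\<le>Suc (n + 1). involution_term (n + 1) z)"
      by (rule involution_sum_eq) simp
    also have "\<dots> = involution_term (n + 1) 0 + (\<Sum>z\<le>n + 1. involution_term (n + 1) (Suc z))"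
      by (rule sum.atMost_Suc_shift)
    finally show ?thesis by (simp only: add.assoc)
  qed
  finally show ?thesis .
qed

lemma card_involutions:
  "finite A \<Longrightarrow> real (card (involutions A)) = fact (card A) * involution_sum (card A)"
proof (induction "card A" arbitrary: A rule: less_induct)
  case less
  show ?case
  proof (cases "A = {}")
    case True
    then have "involutions A = {id}" by (auto simp: involutions_def)
    then show ?thesis using True by (simp add: involution_sum_def)
  next
    case False
    then obtain a B where A: "A = insert a B" "a \<notin> B" by (meson Set.set_insert ex_in_conv)
    then have B: "finite B" "card A = Suc (card B)" using less.prems by auto
    have IB: "real (card (involutions B)) = fact (card B) * involution_sum (card B)"
      using less.hyps[of B] B by simp
    have Ib: "real (card (involutions (B - {b}))) = fact (card B - 1) * involution_sum (card B - 1)"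
      if "b \<in> B" for b
      using less.hyps[of "B - {b}"] B that by (simp add: card_Diff_singleton)
    have "real (card (involutions A)) = real (card (involutions B)) + (\<Sum>b\<in>B. real (card (involutions (B - {b}))))"
      unfolding A(1) card_involutions_insert[OF B(1) A(2)] by simp
    also have "\<dots> = fact (card B) * involution_sum (card B) +
        real (card B) * (fact (card B - 1) * involution_sum (card B - 1))"
      using IB Ib by simp
    also have "\<dots> = fact (card A) * involution_sum (card A)"
    proof (cases "card B")
      case 0
      then show ?thesis using B by (simp add: involution_sum_def)
    next
      case (Suc n)
      have "fact (n + 2) * involution_sum (n + 2) = fact (n + 1) * (real (n + 2) * involution_sum (n + 2))"
        by simp
      also have "\<dots> = fact (n + 1) * (involution_sum (n + 1) + involution_sum n)"
        by (simp only: involution_sum_rec)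
      finally show ?thesis using Suc B by (simp add: algebra_simps)
    qed
    finally show ?thesis .
  qed
qed

lemma card_sym_grp_involutions:
  "real (card {g \<in> sym_grp n. g + g = 0}) = fact n * involution_sum n"
proof -
  have "g + g = 0 \<longleftrightarrow> apply g \<circ> apply g = id" for g :: "nat perm"
    unfolding perm_eq_iff by (simp add: fun_eq_iff)
  then have "bij_betw apply {g \<in> sym_grp n. g + g = 0} (involutions {1..n})"
    using bij_betw_sym_grp_permutes[of n] unfolding involutions_def bij_betw_def
    by (auto simp: inj_on_def image_iff)
  then show ?thesis using bij_betw_same_card card_involutions[of "{1..n}"] by fastforce
qed

section \<open>The length of a representation of the symmetric group\<close>

lemma card_sym_grp: "card (sym_grp n) = fact n"
  using bij_betw_same_card[OF bij_betw_sym_grp_permutes[of n]] card_permutations[of "{1..n}" n] by simp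

text \<open>The group is abelian, so \<open>g e\<close> is a multiple of \<open>e\<close>, by the
  scalar \<open>e(g) / e(1)\<close>, whose square is 1. The coefficient of 1 in
  \<open>e e = e\<close> then reads \<open>e(1) = n! e(1)^2\<close>.\<close>

lemma primitive_involutive:
  assumes e: "primitive n e" and inv: "\<And>g. g \<in> sym_grp n \<Longrightarrow> g + g = 0"
  shows "fact n * coef e 0 = 1"
proof -
  have ee: "e * e = e" and en: "e \<in> subalg n" using e by (simp_all add: primitive_def)
  have neg: "- g = g" if "g \<in> sym_grp n" for g using inv[OF that] by (simp add: minus_unique)
  have comm: "g + h = h + g" if "g \<in> sym_grp n" "h \<in> sym_grp n" for g h
    using neg[OF sym_grp_plus[OF that]] neg[OF that(1)] neg[OF that(2)] minus_add[of g h] by simp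
  have sq: "coef e g * coef e g = coef e 0 * coef e 0" if g: "g \<in> sym_grp n" for g
  proof -
    let ?c = "coef e g / coef e 0"
    have "e * delta g = (\<Sum>h\<in>sym_grp n. Poly_Mapping.single h (coef e h) * delta g)"
      by (subst subalg_expand[OF en]) (simp add: sum_distrib_right)
    also have "\<dots> = (\<Sum>h\<in>sym_grp n. delta g * Poly_Mapping.single h (coef e h))"
      using comm[OF g] by (intro sum.cong) (simp_all add: mult_single)
    also have "\<dots> = delta g * e"
      by (subst (2) subalg_expand[OF en]) (simp add: sum_distrib_left)
    finally have eg: "e * delta g = delta g * e" .
    have ge: "delta g * e = scalar ?c * e"
      using primitive_sandwich[OF e g] unfolding eg by (simp only: mult.assoc ee)
    have "e = delta g * (delta g * e)"
      using inv[OF g] by (simp add: mult.assoc[symmetric] delta_add)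
    also have "\<dots> = delta g * (scalar ?c * e)" by (simp only: ge)
    also have "\<dots> = scalar ?c * (delta g * e)" by (rule scalar_mult_right)
    also have "\<dots> = scalar ?c * (scalar ?c * e)" by (simp only: ge)
    also have "\<dots> = scalar (?c * ?c) * e" by (rule scalar_scalar)
    finally have "coef e 0 = coef (scalar (?c * ?c) * e) 0" by simp
    then show ?thesis using primitive_coef_0_neq[OF e] by (simp add: field_simps)
  qed
  have "coef e 0 = coef (e * e) 0" using ee by simp
  also have "\<dots> = (\<Sum>g\<in>sym_grp n. coef e g * coef e g)"
    by (simp add: lookup_mult_0[OF en] primitive_coef_uminus[OF e])
  also have "\<dots> = (\<Sum>g\<in>sym_grp n. coef e 0 * coef e 0)" by (intro sum.cong refl sq)
  also have "\<dots> = fact n * (coef e 0 * coef e 0)" by (simp add: card_sym_grp)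
  finally have q: "coef e 0 = fact n * (coef e 0 * coef e 0)" .
  have "fact n * coef e 0 * coef e 0 = 1 * coef e 0"
    unfolding mult.assoc mult_1 by (rule q[symmetric])
  then show ?thesis by (rule mult_right_cancel[THEN iffD1, OF primitive_coef_0_neq[OF e]])
qed

section \<open>Representations on a subspace and their simple submodules\<close>

locale sym_rep = complex_vector_space scale
  for scale :: "complex \<Rightarrow> 'b::ab_group_add \<Rightarrow> 'b" (infixr \<open>\<cdot>\<close> 75) +
  fixes l :: nat and \<rho> :: "nat perm \<Rightarrow> 'b \<Rightarrow> 'b" and W :: "'b set"
  assumes W: "fin_dim W"
    and rho_lin: "p \<in> sym_grp l \<Longrightarrow> lin_on W (\<rho> p)"
    and rho_W: "p \<in> sym_grp l \<Longrightarrow> \<rho> p ` W \<subseteq> W"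
    and rho_plus: "p \<in> sym_grp l \<Longrightarrow> q \<in> sym_grp l \<Longrightarrow> w \<in> W \<Longrightarrow> \<rho> (p + q) w = \<rho> p (\<rho> q w)"
    and rho_0: "w \<in> W \<Longrightarrow> \<rho> 0 w = w"
begin

lemma sW: "subspace W" using W by (rule fin_dim_subspace)

lemma rho_mem: "p \<in> sym_grp l \<Longrightarrow> w \<in> W \<Longrightarrow> \<rho> p w \<in> W"
  using rho_W by blast

definition alg_act :: "galg \<Rightarrow> 'b \<Rightarrow> 'b" where
  "alg_act a w = (\<Sum>g\<in>sym_grp l. coef a g \<cdot> \<rho> g w)"

definition stable :: "'b set \<Rightarrow> bool" where
  "stable U \<longleftrightarrow> subspace U \<and> U \<subseteq> W \<and> (\<forall>p\<in>sym_grp l. \<rho> p ` U \<subseteq> U)"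

lemma stable_W: "stable W"
  using sW rho_W by (simp add: stable_def)

lemma stable_subspace: "stable U \<Longrightarrow> subspace U"
  and stable_subset: "stable U \<Longrightarrow> U \<subseteq> W"
  and stable_mem: "stable U \<Longrightarrow> u \<in> U \<Longrightarrow> u \<in> W"
  and stable_rho: "stable U \<Longrightarrow> p \<in> sym_grp l \<Longrightarrow> u \<in> U \<Longrightarrow> \<rho> p u \<in> U"
  by (auto simp: stable_def)

lemma stable_fin_dim: "stable U \<Longrightarrow> fin_dim U"
  using fin_dim_mono[OF W] by (simp add: stable_def)

lemma alg_act_lin: "lin_on W (alg_act a)"
  unfolding alg_act_def by (intro lin_on_sum lin_on_scale rho_lin)

lemma alg_act_stable: "stable U \<Longrightarrow> u \<in> U \<Longrightarrow> alg_act a u \<in> U"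
  unfolding alg_act_def by (intro subspace_sum subspace_scale stable_subspace stable_rho)

lemma alg_act_mem: "u \<in> W \<Longrightarrow> alg_act a u \<in> W"
  using alg_act_stable[OF stable_W] .

lemma alg_act_add: "alg_act (a + b) w = alg_act a w + alg_act b w"
  by (simp add: alg_act_def lookup_add scale_left_distrib sum.distrib)

lemma alg_act_0: "alg_act 0 w = 0"
  by (simp add: alg_act_def)

lemma alg_act_sum: "alg_act (\<Sum>i\<in>I. a i) w = (\<Sum>i\<in>I. alg_act (a i) w)"
  by (induction I rule: infinite_finite_induct) (simp_all add: alg_act_add alg_act_0)

lemma alg_act_scalar: "alg_act (scalar c * a) w = c \<cdot> alg_act a w"
  by (simp add: alg_act_def scale_sum_right)

lemma alg_act_delta:
  assumes "g \<in> sym_grp l"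
  shows "alg_act (delta g) w = \<rho> g w"
proof -
  have "alg_act (delta g) w = (\<Sum>h\<in>sym_grp l. if h = g then \<rho> g w else 0)"
    unfolding alg_act_def by (intro sum.cong) (auto simp: lookup_single when_def)
  then show ?thesis using assms by simp
qed

lemma alg_act_1: "w \<in> W \<Longrightarrow> alg_act 1 w = w"
  using alg_act_delta[of 0] rho_0 by simp

lemma rho_sum: "p \<in> sym_grp l \<Longrightarrow> (\<And>i. i \<in> I \<Longrightarrow> x i \<in> W) \<Longrightarrow>
    \<rho> p (\<Sum>i\<in>I. c i \<cdot> x i) = (\<Sum>i\<in>I. c i \<cdot> \<rho> p (x i))"
  by (rule lin_on_apply_sum[OF rho_lin sW])

lemma alg_act_mult:
  assumes a: "a \<in> subalg l" and w: "w \<in> W"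
  shows "alg_act (a * b) w = alg_act a (alg_act b w)"
proof -
  have "alg_act a (alg_act b w) = (\<Sum>g\<in>sym_grp l. coef a g \<cdot> (\<Sum>h\<in>sym_grp l. coef b h \<cdot> \<rho> (g + h) w))"
  proof -
    have "\<rho> g (alg_act b w) = (\<Sum>h\<in>sym_grp l. coef b h \<cdot> \<rho> (g + h) w)" if g: "g \<in> sym_grp l" for g
      unfolding alg_act_def using rho_sum[OF g, of "sym_grp l" "\<lambda>h. \<rho> h w" "coef b"] w g
      by (simp add: rho_mem rho_plus)
    then show ?thesis by (simp add: alg_act_def[of a])
  qed
  also have "\<dots> = (\<Sum>g\<in>sym_grp l. coef a g \<cdot> (\<Sum>k\<in>sym_grp l. coef b (- g + k) \<cdot> \<rho> k w))"
  proof (intro sum.cong refl)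
    fix g assume g: "g \<in> sym_grp l"
    have "(\<Sum>k\<in>sym_grp l. coef b (- g + k) \<cdot> \<rho> k w) = (\<Sum>h\<in>sym_grp l. coef b (- g + (g + h)) \<cdot> \<rho> (g + h) w)"
      by (rule sum.reindex_bij_betw[OF bij_betw_sym_grp_add(2)[OF g], symmetric])
    then show "coef a g \<cdot> (\<Sum>h\<in>sym_grp l. coef b h \<cdot> \<rho> (g + h) w)
      = coef a g \<cdot> (\<Sum>k\<in>sym_grp l. coef b (- g + k) \<cdot> \<rho> k w)"
      by (simp add: add.assoc[symmetric])
  qed
  also have "\<dots> = (\<Sum>k\<in>sym_grp l. \<Sum>g\<in>sym_grp l. (coef a g * coef b (- g + k)) \<cdot> \<rho> k w)"
    by (subst sum.swap) (simp add: scale_sum_right)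
  also have "\<dots> = alg_act (a * b) w"
    unfolding alg_act_def
  proof (intro sum.cong refl)
    fix k
    have "coef (a * b) k = (\<Sum>g\<in>sym_grp l. coef (Poly_Mapping.single g (coef a g) * b) k)"
      by (subst subalg_expand[OF a]) (simp add: sum_distrib_right lookup_sum)
    then show "(\<Sum>g\<in>sym_grp l. (coef a g * coef b (- g + k)) \<cdot> \<rho> k w) = coef (a * b) k \<cdot> \<rho> k w"
      by (simp add: lookup_single_times scale_sum_left)
  qed
  finally show ?thesis by simp
qed

lemma alg_act_idem:
  assumes "primitive l e" "w \<in> W"
  shows "alg_act e (alg_act e w) = alg_act e w"
  using alg_act_mult[of e w e] assms by (simp add: primitive_def)

lemma dim_alg_act_trace:
  assumes e: "primitive l e" and U: "stable U" and f: "frame U I b \<phi>"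
  shows "of_nat (dim (alg_act e ` U)) = (\<Sum>g\<in>sym_grp l. coef e g * (\<Sum>i\<in>I. \<phi> i (\<rho> g (b i))))"
proof -
  have b: "b i \<in> U" if "i \<in> I" for i using f that by (auto simp: frame_def)
  have "of_nat (dim (alg_act e ` U)) = (\<Sum>i\<in>I. \<phi> i (alg_act e (b i)))"
    using alg_act_stable[OF U] alg_act_idem[OF e stable_mem[OF U]]
    by (intro frame_trace_idempotent[OF f, symmetric] lin_on_mono[OF alg_act_lin stable_subset[OF U]]) auto
  also have "\<dots> = (\<Sum>i\<in>I. \<Sum>g\<in>sym_grp l. coef e g * \<phi> i (\<rho> g (b i)))"
  proof (intro sum.cong refl)
    fix i assume i: "i \<in> I"
    then have "functional_on U (\<phi> i)" using f by (auto simp: frame_def)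
    then show "\<phi> i (alg_act e (b i)) = (\<Sum>g\<in>sym_grp l. coef e g * \<phi> i (\<rho> g (b i)))"
      unfolding alg_act_def using stable_rho[OF U _ b[OF i]]
      by (intro functional_on_apply_sum[OF _ stable_subspace[OF U]])
  qed
  also have "\<dots> = (\<Sum>g\<in>sym_grp l. coef e g * (\<Sum>i\<in>I. \<phi> i (\<rho> g (b i))))"
    by (subst sum.swap) (simp add: sum_distrib_left)
  finally show ?thesis .
qed

lemma sum_dim_alg_act:
  assumes E: "primitive_family l E" and U: "stable U"
  shows "(\<Sum>e\<in>E. dim (alg_act e ` U)) = dim U"
proof -
  obtain I :: "'b set" and b \<phi> where f: "frame U I b \<phi>" using frame_exists[OF stable_fin_dim[OF U]] .
  have b: "b i \<in> U" if "i \<in> I" for i using f that by (auto simp: frame_def)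
  have "of_nat (\<Sum>e\<in>E. dim (alg_act e ` U)) = (\<Sum>e\<in>E. \<Sum>i\<in>I. \<phi> i (alg_act e (b i)))"
    unfolding of_nat_sum
  proof (intro sum.cong refl)
    fix e assume "e \<in> E"
    then have e: "primitive l e" using E by (simp add: primitive_family_def)
    show "of_nat (dim (alg_act e ` U)) = (\<Sum>i\<in>I. \<phi> i (alg_act e (b i)))"
      using alg_act_stable[OF U] alg_act_idem[OF e stable_mem[OF U]]
      by (intro frame_trace_idempotent[OF f, symmetric] lin_on_mono[OF alg_act_lin stable_subset[OF U]]) auto
  qed
  also have "\<dots> = (\<Sum>i\<in>I. \<Sum>e\<in>E. \<phi> i (alg_act e (b i)))" by (rule sum.swap)
  also have "\<dots> = (\<Sum>i\<in>I. \<phi> i (b i))"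
  proof (intro sum.cong refl)
    fix i assume i: "i \<in> I"
    then have fi: "functional_on U (\<phi> i)" using f by (auto simp: frame_def)
    have "b i = alg_act (\<Sum>E) (b i)" using E alg_act_1[OF stable_mem[OF U b[OF i]]] by (simp add: primitive_family_def)
    also have "\<dots> = (\<Sum>e\<in>E. 1 \<cdot> alg_act e (b i))" using alg_act_sum[of "\<lambda>e. e" E] by simp
    finally show "(\<Sum>e\<in>E. \<phi> i (alg_act e (b i))) = \<phi> i (b i)"
      using functional_on_apply_sum[OF fi stable_subspace[OF U], of E "\<lambda>e. alg_act e (b i)" "\<lambda>_. 1"]
        alg_act_stable[OF U b[OF i]] by simp
  qed
  also have "\<dots> = of_nat (dim U)" by (rule frame_trace_id[OF f])
  finally show ?thesis by (simp only: of_nat_eq_iff)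
qed

definition simple :: "'b set \<Rightarrow> bool" where
  "simple S \<longleftrightarrow> stable S \<and> S \<noteq> {0} \<and> (\<forall>T. stable T \<and> T \<subseteq> S \<longrightarrow> T = {0} \<or> T = S)"

lemma simple_eq:
  assumes "simple S" "stable T" "T \<subseteq> S" "s \<in> T" "s \<noteq> 0"
  shows "T = S"
  using assms by (auto simp: simple_def)

text \<open>A nonzero \<open>s\<close> in \<open>e S\<close> generates \<open>S\<close>, so
  \<open>e S = e A e s\<close> is the line through \<open>s\<close>. The sum \<open>P\<close> of the
  conjugates of \<open>e\<close> commutes with the group, so its eigenspace for
  \<open>1 / e(1)\<close>, which contains \<open>s\<close>, is all of \<open>S\<close>. Computing
  the trace of \<open>P\<close> in two ways yields \<open>dim S / e(1) = l!\<close>.\<close>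

lemma simple_dim_alg_act:
  assumes S: "simple S" and e: "primitive l e" and ne: "alg_act e ` S \<noteq> {0}"
  shows "dim (alg_act e ` S) = 1" "of_nat (dim S) = fact l * coef e 0"
proof -
  have stS: "stable S" using S by (simp add: simple_def)
  have el: "e \<in> subalg l" and ee: "e * e = e" using e by (simp_all add: primitive_def)
  have se: "subspace (alg_act e ` S)"
    by (intro subspace_image_lin_on lin_on_mono[OF alg_act_lin stable_subset] stable_subspace stS)
  obtain s where s: "s \<in> alg_act e ` S" "s \<noteq> 0" using ne subspace_0[OF se] by blast
  have sS: "s \<in> S" using s alg_act_stable[OF stS] by blast
  then have s_W: "s \<in> W" using stable_mem[OF stS] by blast
  have es: "alg_act e s = s" using s(1) alg_act_idem[OF e stable_mem[OF stS]] by auto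
  let ?T = "(\<lambda>a. alg_act a s) ` subalg l"
  have "stable ?T" unfolding stable_def
  proof (intro conjI ballI)
    show "subspace ?T"
    proof (rule subspaceI)
      show "0 \<in> ?T" using alg_act_0[of s] subalg_0 by force
      show "x + y \<in> ?T" if "x \<in> ?T" "y \<in> ?T" for x y
        using that alg_act_add[symmetric] subalg_add by blast
      show "c \<cdot> x \<in> ?T" if x: "x \<in> ?T" for c x
      proof -
        obtain a where a: "x = alg_act a s" "a \<in> subalg l" using x by blast
        have "scalar c * a \<in> subalg l" using a(2) by (intro subalg_mult subalg_single sym_grp_0)
        moreover have "c \<cdot> x = alg_act (scalar c * a) s" by (simp only: alg_act_scalar a(1))
        ultimately show ?thesis by blast
      qed
    qed
    show "?T \<subseteq> W" using alg_act_mem[OF s_W] by blast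
    show "\<rho> p ` ?T \<subseteq> ?T" if p: "p \<in> sym_grp l" for p
    proof clarify
      fix a assume "a \<in> subalg l"
      then have "delta p * a \<in> subalg l" using p by simp
      moreover have "\<rho> p (alg_act a s) = alg_act (delta p * a) s"
        using alg_act_mult[OF _ s_W, of "delta p" a] alg_act_delta[OF p] p by simp
      ultimately show "\<rho> p (alg_act a s) \<in> ?T" by blast
    qed
  qed
  moreover have "?T \<subseteq> S" using alg_act_stable[OF stS sS] by blast
  moreover have "s \<in> ?T" using alg_act_1[OF s_W] by (intro image_eqI[of _ _ 1]) simp_all
  ultimately have T: "?T = S" using simple_eq[OF S] s(2) by blast
  have "alg_act e ` S \<subseteq> span {s}"
  proof clarify
    fix x assume "x \<in> S"
    then obtain a where a: "a \<in> subalg l" "x = alg_act a s" using T by blast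
    obtain c where c: "e * a * e = scalar c * e" using e a by (auto simp: primitive_def)
    have "alg_act e x = alg_act (e * a * e) s"
      using a el es s_W by (simp add: alg_act_mult)
    also have "\<dots> = c \<cdot> s" by (simp add: c alg_act_scalar es)
    finally show "alg_act e x \<in> span {s}" by (simp add: span_base span_scale)
  qed
  then have "dim (alg_act e ` S) \<le> 1" using dim_le_card[of "alg_act e ` S" "{s}"] by simp
  moreover have "dim (alg_act e ` S) \<noteq> 0"
    using dim_eq_0_fin[OF fin_dim_image(1)[OF lin_on_mono[OF alg_act_lin stable_subset[OF stS]] stable_fin_dim[OF stS]]] ne
    by blast
  ultimately show d1: "dim (alg_act e ` S) = 1" by simp
  define P where "P = (\<Sum>h\<in>sym_grp l. delta h * e * delta (- h))"
  have P_act: "alg_act P w = (\<Sum>h\<in>sym_grp l. \<rho> h (alg_act e (\<rho> (- h) w)))" if w: "w \<in> W" for w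
  proof -
    have "alg_act (delta h * e * delta (- h)) w = \<rho> h (alg_act e (\<rho> (- h) w))" if h: "h \<in> sym_grp l" for h
      using w el h by (simp add: alg_act_mult alg_act_delta rho_mem)
    then show ?thesis unfolding P_def alg_act_sum by (intro sum.cong) auto
  qed
  have Pl: "P \<in> subalg l" unfolding P_def using el by (intro subalg_sum subalg_mult) auto
  have Pcomm: "delta k * P = P * delta k" if k: "k \<in> sym_grp l" for k
  proof -
    have "delta k * P * delta (- k) = (\<Sum>h\<in>sym_grp l. delta (k + h) * e * delta (- (k + h)))"
      by (simp only: P_def sum_distrib_left sum_distrib_right delta_uminus_add delta_add[symmetric] mult.assoc)
    also have "\<dots> = P" unfolding P_def
      using sum.reindex_bij_betw[OF bij_betw_sym_grp_add(2)[OF k]] .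
    finally have "delta k * P * delta (- k) * delta k = P * delta k" by simp
    then show ?thesis by (simp add: mult.assoc delta_add)
  qed
  let ?r = "1 / coef e 0"
  let ?K = "{w \<in> S. alg_act P w = ?r \<cdot> w}"
  have "stable ?K" unfolding stable_def
  proof (intro conjI ballI)
    show "subspace ?K"
      using alg_act_lin[of P] stable_subspace[OF stS] stable_mem[OF stS] lin_on_0[OF alg_act_lin[of P] sW]
      by (auto simp: subspace_def lin_on_def scale_right_distrib mult.commute)
    show "?K \<subseteq> W" using stable_subset[OF stS] by blast
    show "\<rho> p ` ?K \<subseteq> ?K" if p: "p \<in> sym_grp l" for p
    proof clarify
      fix w assume w: "w \<in> S" "alg_act P w = ?r \<cdot> w"
      have wW: "w \<in> W" using stable_mem[OF stS w(1)] .
      have "alg_act P (\<rho> p w) = alg_act (P * delta p) w"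
        using alg_act_mult[OF Pl wW, of "delta p"] alg_act_delta[OF p] by simp
      also have "\<dots> = \<rho> p (alg_act P w)"
        using alg_act_mult[OF _ wW, of "delta p" P] alg_act_delta[OF p] p by (simp add: Pcomm[symmetric])
      also have "\<dots> = ?r \<cdot> \<rho> p w" using rho_lin[OF p] wW by (simp add: w(2) lin_on_def)
      finally show "\<rho> p w \<in> S \<and> alg_act P (\<rho> p w) = ?r \<cdot> \<rho> p w"
        using stable_rho[OF stS p w(1)] by simp
    qed
  qed
  moreover have "s \<in> ?K"
  proof -
    have "alg_act P s = alg_act (P * e) s" using alg_act_mult[OF Pl s_W, of e] es by simp
    also have "\<dots> = ?r \<cdot> s"
      unfolding P_def primitive_average[OF e] by (simp add: alg_act_scalar es)
    finally show ?thesis using sS by simp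
  qed
  ultimately have K: "?K = S" using simple_eq[OF S, of ?K s] s(2) by blast
  obtain I :: "'b set" and b \<phi> where f: "frame S I b \<phi>" using frame_exists[OF stable_fin_dim[OF stS]] .
  have b: "b i \<in> S" if "i \<in> I" for i using f that by (auto simp: frame_def)
  have fi: "functional_on S (\<phi> i)" if "i \<in> I" for i using f that by (auto simp: frame_def)
  have linS: "lin_on S (alg_act e)" "\<And>p. p \<in> sym_grp l \<Longrightarrow> lin_on S (\<rho> p)"
    using lin_on_mono[OF _ stable_subset[OF stS]] alg_act_lin rho_lin by auto
  have im: "alg_act e ` S \<subseteq> S" "\<And>p. p \<in> sym_grp l \<Longrightarrow> \<rho> p ` S \<subseteq> S"
    using alg_act_stable[OF stS] stable_rho[OF stS] by auto
  have "?r * of_nat (dim S) = (\<Sum>i\<in>I. ?r * \<phi> i (b i))"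
    by (simp add: frame_trace_id[OF f, symmetric] sum_distrib_left)
  also have "\<dots> = (\<Sum>i\<in>I. \<phi> i (alg_act P (b i)))"
  proof (intro sum.cong refl)
    fix i assume i: "i \<in> I"
    have "alg_act P (b i) = ?r \<cdot> b i" using b[OF i] K by blast
    then show "?r * \<phi> i (b i) = \<phi> i (alg_act P (b i))"
      using fi[OF i] b[OF i] unfolding functional_on_def by simp
  qed
  also have "\<dots> = (\<Sum>i\<in>I. \<Sum>h\<in>sym_grp l. \<phi> i (\<rho> h (alg_act e (\<rho> (- h) (b i)))))"
  proof (intro sum.cong refl)
    fix i assume i: "i \<in> I"
    show "\<phi> i (alg_act P (b i)) = (\<Sum>h\<in>sym_grp l. \<phi> i (\<rho> h (alg_act e (\<rho> (- h) (b i)))))"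
      using functional_on_apply_sum[OF fi[OF i] stable_subspace[OF stS],
          of "sym_grp l" "\<lambda>h. \<rho> h (alg_act e (\<rho> (- h) (b i)))" "\<lambda>_. 1"]
        stable_rho[OF stS] alg_act_stable[OF stS] b[OF i] P_act[OF stable_mem[OF stS b[OF i]]] by simp
  qed
  also have "\<dots> = (\<Sum>h\<in>sym_grp l. \<Sum>i\<in>I. \<phi> i (\<rho> h (alg_act e (\<rho> (- h) (b i)))))" by (rule sum.swap)
  \<comment> \<open>Each conjugate of \<open>e\<close> has the same trace as \<open>e\<close>, which
    is the rank of \<open>e\<close>.\<close>
  also have "\<dots> = (\<Sum>h\<in>sym_grp l. of_nat (dim (alg_act e ` S)))"
  proof (intro sum.cong refl)
    fix h assume h: "h \<in> sym_grp l"
    then have h': "- h \<in> sym_grp l" by simp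
    have "(\<Sum>i\<in>I. \<phi> i (\<rho> h (alg_act e (\<rho> (- h) (b i)))))
        = (\<Sum>i\<in>I. \<phi> i (alg_act e (\<rho> (- h) (\<rho> h (b i)))))"
      by (rule frame_trace_commute[OF f f])
        (use lin_on_compose[OF linS(2)[OF h'] linS(1)] linS(2) im h h' in \<open>auto simp: image_subset_iff\<close>)
    also have "\<dots> = (\<Sum>i\<in>I. \<phi> i (alg_act e (b i)))"
      using rho_plus[OF h' h] rho_0 stable_mem[OF stS b] by (intro sum.cong) simp_all
    also have "\<dots> = of_nat (dim (alg_act e ` S))"
      using linS(1) im(1) alg_act_idem[OF e stable_mem[OF stS]] by (intro frame_trace_idempotent[OF f]) auto
    finally show "(\<Sum>i\<in>I. \<phi> i (\<rho> h (alg_act e (\<rho> (- h) (b i))))) = of_nat (dim (alg_act e ` S))" .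
  qed
  also have "\<dots> = fact l" by (simp add: d1 card_sym_grp)
  finally show "of_nat (dim S) = fact l * coef e 0"
    using primitive_coef_0_neq[OF e] by (simp add: field_simps)
qed

section \<open>The length of a representation\<close>

text \<open>The composition length of \<open>U\<close>. In this form it is visibly monotone in
  \<open>U\<close> and additive over direct sums, because ranks of operators preserving the summands
  are.\<close>

definition rep_length :: "galg set \<Rightarrow> 'b set \<Rightarrow> real" where
  "rep_length E U = (\<Sum>e\<in>E. of_nat (dim (alg_act e ` U)) / (fact l * Re (coef e 0)))"

lemma degree_pos: "primitive l e \<Longrightarrow> fact l * Re (coef e 0) > 0"
  using primitive_coef_0[of l e] by fastforce

text \<open>An \<open>e\<close> that kills \<open>S\<close> contributes 0 over any denominator, and
  the others all have denominator \<open>dim S\<close>; the ranks add up to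
  \<open>dim S\<close>.\<close>

lemma rep_length_simple:
  assumes E: "primitive_family l E" and S: "simple S"
  shows "rep_length E S = 1"
proof -
  have stS: "stable S" and "S \<noteq> {0}" using S by (auto simp: simple_def)
  then have d0: "dim S \<noteq> 0" using dim_eq_0_fin[OF stable_fin_dim] by blast
  have "rep_length E S = (\<Sum>e\<in>E. of_nat (dim (alg_act e ` S)) / of_nat (dim S))"
    unfolding rep_length_def
  proof (intro sum.cong refl)
    fix e assume "e \<in> E"
    then have e: "primitive l e" using E by (simp add: primitive_family_def)
    show "real (dim (alg_act e ` S)) / (fact l * Re (coef e 0)) = real (dim (alg_act e ` S)) / real (dim S)"
    proof (cases "alg_act e ` S = {0}")
      case True
      then show ?thesis using dim_eq_0_fin[of "{0}"] by (simp add: fin_dim_def exI[of _ "{}"])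
    next
      case False
      have "of_nat (dim S) = (fact l * coef e 0 :: complex)" by (rule simple_dim_alg_act(2)[OF S e False])
      then have "complex_of_real (real (dim S)) = complex_of_real (fact l) * coef e 0" by simp
      then have "real (dim S) = Re (complex_of_real (fact l) * coef e 0)" by (metis Re_complex_of_real)
      then have "real (dim S) = fact l * Re (coef e 0)" by (simp only: Re_complex_of_real Im_complex_of_real mult_zero_left times_complex.sel diff_zero)
      then show ?thesis by simp
    qed
  qed
  also have "\<dots> = of_nat (\<Sum>e\<in>E. dim (alg_act e ` S)) / of_nat (dim S)"
    by (simp add: sum_divide_distrib)
  finally show ?thesis using sum_dim_alg_act[OF E stS] d0 by simp
qed

lemma rep_length_mono:
  assumes E: "primitive_family l E" and "stable U" "stable U'" "U \<subseteq> U'"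
  shows "rep_length E U \<le> rep_length E U'"
  unfolding rep_length_def
proof (intro sum_mono divide_right_mono)
  fix e assume "e \<in> E"
  then have e: "primitive l e" using E by (simp add: primitive_family_def)
  show "0 \<le> fact l * Re (coef e 0)" using degree_pos[OF e] by simp
  show "real (dim (alg_act e ` U)) \<le> real (dim (alg_act e ` U'))"
    unfolding of_nat_le_iff
    by (intro dim_mono_fin fin_dim_image(1) stable_fin_dim subspace_image_lin_on image_mono
        lin_on_mono[OF alg_act_lin] stable_subset stable_subspace assms)
qed

lemma simple_exists:
  assumes "stable U" "U \<noteq> {0}"
  obtains S where "simple S" "S \<subseteq> U"
proof -
  let ?P = "\<lambda>S. stable S \<and> S \<noteq> {0} \<and> S \<subseteq> U"
  obtain S where S: "?P S" and min: "\<And>T. ?P T \<Longrightarrow> dim S \<le> dim T"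
    using ex_has_least_nat[of ?P U dim] assms by blast
  have "T = {0} \<or> T = S" if T: "stable T" "T \<subseteq> S" for T
  proof (rule ccontr)
    assume "\<not> (T = {0} \<or> T = S)"
    then have "T \<noteq> {0}" "T \<subset> S" using T by auto
    moreover have "T \<subseteq> U" using T S by blast
    ultimately have "dim S \<le> dim T" "dim T < dim S"
      using min[of T] T S dim_strict_mono_fin[OF stable_fin_dim stable_subspace, of S T] by blast+
    then show False by simp
  qed
  then have "simple S" using S by (auto simp: simple_def)
  then show ?thesis using that S by blast
qed

lemma rep_length_ge_1:
  assumes E: "primitive_family l E" and "stable U" "U \<noteq> {0}"
  shows "rep_length E U \<ge> 1"
proof -
  obtain S where S: "simple S" "S \<subseteq> U" using simple_exists[OF assms(2,3)] .
  then show ?thesis using rep_length_mono[OF E, of S U] rep_length_simple[OF E S(1)] assms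
    by (simp add: simple_def)
qed

lemma rep_length_le:
  assumes E: "primitive_family l E" and U: "stable U"
  shows "rep_length E U \<le> (\<Sum>e\<in>E. 1 / (fact l * Re (coef e 0))) * real (dim U)"
  unfolding rep_length_def sum_distrib_right
proof (intro sum_mono)
  fix e assume "e \<in> E"
  then have e: "primitive l e" using E by (simp add: primitive_family_def)
  have "dim (alg_act e ` U) \<le> dim U"
    by (intro fin_dim_image(2) lin_on_mono[OF alg_act_lin] stable_subset U stable_fin_dim)
  then show "real (dim (alg_act e ` U)) / (fact l * Re (coef e 0))
      \<le> 1 / (fact l * Re (coef e 0)) * real (dim U)"
    using degree_pos[OF e] by (simp add: divide_right_mono)
qed

lemma rep_length_direct_sum:
  assumes "finite I" "direct_sum I U W" "\<And>i. i \<in> I \<Longrightarrow> stable (U i)"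
  shows "rep_length E W = (\<Sum>i\<in>I. rep_length E (U i))"
proof -
  have "dim (alg_act e ` W) = (\<Sum>i\<in>I. dim (alg_act e ` U i))" for e
    using assms stable_subspace alg_act_stable alg_act_lin W
    by (intro dim_image_direct_sum) (auto simp: image_subset_iff)
  then have "rep_length E W = (\<Sum>e\<in>E. \<Sum>i\<in>I. of_nat (dim (alg_act e ` U i)) / (fact l * Re (coef e 0)))"
    by (simp add: rep_length_def sum_divide_distrib)
  also have "\<dots> = (\<Sum>i\<in>I. rep_length E (U i))"
    unfolding rep_length_def by (rule sum.swap)
  finally show ?thesis .
qed

text \<open>Maschke's argument: a linear projection onto \<open>X\<close>, averaged over conjugation
  by the group, commutes with the group and still fixes \<open>X\<close>; its kernel is the
  complement.\<close>

lemma stable_complement: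
  assumes U: "stable U" and X: "stable X" "X \<subseteq> U"
  obtains Y where "stable Y" "Y \<subseteq> U" "X \<inter> Y = {0}" "\<And>u. u \<in> U \<Longrightarrow> \<exists>x\<in>X. \<exists>y\<in>Y. u = x + y"
proof -
  have "\<exists>p. lin_on U p \<and> p ` U \<subseteq> X \<and> (\<forall>x\<in>X. p x = x)"
    by (rule projection_exists[OF stable_fin_dim[OF U] stable_subspace[OF X(1)] X(2)]) blast
  then obtain p where "lin_on U p \<and> p ` U \<subseteq> X \<and> (\<forall>x\<in>X. p x = x)" by (rule exE)
  then have p: "lin_on U p" "p ` U \<subseteq> X" "\<And>x. x \<in> X \<Longrightarrow> p x = x" by auto
  note sU = stable_subspace[OF U] and sX = stable_subspace[OF X(1)]
  define P where "P u = (1 / fact l) \<cdot> (\<Sum>g\<in>sym_grp l. \<rho> g (p (\<rho> (- g) u)))" for u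
  have linU: "lin_on U (\<rho> q)" if "q \<in> sym_grp l" for q
    using lin_on_mono[OF rho_lin[OF that] stable_subset[OF U]] .
  have linP: "lin_on U P" unfolding P_def
  proof (intro lin_on_scale lin_on_sum)
    fix g assume g: "g \<in> sym_grp l"
    then have g': "- g \<in> sym_grp l" by simp
    have "lin_on U (\<lambda>u. p (\<rho> (- g) u))"
      using lin_on_compose[OF linU[OF g'] p(1)] stable_rho[OF U g'] by blast
    then show "lin_on U (\<lambda>u. \<rho> g (p (\<rho> (- g) u)))"
      by (rule lin_on_compose[OF _ linU[OF g]]) (use p(2) X(2) stable_rho[OF U g'] in blast)
  qed
  have PX: "P u \<in> X" if "u \<in> U" for u
    unfolding P_def using p(2) stable_rho[OF U _ that]
    by (intro subspace_scale subspace_sum sX stable_rho[OF X(1)]) auto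
  have Px: "P x = x" if x: "x \<in> X" for x
  proof -
    have "\<rho> g (p (\<rho> (- g) x)) = x" if g: "g \<in> sym_grp l" for g
    proof -
      have "p (\<rho> (- g) x) = \<rho> (- g) x" using p(3) stable_rho[OF X(1), of "- g" x] x g by simp
      then show ?thesis using rho_plus[of g "- g" x] g x stable_mem[OF X(1) x] rho_0 by simp
    qed
    then have "P x = (1 / fact l) \<cdot> (of_nat (card (sym_grp l)) \<cdot> x)"
      unfolding P_def by (simp add: sum_constant_scale)
    then show ?thesis by (simp add: card_sym_grp)
  qed
  have Prho: "P (\<rho> k u) = \<rho> k (P u)" if k: "k \<in> sym_grp l" and u: "u \<in> U" for k u
  proof -
    have uW: "u \<in> W" using stable_mem[OF U u] .
    have pW: "p (\<rho> (- g) u) \<in> W" if "g \<in> sym_grp l" for g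
      using p(2) stable_rho[OF U, of "- g" u] that u stable_mem[OF X(1)] by auto
    have "(\<Sum>g\<in>sym_grp l. \<rho> g (p (\<rho> (- g) (\<rho> k u))))
        = (\<Sum>g\<in>sym_grp l. \<rho> (k + g) (p (\<rho> (- (k + g)) (\<rho> k u))))"
      by (rule sum.reindex_bij_betw[OF bij_betw_sym_grp_add(2)[OF k], symmetric])
    also have "\<dots> = (\<Sum>g\<in>sym_grp l. \<rho> k (\<rho> g (p (\<rho> (- g) u))))"
    proof (intro sum.cong refl)
      fix g assume g: "g \<in> sym_grp l"
      have "- (k + g) + k = - g" by (simp only: minus_add add.assoc left_minus add_0_right)
      then have "\<rho> (- (k + g)) (\<rho> k u) = \<rho> (- g) u"
        using rho_plus[of "- (k + g)" k u] g k uW sym_grp_plus[OF k g] by (simp only: sym_grp_uminus)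
      then show "\<rho> (k + g) (p (\<rho> (- (k + g)) (\<rho> k u))) = \<rho> k (\<rho> g (p (\<rho> (- g) u)))"
        using rho_plus[OF k g pW[OF g]] by simp
    qed
    also have "\<dots> = \<rho> k (\<Sum>g\<in>sym_grp l. \<rho> g (p (\<rho> (- g) u)))"
      using lin_on_apply_sum'[OF rho_lin[OF k] sW, of "sym_grp l" "\<lambda>g. \<rho> g (p (\<rho> (- g) u))"]
        rho_mem pW by simp
    finally show ?thesis
      unfolding P_def using rho_lin[OF k] rho_mem pW by (simp add: lin_on_def subspace_sum[OF sW])
  qed
  let ?Y = "{u \<in> U. P u = 0}"
  show ?thesis
  proof
    show "stable ?Y" unfolding stable_def
    proof (intro conjI ballI)
      show "subspace ?Y"
        using linP sU lin_on_0[OF linP sU] by (auto simp: subspace_def lin_on_def)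
      show "?Y \<subseteq> W" using stable_subset[OF U] by blast
      show "\<rho> k ` ?Y \<subseteq> ?Y" if k: "k \<in> sym_grp l" for k
        using Prho[OF k] stable_rho[OF U k] lin_on_0[OF rho_lin[OF k] sW] by auto
    qed
    show "X \<inter> ?Y = {0}"
      using Px X(2) subspace_0[OF sX] lin_on_0[OF linP sU] by force
    show "\<exists>x\<in>X. \<exists>y\<in>?Y. u = x + y" if u: "u \<in> U" for u
    proof (intro bexI)
      show "u = P u + (u - P u)" by simp
      have PU: "P u \<in> U" using PX[OF u] X(2) by blast
      have du: "u - P u \<in> U" using subspace_diff[OF sU u PU] .
      have "P u = P (u - P u) + P (P u)" using linP du PU unfolding lin_on_def by (metis diff_add_cancel)
      then have "P (u - P u) = 0" using Px[OF PX[OF u]] by simp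
      then show "u - P u \<in> ?Y" using du by simp
    qed (rule PX[OF u])
  qed auto
qed

end

section \<open>Decompositions in the presence of noninvertible operators\<close>

text \<open>\<open>I\<close> consists of total functions of which only the values on
  \<open>W\<close> matter. Closure under multiplication by group elements is therefore expressed by
  some \<open>s \<in> I\<close> that agrees with the composite on \<open>W\<close>.\<close>

locale unit_rep = sym_rep scale l \<rho> W
  for scale :: "complex \<Rightarrow> 'b::ab_group_add \<Rightarrow> 'b" (infixr \<open>\<cdot>\<close> 75)
    and l :: nat and \<rho> :: "nat perm \<Rightarrow> 'b \<Rightarrow> 'b" and W :: "'b set" +
  fixes I :: "('b \<Rightarrow> 'b) set"
  assumes fin_I: "finite I"
    and I_lin: "t \<in> I \<Longrightarrow> lin_on W t"
    and I_W: "t \<in> I \<Longrightarrow> t ` W \<subseteq> W"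
    and I_left: "t \<in> I \<Longrightarrow> p \<in> sym_grp l \<Longrightarrow> \<exists>s\<in>I. \<forall>w\<in>W. \<rho> p (t w) = s w"
    and I_right: "t \<in> I \<Longrightarrow> p \<in> sym_grp l \<Longrightarrow> \<exists>s\<in>I. \<forall>w\<in>W. t (\<rho> p w) = s w"
begin

lemma stable_complement_ex:
  assumes "stable U" "stable X" "X \<subseteq> U"
  shows "\<exists>Y. stable Y \<and> Y \<subseteq> U \<and> X \<inter> Y = {0} \<and> (\<forall>u\<in>U. \<exists>x\<in>X. \<exists>y\<in>Y. u = x + y)"
  by (rule stable_complement[OF assms]) (intro exI conjI ballI)

text \<open>\<open>msub\<close>, \<open>indec\<close> and \<open>decomposition\<close> restate the
  notions for modules over the monoid, with the unit group and the remaining operators kept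
  apart.\<close>

definition msub :: "'b set \<Rightarrow> bool" where
  "msub U \<longleftrightarrow> stable U \<and> (\<forall>t\<in>I. t ` U \<subseteq> U)"

definition indec :: "'b set \<Rightarrow> bool" where
  "indec U \<longleftrightarrow> msub U \<and> U \<noteq> {0} \<and>
     \<not> (\<exists>A B. msub A \<and> msub B \<and> A \<noteq> {0} \<and> B \<noteq> {0} \<and> bij_betw (\<lambda>(u, v). u + v) (A \<times> B) U)"

definition decomposition :: "'b set \<Rightarrow> nat \<Rightarrow> (nat \<Rightarrow> 'b set) \<Rightarrow> bool" where
  "decomposition U k X \<longleftrightarrow> (\<forall>i<k. indec (X i)) \<and> direct_sum {..<k} X U"

lemma msub_stable: "msub U \<Longrightarrow> stable U" by (simp add: msub_def)

lemma msub_subspace: "msub U \<Longrightarrow> subspace U" by (simp add: msub_def stable_def)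

lemma msub_W: "msub W" using stable_W I_W by (simp add: msub_def)

lemma sum_lessThan_add: "(\<Sum>i<k + m. f i) = (\<Sum>i<k. f i) + (\<Sum>i<m. f (k + i))"
  for f :: "nat \<Rightarrow> 'b"
  by (induction m) (simp_all add: add.assoc)

lemma decomposition_exists:
  assumes "msub U"
  shows "\<exists>k X. decomposition U k X"
  using assms
proof (induction "dim U" arbitrary: U rule: less_induct)
  case less
  have fU: "fin_dim U" using stable_fin_dim[OF msub_stable[OF less.prems]] .
  consider "U = {0}" | "indec U" | A B where "msub A" "msub B" "A \<noteq> {0}" "B \<noteq> {0}"
    "bij_betw (\<lambda>(u, v). u + v) (A \<times> B) U"
    using less.prems by (auto simp: indec_def)
  then show ?case
  proof cases
    case 1
    have "direct_sum {..<0::nat} (\<lambda>_. {0}) U" using 1 by (intro direct_sumI) auto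
    then show ?thesis unfolding decomposition_def by (intro exI[of _ 0] exI[of _ "\<lambda>_. {0}"]) simp
  next
    case 2
    have "direct_sum {..<1::nat} (\<lambda>_. U) U"
      using fin_dim_subspace[OF fU] by (intro direct_sumI) auto
    then show ?thesis using 2 unfolding decomposition_def by (intro exI[of _ 1] exI[of _ "\<lambda>_. U"]) simp
  next
    case 3
    note s = msub_subspace[OF 3(1)] msub_subspace[OF 3(2)]
    note d = bij_betw_sumD[OF s 3(5)]
    obtain a b where ab: "a \<in> A" "a \<noteq> 0" "b \<in> B" "b \<noteq> 0" using 3(3,4) subspace_0[OF s(1)] subspace_0[OF s(2)] by blast
    have "A \<subset> U" "B \<subset> U" using d(1,2,3) ab by blast+
    then have "dim A < dim U" "dim B < dim U" using dim_strict_mono_fin[OF fU] s by blast+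
    then obtain k X m Y where X: "decomposition A k X" and Y: "decomposition B m Y"
      using less.hyps[OF _ 3(1)] less.hyps[OF _ 3(2)] by blast
    have dX: "direct_sum {..<k} X A" and dY: "direct_sum {..<m} Y B"
      and iX: "\<And>i. i < k \<Longrightarrow> indec (X i)" and iY: "\<And>i. i < m \<Longrightarrow> indec (Y i)"
      using X Y by (auto simp: decomposition_def)
    define Z where "Z i = (if i < k then X i else Y (i - k))" for i
    have Zi: "indec (Z i)" if "i < k + m" for i using that iX iY by (auto simp: Z_def)
    have Zs: "subspace (Z i)" if "i < k + m" for i
      using Zi[OF that] msub_subspace by (simp add: indec_def)
    have Xs: "subspace (X i)" if "i < k" for i using Zs[of i] that by (simp add: Z_def)
    have Ys: "subspace (Y i)" if "i < m" for i using Zs[of "k + i"] that by (simp add: Z_def)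
    have "direct_sum {..<k + m} Z U"
    proof (rule direct_sumI)
      show "subspace (Z i)" if "i \<in> {..<k + m}" for i using Zs that by simp
      fix u assume "\<And>i. i \<in> {..<k + m} \<Longrightarrow> u i \<in> Z i"
      then have u: "\<And>i. i \<in> {..<k + m} \<Longrightarrow> u i \<in> Z i" .
      have uX: "u i \<in> X i" if "i \<in> {..<k}" for i using u[of i] that by (simp add: Z_def)
      have uY: "u (k + i) \<in> Y i" if "i \<in> {..<m}" for i using u[of "k + i"] that by (simp add: Z_def)
      have mem: "(\<Sum>i<k. u i) \<in> A" "(\<Sum>i<m. u (k + i)) \<in> B"
        using direct_sum_sum_mem[OF dX, of u] direct_sum_sum_mem[OF dY, of "\<lambda>i. u (k + i)"] uX uY by auto
      then show "(\<Sum>i<k + m. u i) \<in> U" unfolding sum_lessThan_add by (rule d(5))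
      fix i assume z: "(\<Sum>i<k + m. u i) = 0" and i: "i \<in> {..<k + m}"
      have zero: "(\<Sum>i<k. u i) = 0" "(\<Sum>i<m. u (k + i)) = 0"
        using d(6)[OF mem] z unfolding sum_lessThan_add by auto
      show "u i = 0"
      proof (cases "i < k")
        case True
        then show ?thesis
          using direct_sum_unique[OF dX, of u "\<lambda>_. 0" i] uX zero(1) subspace_0[OF Xs] by simp
      next
        case False
        then show ?thesis
          using direct_sum_unique[OF dY, of "\<lambda>i. u (k + i)" "\<lambda>_. 0" "i - k"] uY zero(2) subspace_0[OF Ys] i
          by simp
      qed
    next
      fix w assume "w \<in> U"
      then obtain a b where ab: "a \<in> A" "b \<in> B" "w = a + b" using d(4) by blast
      obtain u v where u: "u \<in> Pi\<^sub>E {..<k} X" "a = (\<Sum>i<k. u i)" and v: "v \<in> Pi\<^sub>E {..<m} Y" "b = (\<Sum>i<m. v i)"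
        using dX dY ab(1,2) unfolding direct_sum_def bij_betw_def by blast
      let ?x = "\<lambda>i. if i < k then u i else v (i - k)"
      have "w = (\<Sum>i<k + m. ?x i)" unfolding sum_lessThan_add using ab(3) u(2) v(2) by simp
      moreover have "\<forall>i\<in>{..<k + m}. ?x i \<in> Z i" using u(1) v(1) by (auto simp: Z_def PiE_iff)
      ultimately show "\<exists>x. (\<forall>i\<in>{..<k + m}. x i \<in> Z i) \<and> w = (\<Sum>i<k + m. x i)"
        by (intro exI[of _ ?x] conjI)
    qed
    then show ?thesis using Zi
      by (intro exI[of _ "k + m"] exI[of _ Z]) (simp add: decomposition_def)
  qed
qed

text \<open>Operators that vanish on \<open>U\<close> preserve every subspace of \<open>U\<close>,
  so the Maschke complement of a stable subspace is itself a submodule.\<close>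

lemma indec_simple:
  assumes U: "indec U" and z: "\<And>t u. t \<in> I \<Longrightarrow> u \<in> U \<Longrightarrow> t u = 0"
  shows "simple U"
  unfolding simple_def
proof (intro conjI allI impI)
  show sU: "stable U" and "U \<noteq> {0}" using U by (auto simp: indec_def msub_def)
  fix T assume "stable T \<and> T \<subseteq> U"
  then have T: "stable T" "T \<subseteq> U" by auto
  from stable_complement_ex[OF sU T] obtain Y
    where "stable Y \<and> Y \<subseteq> U \<and> T \<inter> Y = {0} \<and> (\<forall>u\<in>U. \<exists>x\<in>T. \<exists>y\<in>Y. u = x + y)" by (rule exE)
  then have Y: "stable Y" "Y \<subseteq> U" "T \<inter> Y = {0}" "\<And>u. u \<in> U \<Longrightarrow> \<exists>x\<in>T. \<exists>y\<in>Y. u = x + y"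
    by - ((elim conjE, assumption)+, elim conjE, erule bspec)
  have "msub X" if "stable X" "X \<subseteq> U" for X
    unfolding msub_def
  proof (intro conjI ballI subsetI that(1))
    fix t x assume "t \<in> I" "x \<in> t ` X"
    then have "x = 0" using z that(2) by blast
    then show "x \<in> X" using subspace_0[OF stable_subspace[OF that(1)]] by simp
  qed
  moreover have "bij_betw (\<lambda>(u, v). u + v) (T \<times> Y) U"
    using T Y by (intro bij_betw_sumI stable_subspace sU) auto
  ultimately have "T = {0} \<or> Y = {0}" using U T Y(1,2) unfolding indec_def by blast
  then show "T = {0} \<or> T = U"
  proof
    assume "Y = {0}"
    then have "U \<subseteq> T" using Y(4) by auto
    then show ?thesis using T(2) by blast
  qed simp
qed

lemma stable_sum: "stable A \<Longrightarrow> stable B \<Longrightarrow> stable {a + b |a b. a \<in> A \<and> b \<in> B}"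
  unfolding stable_def
proof (intro conjI ballI)
  assume A: "subspace A \<and> A \<subseteq> W \<and> (\<forall>p\<in>sym_grp l. \<rho> p ` A \<subseteq> A)"
    and B: "subspace B \<and> B \<subseteq> W \<and> (\<forall>p\<in>sym_grp l. \<rho> p ` B \<subseteq> B)"
  show "subspace {a + b |a b. a \<in> A \<and> b \<in> B}" using A B subspace_sums by blast
  show "{a + b |a b. a \<in> A \<and> b \<in> B} \<subseteq> W" using A B subspace_add[OF sW] by blast
  fix p assume p: "p \<in> sym_grp l"
  show "\<rho> p ` {a + b |a b. a \<in> A \<and> b \<in> B} \<subseteq> {a + b |a b. a \<in> A \<and> b \<in> B}"
  proof clarify
    fix a b assume ab: "a \<in> A" "b \<in> B"
    then have "\<rho> p (a + b) = \<rho> p a + \<rho> p b" "\<rho> p a \<in> A" "\<rho> p b \<in> B"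
      using A B rho_lin[OF p] p unfolding lin_on_def by blast+
    then show "\<exists>a' b'. \<rho> p (a + b) = a' + b' \<and> a' \<in> A \<and> b' \<in> B" by blast
  qed
qed

text \<open>
  If the noninvertible operators do not all vanish on \<open>U\<close>, a complement of \<open>K \<inter> J\<close> in their
  common kernel \<open>K\<close> (with \<open>J\<close> spanned by their images) would split off; so \<open>K \<subseteq> J\<close>.
\<close>

lemma indec_dim_le:
  assumes U: "indec U" and nz: "\<exists>t\<in>I. \<exists>u\<in>U. t u \<noteq> 0"
  shows "dim U \<le> 2 * (\<Sum>t\<in>I. dim (t ` U))"
proof -
  have mU: "msub U" and sU: "stable U" using U by (auto simp: indec_def msub_def)
  note subU = stable_subspace[OF sU] and UW = stable_subset[OF sU] and fU = stable_fin_dim[OF sU]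
  have lU: "lin_on U t" if "t \<in> I" for t using lin_on_mono[OF I_lin[OF that] UW] .
  define K where "K = {u \<in> U. \<forall>t\<in>I. t u = 0}"
  define J where "J = span (\<Union>t\<in>I. t ` U)"
  have K_iff: "u \<in> K \<longleftrightarrow> u \<in> U \<and> (\<forall>t\<in>I. t u = 0)" for u by (simp add: K_def)
  have bound: "dim U \<le> dim K + (\<Sum>t\<in>I. dim (t ` U))" and subK: "subspace K"
    using dim_le_common_kernel[OF fin_I fU lU] unfolding K_def by blast+
  have subJ: "subspace J" unfolding J_def by (rule subspace_span)
  have tU: "t u \<in> U" if "t \<in> I" "u \<in> U" for t u using mU that unfolding msub_def by blast
  have tJ: "t u \<in> J" if "t \<in> I" "u \<in> U" for t u unfolding J_def using that by (intro span_base) blast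
  have J_min: "J \<subseteq> L" if "subspace L" "\<And>t u. t \<in> I \<Longrightarrow> u \<in> U \<Longrightarrow> t u \<in> L" for L
    unfolding J_def using that by (intro span_minimal) auto
  have JU: "J \<subseteq> U" by (rule J_min[OF subU]) (rule tU)
  have sK: "stable K" unfolding stable_def
  proof (intro conjI ballI subK)
    show "K \<subseteq> W" using UW K_iff by blast
    fix p assume p: "p \<in> sym_grp l"
    show "\<rho> p ` K \<subseteq> K"
    proof clarify
      fix u assume u: "u \<in> K"
      then have uU: "u \<in> U" by (simp add: K_iff)
      have "t (\<rho> p u) = 0" if t: "t \<in> I" for t
      proof -
        obtain s where "s \<in> I" "\<forall>w\<in>W. t (\<rho> p w) = s w" using I_right[OF t p] by blast
        then show ?thesis using u uU UW by (auto simp: K_iff)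
      qed
      then show "\<rho> p u \<in> K" using stable_rho[OF sU p uU] by (simp add: K_iff)
    qed
  qed
  have sJ: "stable J" unfolding stable_def
  proof (intro conjI ballI subJ)
    show "J \<subseteq> W" using JU UW by blast
    fix p assume p: "p \<in> sym_grp l"
    let ?L = "{x \<in> U. \<rho> p x \<in> J}"
    have lp: "lin_on U (\<rho> p)" using lin_on_mono[OF rho_lin[OF p] UW] .
    have "J \<subseteq> ?L"
    proof (rule J_min)
      show "t u \<in> ?L" if t: "t \<in> I" and u: "u \<in> U" for t u
      proof -
        obtain s where s: "s \<in> I" "\<forall>w\<in>W. \<rho> p (t w) = s w" using I_left[OF t p] by blast
        then have "\<rho> p (t u) = s u" using u UW by blast
        then show ?thesis using tJ[OF s(1) u] tU[OF t u] by simp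
      qed
      show "subspace ?L"
        using subU lp lin_on_0[OF lp subU] subJ unfolding subspace_def lin_on_def by auto
    qed
    then show "\<rho> p ` J \<subseteq> J" by blast
  qed
  define X where "X = K \<inter> J"
  have XK: "X \<subseteq> K" by (simp add: X_def)
  have sX: "stable X" unfolding stable_def
  proof (intro conjI ballI)
    show "subspace X" unfolding X_def by (rule subspace_inter[OF subK subJ])
    show "X \<subseteq> W" using stable_subset[OF sK] XK by blast
    show "\<rho> p ` X \<subseteq> X" if "p \<in> sym_grp l" for p
      using stable_rho[OF sK that] stable_rho[OF sJ that] unfolding X_def by blast
  qed
  from stable_complement_ex[OF sK sX XK] obtain S
    where "stable S \<and> S \<subseteq> K \<and> X \<inter> S = {0} \<and> (\<forall>u\<in>K. \<exists>x\<in>X. \<exists>y\<in>S. u = x + y)" by (rule exE)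
  then have S: "stable S" "S \<subseteq> K" "X \<inter> S = {0}" "\<And>u. u \<in> K \<Longrightarrow> \<exists>x\<in>X. \<exists>y\<in>S. u = x + y"
    by - ((elim conjE, assumption)+, elim conjE, erule bspec)
  have SU: "S \<subseteq> U" using S(2) K_iff by blast
  define Z where "Z = {a + b |a b. a \<in> J \<and> b \<in> S}"
  have sZ: "stable Z" unfolding Z_def by (rule stable_sum[OF sJ S(1)])
  have ZU: "Z \<subseteq> U" unfolding Z_def using JU SU subspace_add[OF subU] by blast
  from stable_complement_ex[OF sU sZ ZU] obtain T'
    where "stable T' \<and> T' \<subseteq> U \<and> Z \<inter> T' = {0} \<and> (\<forall>u\<in>U. \<exists>x\<in>Z. \<exists>y\<in>T'. u = x + y)" by (rule exE)
  then have T': "stable T'" "T' \<subseteq> U" "Z \<inter> T' = {0}" "\<And>u. u \<in> U \<Longrightarrow> \<exists>x\<in>Z. \<exists>y\<in>T'. u = x + y"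
    by - ((elim conjE, assumption)+, elim conjE, erule bspec)
  \<comment> \<open>A stable subspace of \<open>U\<close> that contains \<open>J\<close> is
    invariant under \<open>I\<close>, because all images lie in \<open>J\<close>. So
    \<open>T\<close> is a submodule; \<open>S\<close> is one because \<open>I\<close> kills
    it.\<close>
  define T where "T = {a + b |a b. a \<in> J \<and> b \<in> T'}"
  have sT: "stable T" unfolding T_def by (rule stable_sum[OF sJ T'(1)])
  have TU: "T \<subseteq> U" unfolding T_def using JU T'(2) subspace_add[OF subU] by blast
  have JT: "J \<subseteq> T"
  proof
    fix x assume "x \<in> J"
    moreover have "x = x + 0" by simp
    ultimately show "x \<in> T" unfolding T_def using subspace_0[OF stable_subspace[OF T'(1)]] by blast
  qed
  have mT: "msub T" unfolding msub_def using sT tJ TU JT by blast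
  have mS: "msub S" unfolding msub_def
  proof (intro conjI ballI S(1))
    fix t assume "t \<in> I"
    then have "t s = 0" if "s \<in> S" for s using S(2) K_iff that by blast
    then show "t ` S \<subseteq> S" using subspace_0[OF stable_subspace[OF S(1)]] by auto
  qed
  have "bij_betw (\<lambda>(u, v). u + v) (S \<times> T) U"
  proof (rule bij_betw_sumI[OF stable_subspace[OF S(1)] stable_subspace[OF sT] _ SU TU subU])
    show "S \<inter> T = {0}"
    proof (intro equalityI subsetI)
      fix x assume x: "x \<in> S \<inter> T"
      then obtain a b where ab: "a \<in> J" "b \<in> T'" "x = a + b" unfolding T_def by blast
      have "b = - a + x" using ab by simp
      moreover have "- a \<in> J" using subspace_neg[OF subJ ab(1)] .
      ultimately have "b \<in> Z \<inter> T'" using x ab(2) unfolding Z_def by blast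
      then have "b = 0" using T'(3) by blast
      then have "x \<in> X \<inter> S" using ab x S(2) by (auto simp: X_def)
      then show "x \<in> {0}" using S(3) by blast
    qed (use subspace_0[OF stable_subspace[OF S(1)]] subspace_0[OF stable_subspace[OF sT]] in auto)
    show "\<exists>a\<in>S. \<exists>b\<in>T. u = a + b" if u: "u \<in> U" for u
    proof -
      obtain z b where zb: "z \<in> Z" "b \<in> T'" "u = z + b" using T'(4)[OF u] by blast
      then obtain a s where as: "a \<in> J" "s \<in> S" "z = a + s" unfolding Z_def by blast
      have "u = s + (a + b)" using zb(3) as(3) by (simp add: algebra_simps)
      moreover have "a + b \<in> T" unfolding T_def using as(1) zb(2) by blast
      ultimately show ?thesis using as(2) by blast
    qed
  qed
  then have "S = {0} \<or> T = {0}" using U mS mT unfolding indec_def by blast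
  moreover have "T \<noteq> {0}" using nz tJ JT by blast
  ultimately have S0: "S = {0}" by blast
  have KJ: "K \<subseteq> J"
  proof
    fix u assume "u \<in> K"
    then obtain x y where "x \<in> X" "y \<in> S" "u = x + y" using S(4) by blast
    then show "u \<in> J" using S0 by (simp add: X_def)
  qed
  have fJ: "fin_dim J" using stable_fin_dim[OF sJ] .
  \<comment> \<open>The factor 2 arises here: one sum of ranks bounds the codimension of
    \<open>K\<close> in \<open>U\<close>, and a second one bounds \<open>dim J\<close>, hence
    \<open>dim K\<close>.\<close>
  have "dim K \<le> dim J" by (rule dim_mono_fin[OF fJ subK KJ])
  also have "\<dots> \<le> (\<Sum>t\<in>I. dim (t ` U))"
    unfolding J_def using fin_dim_image(1)[OF lU fU] by (intro dim_span_UNION_le fin_I)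
  finally show ?thesis using bound by simp
qed

text \<open>Every summand has length at least 1. It is exactly 1 if \<open>I\<close> vanishes on the
  summand, which is then simple; otherwise it is at most a constant times the dimension, and the
  dimension is bounded by the ranks of \<open>I\<close> on that summand.\<close>

lemma decomposition_bounds:
  assumes E: "primitive_family l E" and d: "decomposition W k X"
  shows "real k \<le> rep_length E W"
    and "rep_length E W \<le> real k + 2 * (\<Sum>e\<in>E. 1 / (fact l * Re (coef e 0))) * (\<Sum>t\<in>I. real (dim (t ` W)))"
proof -
  let ?C = "\<Sum>e\<in>E. 1 / (fact l * Re (coef e 0))"
  have C: "?C \<ge> 0"
  proof (rule sum_nonneg)
    fix e assume "e \<in> E"
    then have "primitive l e" using E by (simp add: primitive_family_def)
    then show "0 \<le> 1 / (fact l * Re (coef e 0))" using degree_pos[of e] by simp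
  qed
  have X: "\<And>i. i < k \<Longrightarrow> indec (X i)" and dX: "direct_sum {..<k} X W"
    using d by (auto simp: decomposition_def)
  have sX: "stable (X i)" "X i \<noteq> {0}" "msub (X i)" if "i < k" for i
    using X[OF that] by (auto simp: indec_def msub_def)
  have len: "rep_length E W = (\<Sum>i<k. rep_length E (X i))"
    using rep_length_direct_sum[OF _ dX] sX(1) by simp
  have "real k = (\<Sum>i<k. 1)" by simp
  also have "\<dots> \<le> (\<Sum>i<k. rep_length E (X i))"
    using rep_length_ge_1[OF E] sX by (intro sum_mono) auto
  finally show "real k \<le> rep_length E W" using len by simp
  have "rep_length E (X i) \<le> 1 + 2 * ?C * (\<Sum>t\<in>I. real (dim (t ` X i)))" if i: "i < k" for i
  proof (cases "\<exists>t\<in>I. \<exists>u\<in>X i. t u \<noteq> 0")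
    case True
    have "rep_length E (X i) \<le> ?C * real (dim (X i))" by (rule rep_length_le[OF E sX(1)[OF i]])
    also have "\<dots> \<le> ?C * real (2 * (\<Sum>t\<in>I. dim (t ` X i)))"
      by (rule mult_left_mono[OF _ C]) (simp only: of_nat_le_iff indec_dim_le[OF X[OF i] True])
    finally show ?thesis by simp
  next
    case False
    then have "simple (X i)" by (intro indec_simple[OF X[OF i]]) blast
    then have "rep_length E (X i) = 1" by (rule rep_length_simple[OF E])
    moreover have "0 \<le> 2 * ?C * (\<Sum>t\<in>I. real (dim (t ` X i)))"
      by (rule mult_nonneg_nonneg[OF mult_nonneg_nonneg[OF _ C]]) (simp_all add: sum_nonneg)
    ultimately show ?thesis by simp
  qed
  then have "rep_length E W \<le> (\<Sum>i<k. 1 + 2 * ?C * (\<Sum>t\<in>I. real (dim (t ` X i))))"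
    unfolding len by (intro sum_mono) auto
  also have "\<dots> = real k + 2 * ?C * (\<Sum>i<k. \<Sum>t\<in>I. real (dim (t ` X i)))"
    by (simp add: sum.distrib sum_distrib_left)
  \<comment> \<open>Each operator preserves the summands, so its ranks on them add up to its rank on
    \<open>W\<close>; the error does not grow with the number of summands.\<close>
  also have "(\<Sum>i<k. \<Sum>t\<in>I. real (dim (t ` X i))) = (\<Sum>t\<in>I. real (dim (t ` W)))"
  proof -
    have "real (dim (t ` W)) = (\<Sum>i<k. real (dim (t ` X i)))" if t: "t \<in> I" for t
    proof -
      have "dim (t ` W) = (\<Sum>i<k. dim (t ` X i))"
        using sX t stable_subspace I_lin W by (intro dim_image_direct_sum[OF _ dX]) (auto simp: msub_def)
      then show ?thesis by simp
    qed
    then have "(\<Sum>t\<in>I. real (dim (t ` W))) = (\<Sum>t\<in>I. \<Sum>i<k. real (dim (t ` X i)))"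
      by (rule sum.cong[OF refl])
    also have "\<dots> = (\<Sum>i<k. \<Sum>t\<in>I. real (dim (t ` X i)))" by (rule sum.swap)
    finally show ?thesis by (rule sym)
  qed
  finally show "rep_length E W \<le> real k + 2 * ?C * (\<Sum>t\<in>I. real (dim (t ` W)))" .
qed

end

section \<open>Tensor powers\<close>

lemma sum_fun_apply: "(\<Sum>i\<in>I. f i) x = (\<Sum>i\<in>I. f i x)"
  for f :: "'i \<Rightarrow> 'x \<Rightarrow> 'y::comm_monoid_add"
  by (induction I rule: infinite_finite_induct) (auto simp: zero_fun_def plus_fun_def)

abbreviation words :: "nat \<Rightarrow> 'a set \<Rightarrow> 'a list set" where
  "words n C \<equiv> {cs. set cs \<subseteq> C \<and> length cs = n}"

lemma words_Suc: "words (Suc n) C = (\<lambda>(c, cs). c # cs) ` (C \<times> words n C)"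
  by (auto simp: length_Suc_conv image_iff)

lemma prod_sum_words:
  fixes F :: "nat \<Rightarrow> 'c \<Rightarrow> 'd::comm_semiring_1"
  assumes "finite C"
  shows "(\<Prod>i<n. \<Sum>c\<in>C. F i c) = (\<Sum>cs\<in>words n C. \<Prod>i<n. F i (cs ! i))"
proof (induction n arbitrary: F)
  case 0
  have "words 0 C = {[]}" by auto
  then show ?case by simp
next
  case (Suc n)
  have "(\<Prod>i<Suc n. \<Sum>c\<in>C. F i c) = (\<Sum>c\<in>C. F 0 c) * (\<Sum>cs\<in>words n C. \<Prod>i<n. F (Suc i) (cs ! i))"
    by (simp only: prod.lessThan_Suc_shift Suc)
  also have "\<dots> = (\<Sum>(c, cs)\<in>C \<times> words n C. F 0 c * (\<Prod>i<n. F (Suc i) (cs ! i)))"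
    by (simp add: sum_product sum.cartesian_product)
  also have "\<dots> = (\<Sum>cs\<in>words (Suc n) C. \<Prod>i<Suc n. F i (cs ! i))"
    unfolding words_Suc by (subst sum.reindex) (auto simp: inj_on_def prod.lessThan_Suc_shift intro!: sum.cong simp del: prod.lessThan_Suc)
  finally show ?case .
qed

interpretation tensor: complex_vector_space "tensor_scale :: complex \<Rightarrow> 'v tensor \<Rightarrow> 'v tensor"
  unfolding complex_vector_space_def by (rule vector_space_tensor)

text \<open>The diagonal action of a single linear map, obtained from \<open>tensor_act\<close> with
  a one-element index type. It separates the calculations with tensors from the monoid.\<close>

definition tensor_map ::
  "(complex \<Rightarrow> 'v::ab_group_add \<Rightarrow> 'v) \<Rightarrow> ('v \<Rightarrow> 'v) \<Rightarrow> 'v tensor \<Rightarrow> 'v tensor" where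
  "tensor_map sc g = tensor_act sc (\<lambda>_::unit. g) ()"

lemma tensor_act_eq_map: "tensor_act sc act x = tensor_map sc (act x)"
  by (simp add: fun_eq_iff tensor_map_def tensor_act_def)

locale fin_dim_space = complex_vector_space scale
  for scale :: "complex \<Rightarrow> 'v::ab_group_add \<Rightarrow> 'v" (infixr \<open>\<cdot>\<close> 75) +
  assumes fin_dim_UNIV: "fin_dim UNIV"
begin

abbreviation lin :: "('v \<Rightarrow> 'v) \<Rightarrow> bool" where "lin \<equiv> Vector_Spaces.linear scale scale"

abbreviation pure :: "'v list \<Rightarrow> 'v tensor" where "pure \<equiv> pure_tensor scale"

abbreviation power :: "nat \<Rightarrow> 'v tensor set" where "power \<equiv> tensor_power scale"

abbreviation functional :: "('v \<Rightarrow> complex) \<Rightarrow> bool" where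
  "functional \<equiv> Vector_Spaces.linear scale (*)"

lemma lin_iff: "lin g \<longleftrightarrow> lin_on UNIV g"
  using vector_space_axioms by (auto simp: Vector_Spaces.linear_iff lin_on_def)

lemma lin_id: "lin id"
  by (auto simp: lin_iff lin_on_def)

lemma functional_compose: "functional f \<Longrightarrow> lin g \<Longrightarrow> functional (f \<circ> g)"
  using Vector_Spaces.linear_compose by blast

lemma tensor_map_pure:
  assumes "lin g"
  shows "tensor_map scale g (pure vs) = pure (map g vs)"
proof
  fix fs
  show "tensor_map scale g (pure vs) fs = pure (map g vs) fs"
    using functional_compose[OF _ assms]
    by (auto simp: tensor_map_def tensor_act_def pure_tensor_def)
qed

lemma tensor_map_compose:
  assumes "lin g" "lin h"
  shows "tensor_map scale (g \<circ> h) t = tensor_map scale g (tensor_map scale h t)"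
proof
  fix fs
  show "tensor_map scale (g \<circ> h) t fs = tensor_map scale g (tensor_map scale h t) fs"
  proof (cases "\<forall>f\<in>set fs. functional f")
    case True
    then have "\<forall>f\<in>set (map (\<lambda>f. f \<circ> g) fs). functional f"
      using functional_compose[OF _ assms(1)] by auto
    moreover have "map (\<lambda>f. f \<circ> (g \<circ> h)) fs = map (\<lambda>f. f \<circ> h) (map (\<lambda>f. f \<circ> g) fs)"
      by (simp add: comp_assoc)
    ultimately show ?thesis using True unfolding tensor_map_def tensor_act_def by presburger
  qed (simp only: tensor_map_def tensor_act_def if_False)
qed

lemma tensor_map_lin: "tensor.lin_on U (tensor_map scale g)"
  unfolding tensor_map_def by (rule tensor.lin_on_linear[OF linear_tensor_act])

lemma tensor_map_power:
  assumes "lin g"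
  shows "tensor_map scale g ` power n = tensor.span ((\<lambda>vs. pure (map g vs)) ` {vs. length vs = n})"
proof -
  interpret L: Vector_Spaces.linear tensor_scale tensor_scale "tensor_map scale g"
    unfolding tensor_map_def by (rule linear_tensor_act)
  show ?thesis
    unfolding tensor_power_def L.span_image[symmetric] image_image
    by (simp only: tensor_map_pure[OF assms])
qed

lemma tensor_map_power_subset:
  assumes "lin g"
  shows "tensor_map scale g ` power n \<subseteq> power n"
  unfolding tensor_map_power[OF assms] unfolding tensor_power_def by (rule tensor.span_mono) auto

text \<open>Restricted to the tensor power: an arbitrary element of the type may be nonzero on lists
  that do not consist of functionals, and there \<open>tensor_map\<close> returns 0.\<close>

lemma tensor_map_id: "t \<in> power n \<Longrightarrow> tensor_map scale id t = t"
  unfolding tensor_power_def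
proof (induction rule: tensor.span_induct)
  case base
  have add: "tensor_map scale id (x + y) = tensor_map scale id x + tensor_map scale id y"
    and sc: "tensor_map scale id (tensor_scale c x) = tensor_scale c (tensor_map scale id x)" for x y c
    using tensor_map_lin[of UNIV id] unfolding tensor.lin_on_def by blast+
  show ?case
  proof (rule tensor.subspaceI)
    show "0 \<in> {t. tensor_map scale id t = t}"
      using tensor.lin_on_0[OF tensor_map_lin tensor.subspace_UNIV, of id] by (simp only: mem_Collect_eq)
  qed (simp_all only: mem_Collect_eq add sc)
next
  case (step x)
  then obtain vs where vs: "x = pure vs" by auto
  have "tensor_map scale id (pure vs) = pure (map id vs)" by (rule tensor_map_pure[OF lin_id])
  then show ?case by (simp only: vs list.map_id)
qed

text \<open>Evaluate on a list of \<open>n\<close> functionals and multiply out. All other lists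
  give 0 on both sides by the convention built into \<open>pure_tensor\<close>.\<close>

lemma pure_expand:
  assumes C: "finite C" and vs: "length vs = n" "\<And>i. i < n \<Longrightarrow> vs ! i = (\<Sum>c\<in>C. a i c \<cdot> c)"
  shows "pure vs = (\<Sum>cs\<in>words n C. tensor_scale (\<Prod>i<n. a i (cs ! i)) (pure cs))"
proof
  fix fs
  show "pure vs fs = (\<Sum>cs\<in>words n C. tensor_scale (\<Prod>i<n. a i (cs ! i)) (pure cs)) fs"
  proof (cases "length fs = n \<and> (\<forall>f\<in>set fs. functional f)")
    case True
    have "(fs ! i) (vs ! i) = (\<Sum>c\<in>C. a i c * (fs ! i) c)" if i: "i < n" for i
    proof -
      have "functional (fs ! i)" using True i by auto
      then interpret L: Vector_Spaces.linear scale "(*)" "fs ! i" .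
      show ?thesis unfolding vs(2)[OF i] by (simp add: L.sum L.scale)
    qed
    then have "pure vs fs = (\<Prod>i<n. \<Sum>c\<in>C. a i c * (fs ! i) c)"
      using True vs(1) by (simp add: pure_tensor_def)
    also have "\<dots> = (\<Sum>cs\<in>words n C. \<Prod>i<n. a i (cs ! i) * (fs ! i) (cs ! i))"
      by (rule prod_sum_words[OF C])
    finally show ?thesis
      using True by (auto simp: sum_fun_apply tensor_scale_def pure_tensor_def prod.distrib intro!: sum.cong)
  next
    case False
    then have "(\<Sum>cs\<in>words n C. tensor_scale (\<Prod>i<n. a i (cs ! i)) (pure cs)) fs = 0"
      unfolding sum_fun_apply tensor_scale_def by (intro sum.neutral ballI) (auto simp: pure_tensor_def)
    moreover have "pure vs fs = 0" using False vs(1) by (auto simp: pure_tensor_def)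
    ultimately show ?thesis by simp
  qed
qed

section \<open>A frame of the tensor power\<close>

context
  fixes B
  assumes B: "finite B" "independent B" "span B = UNIV"
begin

definition coord :: "'v \<Rightarrow> 'v \<Rightarrow> complex" where "coord b v = representation B v b"

lemma coord_functional: "functional (coord b)"
  using vector_space_axioms B(2,3)
  by (auto simp: Vector_Spaces.linear_iff coord_def representation_add representation_scale
      vector_space_over_itself.vector_space_axioms)

lemma coord_expand: "v = (\<Sum>b\<in>B. coord b v \<cdot> b)"
  unfolding coord_def using sum_representation_eq[OF B(2) _ B(1) order_refl, of v] B(3) by simp

lemma pure_coord:
  assumes "length vs = length cs"
  shows "pure vs (map coord cs) = (\<Prod>i<length cs. coord (cs ! i) (vs ! i))"
  using assms coord_functional by (auto simp: pure_tensor_def intro!: prod.cong)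

text \<open>A tensor is a function on lists of functionals, so its coordinate at a word of basis
  vectors is its value at the list of dual functionals.\<close>

lemma tensor_frame:
  "tensor.frame (power n) (words n B) pure (\<lambda>cs t. t (map coord cs))"
  unfolding tensor.frame_def
proof (intro conjI ballI)
  show "finite (words n B)" using finite_lists_length_eq[OF B(1)] .
  show "tensor.subspace (power n)" unfolding tensor_power_def by simp
  show "pure ` words n B \<subseteq> power n"
    unfolding tensor_power_def by (auto intro: tensor.span_base)
  show "tensor.functional_on (power n) (\<lambda>t. t (map coord cs))" for cs
    by (simp add: tensor.functional_on_def tensor_scale_def)
  show "t = (\<Sum>cs\<in>words n B. tensor_scale (t (map coord cs)) (pure cs))" if "t \<in> power n" for t
    using that unfolding tensor_power_def
  proof (induction rule: tensor.span_induct)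
    case base
    show ?case
    proof (rule tensor.subspaceI)
      show "0 \<in> {t. t = (\<Sum>cs\<in>words n B. tensor_scale (t (map coord cs)) (pure cs))}" by simp
      show "x + y \<in> {t. t = (\<Sum>cs\<in>words n B. tensor_scale (t (map coord cs)) (pure cs))}"
        if "x \<in> {t. t = (\<Sum>cs\<in>words n B. tensor_scale (t (map coord cs)) (pure cs))}"
          "y \<in> {t. t = (\<Sum>cs\<in>words n B. tensor_scale (t (map coord cs)) (pure cs))}" for x y
        using that by (simp add: tensor.scale_left_distrib sum.distrib)
      show "tensor_scale c x \<in> {t. t = (\<Sum>cs\<in>words n B. tensor_scale (t (map coord cs)) (pure cs))}"
        if "x \<in> {t. t = (\<Sum>cs\<in>words n B. tensor_scale (t (map coord cs)) (pure cs))}" for c x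
      proof -
        have "tensor_scale c x = tensor_scale c (\<Sum>cs\<in>words n B. tensor_scale (x (map coord cs)) (pure cs))"
          using that by simp
        also have "\<dots> = (\<Sum>cs\<in>words n B. tensor_scale ((tensor_scale c x) (map coord cs)) (pure cs))"
          by (simp add: tensor.scale_sum_right tensor_scale_def[of c x])
        finally show ?thesis by simp
      qed
    qed
  next
    case (step t)
    then obtain vs where vs: "t = pure vs" "length vs = n" by auto
    have "pure vs = (\<Sum>cs\<in>words n B. tensor_scale (\<Prod>i<n. coord (cs ! i) (vs ! i)) (pure cs))"
      using vs by (intro pure_expand[OF B(1)] coord_expand)
    also have "\<dots> = (\<Sum>cs\<in>words n B. tensor_scale (pure vs (map coord cs)) (pure cs))"
      using vs(2) by (intro sum.cong) (auto simp: pure_coord)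
    finally show ?case using vs by simp
  qed
qed

text \<open>The diagonal entry at a word is a product of diagonal entries of \<open>g\<close>, and
  the sum of these products over all words factors.\<close>

lemma tensor_frame_trace:
  assumes "lin g"
  shows "(\<Sum>cs\<in>words n B. tensor_map scale g (pure cs) (map coord cs)) = (\<Sum>b\<in>B. coord b (g b)) ^ n"
proof -
  have "(\<Sum>cs\<in>words n B. tensor_map scale g (pure cs) (map coord cs))
      = (\<Sum>cs\<in>words n B. \<Prod>i<n. coord (cs ! i) (g (cs ! i)))"
    by (intro sum.cong) (auto simp: tensor_map_pure[OF assms] pure_coord)
  also have "\<dots> = (\<Prod>i<n. \<Sum>b\<in>B. coord b (g b))"
    by (rule prod_sum_words[OF B(1), symmetric])
  finally show ?thesis by simp
qed

lemma coord_base: "b \<in> B \<Longrightarrow> coord b b = 1"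
  unfolding coord_def using representation_basis[OF B(2)] by simp

lemma dim_UNIV: "dim UNIV = card B"
  using dim_span_eq_card_independent[OF B(2)] B(3) by simp

lemma frame_UNIV: "frame UNIV B (\<lambda>b. b) coord"
  using frame_basis[OF B(1,2)] B(3) by (simp add: coord_def[abs_def])

end

lemma basis_UNIV:
  obtains B where "finite B" "independent B" "span B = UNIV"
  using fin_dim_basis[OF fin_dim_UNIV] .

lemma power_fin_dim: "tensor.fin_dim (power n)"
proof -
  obtain B where B: "finite B" "independent B" "span B = UNIV" using basis_UNIV .
  show ?thesis using tensor.frame_fin_dim[OF tensor_frame[OF B]] .
qed

lemma dim_power: "tensor.dim (power n) = dim UNIV ^ n"
proof -
  obtain B where B: "finite B" "independent B" "span B = UNIV" using basis_UNIV .
  have "of_nat (tensor.dim (power n)) = (\<Sum>cs\<in>words n B. pure cs (map (coord B) cs))"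
    by (rule tensor.frame_trace_id[OF tensor_frame[OF B], symmetric])
  also have "\<dots> = (\<Sum>cs\<in>words n B. tensor_map scale id (pure cs) (map (coord B) cs))"
    by (simp add: tensor_map_pure[OF lin_id])
  also have "\<dots> = (\<Sum>b\<in>B. coord B b (id b)) ^ n" by (rule tensor_frame_trace[OF B lin_id])
  also have "\<dots> = (of_nat (card B)) ^ n" using coord_base[OF B] by simp
  finally have "of_nat (tensor.dim (power n)) = (of_nat (card B ^ n) :: complex)" by simp
  then show ?thesis using dim_UNIV[OF B] by (simp only: of_nat_eq_iff)
qed

text \<open>The image is contained in the span of the pure tensors over words in a basis of the
  range of \<open>g\<close>.\<close>

lemma dim_tensor_map_le:
  assumes g: "lin g"
  shows "tensor.dim (tensor_map scale g ` power n) \<le> dim (range g) ^ n"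
proof -
  have lg: "lin_on UNIV g" using g by (simp add: lin_iff)
  obtain C where C: "finite C" "independent C" "span C = range g" "card C = dim (range g)" "C \<subseteq> range g"
    using fin_dim_basis[OF fin_dim_image(1)[OF lg fin_dim_UNIV]] .
  have "pure (map g vs) \<in> tensor.span (pure ` words n C)" if "length vs = n" for vs
  proof -
    have "map g vs ! i = (\<Sum>c\<in>C. representation C (map g vs ! i) c \<cdot> c)" if "i < n" for i
      using sum_representation_eq[OF C(2) _ C(1) order_refl, of "map g vs ! i"] C(3) that \<open>length vs = n\<close> by simp
    then have "pure (map g vs) = (\<Sum>cs\<in>words n C.
        tensor_scale (\<Prod>i<n. representation C (map g vs ! i) (cs ! i)) (pure cs))"
      using that by (intro pure_expand[OF C(1)]) auto
    also have "\<dots> \<in> tensor.span (pure ` words n C)"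
      by (intro tensor.span_sum tensor.span_scale tensor.span_base imageI)
    finally show ?thesis .
  qed
  then have "tensor_map scale g ` power n \<subseteq> tensor.span (pure ` words n C)"
    unfolding tensor_map_power[OF g] by (intro tensor.span_minimal) auto
  then have "tensor.dim (tensor_map scale g ` power n) \<le> card (pure ` words n C)"
    using finite_lists_length_eq[OF C(1)] by (intro tensor.dim_le_card) auto
  also have "\<dots> \<le> card (words n C)" by (intro card_image_le finite_lists_length_eq C(1))
  also have "\<dots> = dim (range g) ^ n" using card_lists_length_eq[OF C(1)] C(4) by simp
  finally show ?thesis .
qed

section \<open>Traces of operators of finite order\<close>

text \<open>The parallelogram law gives \<open>|z + w|^2 = 4 - |z - w|^2\<close>.\<close>

lemma norm_unit_add_less:
  fixes z w :: complex
  assumes "cmod z = 1" "cmod w = 1" "z \<noteq> w"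
  shows "cmod (z + w) < 2"
proof -
  have "(cmod (z + w))\<^sup>2 + (cmod (z - w))\<^sup>2 = 4"
  proof -
    have "(cmod (z + w))\<^sup>2 + (cmod (z - w))\<^sup>2 = 2 * (cmod z)\<^sup>2 + 2 * (cmod w)\<^sup>2"
      unfolding cmod_power2 by (simp add: power2_eq_square algebra_simps)
    then show ?thesis using assms by simp
  qed
  moreover have "(cmod (z - w))\<^sup>2 > 0" using assms by simp
  ultimately have "(cmod (z + w))\<^sup>2 < 4" by linarith
  then have "(cmod (z + w))\<^sup>2 < 2\<^sup>2" by simp
  then show ?thesis by (rule power_less_imp_less_base) simp
qed

text \<open>One copy of \<open>z i\<close> and one of \<open>z k\<close> are taken out of the sum.
  This pair contributes strictly less than 2, and the triangle inequality bounds the rest.\<close>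

lemma norm_weighted_unit_sum_less:
  fixes z :: "nat \<Rightarrow> complex" and d :: "nat \<Rightarrow> nat"
  assumes "finite J" "\<And>j. j \<in> J \<Longrightarrow> cmod (z j) = 1" "i \<in> J" "k \<in> J" "z i \<noteq> z k" "d i > 0" "d k > 0"
  shows "cmod (\<Sum>j\<in>J. of_nat (d j) * z j) < of_nat (\<Sum>j\<in>J. d j)"
proof -
  define d' where "d' j = (if j = i \<or> j = k then d j - 1 else d j)" for j
  have d: "d j = d' j + (if j = i then 1 else 0) + (if j = k then 1 else 0)" for j
    using assms(5-7) by (auto simp: d'_def)
  have "(\<Sum>j\<in>J. of_nat (d j) * z j) = (\<Sum>j\<in>J. of_nat (d' j) * z j + (if j = i then z i else 0) + (if j = k then z k else 0))"
    by (intro sum.cong refl) (auto simp: d algebra_simps)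
  also have "\<dots> = (\<Sum>j\<in>J. of_nat (d' j) * z j) + (z i + z k)"
    using assms by (simp add: sum.distrib)
  finally have "cmod (\<Sum>j\<in>J. of_nat (d j) * z j) \<le> cmod (\<Sum>j\<in>J. of_nat (d' j) * z j) + cmod (z i + z k)"
    using norm_triangle_ineq by metis
  also have "cmod (\<Sum>j\<in>J. of_nat (d' j) * z j) \<le> (\<Sum>j\<in>J. of_nat (d' j))"
    by (rule order_trans[OF norm_sum]) (auto intro!: sum_mono simp: norm_mult assms(2))
  also have "cmod (z i + z k) < 2" using assms by (intro norm_unit_add_less) auto
  also have "(\<Sum>j\<in>J. of_nat (d' j)) + 2 = (\<Sum>j\<in>J. of_nat (d' j) + (if j = i then 1 else 0) + (if j = k then 1 else (0::real)))"
    using assms by (simp add: sum.distrib)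
  also have "\<dots> = of_nat (\<Sum>j\<in>J. d j)" by (auto simp: d intro!: sum.cong)
  finally show ?thesis by simp
qed

lemma sum_root_unity:
  fixes w :: complex
  assumes "w ^ N = 1" "w \<noteq> 1"
  shows "(\<Sum>j<N. w ^ j) = 0"
  using geometric_sum[OF assms(2), of N] assms by simp

text \<open>An operator of finite order is diagonalisable with roots of unity as eigenvalues. Its
  trace is a sum of \<open>dim UNIV\<close> numbers of modulus 1, and two of them differ unless the
  operator is a scalar.\<close>

lemma norm_trace_less:
  assumes B: "finite B" "independent B" "span B = UNIV"
    and g: "lin g" and N: "N > 0" "\<And>v. (g ^^ N) v = v"
    and nonscalar: "\<And>c. \<exists>v. g v \<noteq> c \<cdot> v"
  shows "cmod (\<Sum>b\<in>B. coord B b (g b)) < of_nat (dim UNIV)"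
proof -
  define \<omega> where "\<omega> = cis (2 * pi / N)"
  have \<omega>N: "\<omega> ^ N = 1" unfolding \<omega>_def using N(1) Complex.DeMoivre[of "2 * pi / N" N] by simp
  have \<omega>0: "\<omega> \<noteq> 0" by (simp add: \<omega>_def)
  have \<omega>1: "cmod \<omega> = 1" by (simp add: \<omega>_def)
  have \<omega>inj: "\<omega> ^ i \<noteq> \<omega> ^ k" if "i < N" "k < N" "i \<noteq> k" for i k
  proof -
    have "inj_on (\<lambda>k. cis (2 * pi * real k / real N)) {..<N}"
      using Complex.bij_betw_roots_unity[OF N(1)] by (simp add: bij_betw_def)
    then show ?thesis using that unfolding \<omega>_def Complex.DeMoivre inj_on_def
      by (auto simp: mult.commute)
  qed
  have gk: "lin_on UNIV (g ^^ k)" for k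
  proof (induction k)
    case (Suc k)
    then show ?case using g by (auto simp: lin_iff lin_on_def)
  qed (simp add: lin_on_def)
  have glin: "lin_on UNIV g" using g by (simp add: lin_iff)
  \<comment> \<open>The projection onto the eigenspace for \<open>\<omega>^j\<close>, as a discrete
    Fourier transform of the powers of \<open>g\<close>.\<close>
  define P where "P j v = (1 / of_nat N) \<cdot> (\<Sum>k<N. (inverse \<omega> ^ (j * k)) \<cdot> (g ^^ k) v)" for j v
  have P_lin: "lin_on UNIV (P j)" for j
    unfolding P_def by (intro lin_on_scale lin_on_sum gk)
  have gP: "g (P j v) = \<omega> ^ j \<cdot> P j v" for j v
  proof -
    let ?t = "\<lambda>k. (inverse \<omega> ^ (j * k)) \<cdot> (g ^^ k) v"
    have "g (\<Sum>k<N. ?t k) = (\<Sum>k<N. (inverse \<omega> ^ (j * k)) \<cdot> (g ^^ Suc k) v)"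
      using lin_on_apply_sum[OF glin subspace_UNIV, of "{..<N}" "\<lambda>k. (g ^^ k) v" "\<lambda>k. inverse \<omega> ^ (j * k)"] by simp
    also have "\<dots> = (\<Sum>k<N. \<omega> ^ j \<cdot> ?t (Suc k))"
      using \<omega>0 by (intro sum.cong refl) (simp add: power_add power_inverse)
    also have "\<dots> = \<omega> ^ j \<cdot> (\<Sum>k<N. ?t (Suc k))" by (simp add: scale_sum_right)
    also have "(\<Sum>k<N. ?t (Suc k)) = (\<Sum>k<N. ?t k)"
    proof -
      have "inverse \<omega> ^ (j * N) = 1"
        by (simp only: mult.commute[of j] power_mult power_inverse \<omega>N inverse_1 power_one)
      then have "?t N = ?t 0" using N(2) by simp
      then show ?thesis
        using sum.lessThan_Suc_shift[of ?t N] sum.lessThan_Suc[of ?t N] by simp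
    qed
    finally show ?thesis
      unfolding P_def using glin by (simp add: lin_on_def mult.commute)
  qed
  have gkP: "(g ^^ k) (P j v) = \<omega> ^ (j * k) \<cdot> P j v" for j k v
  proof (induction k)
    case (Suc k)
    then show ?case using glin gP by (simp add: lin_on_def power_add mult.commute)
  qed simp
  have PP: "P j (P j v) = P j v" for j v
    using N(1) \<omega>0 by (simp add: P_def[of j "P j v"] gkP power_inverse sum_constant_scale)
  have sumP: "(\<Sum>j<N. P j v) = v" for v
  proof -
    have "(\<Sum>j<N. P j v) = (1 / of_nat N) \<cdot> (\<Sum>k<N. (\<Sum>j<N. (inverse \<omega> ^ k) ^ j) \<cdot> (g ^^ k) v)"
      unfolding P_def scale_sum_right[symmetric] scale_sum_left
      by (subst sum.swap) (simp add: power_mult[symmetric] mult.commute)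
    also have "(\<Sum>k<N. (\<Sum>j<N. (inverse \<omega> ^ k) ^ j) \<cdot> (g ^^ k) v) = (\<Sum>k<N. if k = 0 then of_nat N \<cdot> v else 0)"
    proof (intro sum.cong refl)
      fix k assume k: "k \<in> {..<N}"
      show "(\<Sum>j<N. (inverse \<omega> ^ k) ^ j) \<cdot> (g ^^ k) v = (if k = 0 then of_nat N \<cdot> v else 0)"
      proof (cases "k = 0")
        case False
        have "inverse \<omega> ^ k \<noteq> 1" using \<omega>inj[of k 0] False k N(1) by (simp add: power_inverse)
        moreover have "(inverse \<omega> ^ k) ^ N = 1"
          by (simp only: power_mult[symmetric] mult.commute[of k])
            (simp only: power_mult power_inverse \<omega>N inverse_1 power_one)
        ultimately show ?thesis using sum_root_unity False by simp
      qed simp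
    qed
    finally show ?thesis using N(1) by simp
  qed
  define d where "d j = dim (P j ` UNIV)" for j
  note f = frame_UNIV[OF B]
  have trP: "(\<Sum>b\<in>B. coord B b (P j b)) = of_nat (d j)" for j
    unfolding d_def by (rule frame_trace_idempotent[OF f P_lin]) (auto simp: PP)
  have co: "functional_on UNIV (coord B b)" if "b \<in> B" for b
    using f that by (auto simp: frame_def)
  have co_sum: "coord B b (\<Sum>j<N. c j \<cdot> P j v) = (\<Sum>j<N. c j * coord B b (P j v))" if "b \<in> B" for b c v
    by (rule functional_on_apply_sum[OF co[OF that] subspace_UNIV]) simp
  have tr: "(\<Sum>b\<in>B. coord B b (g b)) = (\<Sum>j<N. of_nat (d j) * \<omega> ^ j)"
  proof -
    have "g v = (\<Sum>j<N. \<omega> ^ j \<cdot> P j v)" for v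
      using lin_on_apply_sum'[OF glin subspace_UNIV, of "{..<N}" "\<lambda>j. P j v"] by (simp add: sumP gP)
    then have "(\<Sum>b\<in>B. coord B b (g b)) = (\<Sum>b\<in>B. \<Sum>j<N. \<omega> ^ j * coord B b (P j b))"
      using co_sum by simp
    also have "\<dots> = (\<Sum>j<N. of_nat (d j) * \<omega> ^ j)"
      by (subst sum.swap) (simp add: sum_distrib_left[symmetric] trP mult.commute)
    finally show ?thesis .
  qed
  have dsum: "dim UNIV = (\<Sum>j<N. d j)"
  proof -
    have "of_nat (dim UNIV) = (\<Sum>b\<in>B. coord B b (\<Sum>j<N. 1 \<cdot> P j b))"
      using frame_trace_id[OF f] by (simp add: sumP)
    also have "\<dots> = (\<Sum>b\<in>B. \<Sum>j<N. coord B b (P j b))"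
      using co_sum[of _ "\<lambda>_. 1"] by simp
    also have "\<dots> = of_nat (\<Sum>j<N. d j)"
      by (subst sum.swap) (simp add: trP)
    finally show ?thesis by (simp only: of_nat_eq_iff)
  qed
  have d0: "P j v = 0" if "d j = 0" for j v
    using that dim_eq_0_fin[OF fin_dim_image(1)[OF P_lin fin_dim_UNIV], of j] unfolding d_def by blast
  \<comment> \<open>If at most one eigenspace \<open>i\<close> were nonzero, then \<open>P i\<close>
    would be the identity and \<open>g\<close> the scalar \<open>\<omega>^i\<close>.\<close>
  have "\<exists>i<N. \<exists>k<N. i \<noteq> k \<and> d i > 0 \<and> d k > 0"
  proof (rule ccontr)
    assume a: "\<not> ?thesis"
    have "\<exists>i<N. \<forall>k<N. k \<noteq> i \<longrightarrow> d k = 0"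
      using a N(1) by (metis gr0I)
    then obtain i where i: "i < N" "\<And>k. k < N \<Longrightarrow> k \<noteq> i \<Longrightarrow> d k = 0" by blast
    have "v = P i v" for v
    proof -
      have "v = (\<Sum>j<N. P j v)" by (simp add: sumP)
      also have "\<dots> = (\<Sum>j<N. if j = i then P i v else 0)" using i(2) d0 by (intro sum.cong) auto
      finally show ?thesis using i(1) by simp
    qed
    then have "g v = \<omega> ^ i \<cdot> v" for v using gP[of i v] by simp
    then show False using nonscalar by blast
  qed
  then obtain i k where "i < N" "k < N" "i \<noteq> k" "d i > 0" "d k > 0" by blast
  then show ?thesis
    unfolding tr dsum using \<omega>inj \<omega>1
    by (intro norm_weighted_unit_sum_less[of _ _ i k]) (auto simp: norm_power)
qed

end

section \<open>Which elements of the symmetric group can act as scalars\<close>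

text \<open>If \<open>g\<close> moves \<open>a\<close> to \<open>b\<close>, a third point
  \<open>c\<close> exists, and the transposition of \<open>b\<close> and \<open>c\<close> fixes
  \<open>a\<close>. One composite with \<open>g\<close> then sends \<open>a\<close> to
  \<open>b\<close>, the other to \<open>c\<close>.\<close>

lemma sym_grp_centerless:
  assumes "l \<ge> 3" "g \<in> sym_grp l" "\<And>h. h \<in> sym_grp l \<Longrightarrow> g + h = h + g"
  shows "g = 0"
proof (rule ccontr)
  assume "g \<noteq> 0"
  then obtain a where a: "g \<langle>$\<rangle> a \<noteq> a" by (auto simp: perm_eq_iff)
  let ?b = "g \<langle>$\<rangle> a"
  have "g \<langle>$\<rangle> ?b \<noteq> ?b" using a by (simp add: apply_inj)
  then have ab: "a \<in> {1..l}" "?b \<in> {1..l}"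
    using a assms(2) unfolding sym_grp_def by (auto simp only: mem_Collect_eq subset_iff in_affected)
  have "card {a, ?b} < card {1..l}" using assms(1) card_insert_le_m1[of 2 "{?b}" a] by simp
  then have "\<not> {1..l} \<subseteq> {a, ?b}" using card_mono[of "{a, ?b}" "{1..l}"] by fastforce
  then obtain c where c: "c \<in> {1..l}" "c \<noteq> a" "c \<noteq> ?b" by blast
  let ?h = "\<langle>?b \<leftrightarrow> c\<rangle>"
  have "affected ?h = {?b, c}" using c by (intro affected_swap) auto
  then have "?h \<in> sym_grp l" using ab c by (auto simp: sym_grp_def)
  then have "(g + ?h) \<langle>$\<rangle> a = (?h + g) \<langle>$\<rangle> a" using assms(3) by simp
  moreover have "?h \<langle>$\<rangle> a = a" using a c by (simp add: Perm.swap.rep_eq Transposition.transpose_def)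
  moreover have "?h \<langle>$\<rangle> ?b = c" by (simp add: Perm.swap.rep_eq)
  ultimately show False using c by simp
qed

lemma sym_grp_involutive:
  assumes "l \<le> 2" "g \<in> sym_grp l"
  shows "g + g = 0"
proof (rule perm_eqI)
  fix a
  have out: "g \<langle>$\<rangle> x = x" if "x \<notin> {1, 2}" for x
  proof (rule ccontr)
    assume "g \<langle>$\<rangle> x \<noteq> x"
    then have "x \<in> {1..l}" using assms(2) unfolding sym_grp_def by (auto simp only: mem_Collect_eq subset_iff in_affected)
    then show False using that assms(1) by auto
  qed
  have "g \<langle>$\<rangle> (g \<langle>$\<rangle> a) = a"
  proof (cases "g \<langle>$\<rangle> a = a")
    case False
    then have ne: "g \<langle>$\<rangle> (g \<langle>$\<rangle> a) \<noteq> g \<langle>$\<rangle> a" by (simp add: apply_inj)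
    have "a \<in> {1, 2}" "g \<langle>$\<rangle> a \<in> {1, 2}" using out False ne by blast+
    moreover have "g \<langle>$\<rangle> (g \<langle>$\<rangle> a) \<in> {1, 2}"
      using out[of "g \<langle>$\<rangle> (g \<langle>$\<rangle> a)"] ne by (auto simp: apply_inj)
    ultimately show ?thesis using False ne by auto
  qed simp
  then show "(g + g) \<langle>$\<rangle> a = 0 \<langle>$\<rangle> a" by simp
qed

context fin_dim_space
begin

lemma dim_range_less:
  assumes g: "lin g" and ni: "\<not> inj g"
  shows "dim (range g) < dim UNIV"
proof -
  have lg: "lin_on UNIV g" using g by (simp add: lin_iff)
  obtain x y where xy: "g x = g y" "x \<noteq> y" using ni by (auto simp: inj_def)
  let ?v = "x - y"
  have "g x = g ?v + g y" using lg unfolding lin_on_def by (metis UNIV_I diff_add_cancel)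
  then have v: "g ?v = 0" "?v \<noteq> 0" using xy by auto
  have iv: "independent {?v}" using v(2) by simp
  obtain B where B: "{?v} \<subseteq> B" "B \<subseteq> UNIV" "independent B" "UNIV \<subseteq> span B"
    using maximal_independent_subset_extend[OF subset_UNIV iv] .
  obtain A where "finite A" "UNIV \<subseteq> span A" using fin_dim_UNIV by (auto simp: fin_dim_def)
  then have fB: "finite B" using independent_span_bound[of A B] B by blast
  have "range g \<subseteq> span (g ` (B - {?v}))"
  proof
    fix z assume "z \<in> range g"
    then obtain u where u: "z = g u" by blast
    have "u = (\<Sum>b\<in>B. representation B u b \<cdot> b)"
      using sum_representation_eq[OF B(3) subsetD[OF B(4) UNIV_I] fB order_refl] by (rule sym)
    then have "z = g (\<Sum>b\<in>B. representation B u b \<cdot> b)" unfolding u by (rule arg_cong)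
    also have "\<dots> = (\<Sum>b\<in>B. representation B u b \<cdot> g b)"
      by (rule lin_on_apply_sum[OF lg subspace_UNIV]) simp
    also have "\<dots> = (\<Sum>b\<in>B - {?v}. representation B u b \<cdot> g b)"
      using fB v(1) by (intro sum.mono_neutral_right) auto
    also have "\<dots> \<in> span (g ` (B - {?v}))" by (intro span_sum span_scale span_base imageI)
    finally show "z \<in> span (g ` (B - {?v}))" .
  qed
  then have "dim (range g) \<le> card (g ` (B - {?v}))" using fB by (intro dim_le_card) auto
  also have "\<dots> \<le> card (B - {?v})" using fB by (intro card_image_le) auto
  also have "\<dots> < card B" using fB B(1) by (intro psubset_card_mono) auto
  also have "card B = dim UNIV" by (rule basis_card_eq_dim[OF B(2,4,3)])
  finally show ?thesis .
qed

end

section \<open>Asymptotics for a finite monoid of operators\<close>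

text \<open>An abstract form of the image of the monoid in the operators on \<open>V\<close>. In
  \<open>rho_Op\<close> the alternative \<open>\<rho> p = id\<close> serves the case
  \<open>l = 0\<close>, where 0 is the only element of \<open>sym_grp l\<close>.\<close>

locale operator_monoid = fin_dim_space scale
  for scale :: "complex \<Rightarrow> 'v::ab_group_add \<Rightarrow> 'v" (infixr \<open>\<cdot>\<close> 75) +
  fixes l :: nat and \<rho> :: "nat perm \<Rightarrow> 'v \<Rightarrow> 'v" and Op :: "('v \<Rightarrow> 'v) set"
  assumes nontrivial: "\<exists>v::'v. v \<noteq> 0"
    and fin_Op: "finite Op"
    and Op_lin: "g \<in> Op \<Longrightarrow> lin g"
    and Op_comp: "g \<in> Op \<Longrightarrow> h \<in> Op \<Longrightarrow> g \<circ> h \<in> Op"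
    and rho_Op: "p \<in> sym_grp l \<Longrightarrow> \<rho> p \<in> Op \<or> \<rho> p = id"
    and rho_comp: "p \<in> sym_grp l \<Longrightarrow> q \<in> sym_grp l \<Longrightarrow> \<rho> (p + q) = \<rho> p \<circ> \<rho> q"
    and rho_id: "\<rho> 0 = id"
    and rho_faithful: "p \<in> sym_grp l \<Longrightarrow> \<rho> p = id \<Longrightarrow> p = 0"
    and Op_unit: "g \<in> Op \<Longrightarrow> inj g \<Longrightarrow> \<exists>p\<in>sym_grp l. g = \<rho> p"
begin

lemma rho_linear: "p \<in> sym_grp l \<Longrightarrow> lin (\<rho> p)"
  using rho_Op Op_lin lin_id by metis

lemma rho_bij:
  assumes "p \<in> sym_grp l"
  shows "inj (\<rho> p)" "surj (\<rho> p)"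
proof -
  have "\<rho> (- p) \<circ> \<rho> p = id" "\<rho> p \<circ> \<rho> (- p) = id"
    using rho_comp[of "- p" p] rho_comp[of p "- p"] assms rho_id by simp_all
  then show "inj (\<rho> p)" "surj (\<rho> p)"
    by (metis inj_on_id inj_on_imageI2, metis comp_surj surj_id surj_def o_apply)
qed

text \<open>\<open>tensor_map\<close> acts on tensors of every degree, so one finite set serves all
  \<open>n\<close>, and its cardinality is a constant in the estimates.\<close>

definition noninv :: "('v tensor \<Rightarrow> 'v tensor) set" where
  "noninv = tensor_map scale ` {g \<in> Op. \<not> inj g}"

lemma noninv_rho:
  assumes "g \<in> Op" "\<not> inj g" "p \<in> sym_grp l"
  shows "\<rho> p \<circ> g \<in> Op" "\<not> inj (\<rho> p \<circ> g)" "g \<circ> \<rho> p \<in> Op" "\<not> inj (g \<circ> \<rho> p)"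
proof -
  show "\<rho> p \<circ> g \<in> Op" "g \<circ> \<rho> p \<in> Op" using rho_Op[OF assms(3)] Op_comp assms(1) by auto
  show "\<not> inj (\<rho> p \<circ> g)" using assms(2) inj_on_imageI2 by blast
  show "\<not> inj (g \<circ> \<rho> p)"
  proof
    assume i: "inj (g \<circ> \<rho> p)"
    have "inj_on g (range (\<rho> p))" using inj_on_imageI[OF i] .
    then show False using rho_bij(2)[OF assms(3)] assms(2) by simp
  qed
qed

lemma unit_rep_power: "unit_rep tensor_scale l (\<lambda>p. tensor_map scale (\<rho> p)) (power n) noninv"
proof (unfold_locales, goal_cases)
  case 1
  show ?case by (rule power_fin_dim)
next
  case (2 p)
  show ?case by (rule tensor_map_lin)
next
  case (3 p)
  then show ?case using tensor_map_power_subset[OF rho_linear] by blast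
next
  case (4 p q w)
  then show ?case using tensor_map_compose[OF rho_linear rho_linear] rho_comp by metis
next
  case (5 w)
  then show ?case using tensor_map_id by (simp only: rho_id)
next
  case 6
  then show ?case using fin_Op by (simp add: noninv_def)
next
  case (7 t)
  then show ?case using tensor_map_lin by (auto simp only: noninv_def)
next
  case (8 t)
  then show ?case using tensor_map_power_subset Op_lin by (auto simp only: noninv_def)
next
  case (9 t p)
  then obtain g where g: "g \<in> Op" "\<not> inj g" "t = tensor_map scale g" by (auto simp: noninv_def)
  have "\<forall>w. tensor_map scale (\<rho> p) (t w) = tensor_map scale (\<rho> p \<circ> g) w"
    using tensor_map_compose[OF rho_linear[OF 9(2)] Op_lin[OF g(1)]] g(3) by simp
  then show ?case using noninv_rho[OF g(1,2) 9(2)] unfolding noninv_def by blast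
next
  case (10 t p)
  then obtain g where g: "g \<in> Op" "\<not> inj g" "t = tensor_map scale g" by (auto simp: noninv_def)
  have "\<forall>w. t (tensor_map scale (\<rho> p) w) = tensor_map scale (g \<circ> \<rho> p) w"
    using tensor_map_compose[OF Op_lin[OF g(1)] rho_linear[OF 10(2)]] g(3) by simp
  then show ?case using noninv_rho[OF g(1,2) 10(2)] unfolding noninv_def by blast
qed

definition character :: "'v set \<Rightarrow> nat perm \<Rightarrow> complex" where
  "character B p = (\<Sum>b\<in>B. coord B b (\<rho> p b))"

lemma rho_order:
  assumes p: "p \<in> sym_grp l"
  obtains N where "N > 0" "\<And>v. (\<rho> p ^^ N) v = v"
proof -
  have pow: "\<rho> p ^^ k \<in> \<rho> ` sym_grp l" for k
  proof (induction k)
    case 0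
    show ?case using rho_id sym_grp_0 by (auto simp: image_iff intro!: bexI[of _ 0])
  next
    case (Suc k)
    then obtain q where "q \<in> sym_grp l" "\<rho> p ^^ k = \<rho> q" by blast
    then have "\<rho> p ^^ Suc k = \<rho> (p + q)" "p + q \<in> sym_grp l"
      using rho_comp[OF p] sym_grp_plus[OF p] by simp_all
    then show ?case by blast
  qed
  \<comment> \<open>The powers lie in the image of a finite group, so two of them agree; cancelling
    the smaller one leaves the identity.\<close>
  have "\<not> inj (\<lambda>k. \<rho> p ^^ k)"
  proof
    assume "inj (\<lambda>k. \<rho> p ^^ k)"
    moreover have "finite (range (\<lambda>k. \<rho> p ^^ k))"
      using pow by (intro finite_subset[OF _ finite_imageI[OF finite_sym_grp]]) blast
    ultimately show False using finite_imageD infinite_UNIV_nat by blast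
  qed
  then obtain i j where ij: "\<rho> p ^^ i = \<rho> p ^^ j" "i < j"
    unfolding inj_def by (metis linorder_neqE_nat)
  have inj: "inj (\<rho> p ^^ i)" using inj_fn[OF rho_bij(1)[OF p]] .
  have "(\<rho> p ^^ (j - i)) v = v" for v
  proof -
    have "(\<rho> p ^^ i) ((\<rho> p ^^ (j - i)) v) = (\<rho> p ^^ (i + (j - i))) v" by (simp add: funpow_add)
    also have "\<dots> = (\<rho> p ^^ i) v" using ij by simp
    finally show ?thesis by (rule injD[OF inj])
  qed
  then show ?thesis using that[of "j - i"] ij(2) by simp
qed

text \<open>A scalar commutes with every operator of the group; by faithfulness \<open>p\<close>
  would be central.\<close>

lemma rho_nonscalar:
  assumes l: "l \<ge> 3" and p: "p \<in> sym_grp l" "p \<noteq> 0"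
  shows "\<exists>v. \<rho> p v \<noteq> c \<cdot> v"
proof (rule ccontr)
  assume "\<not> ?thesis"
  then have s: "\<rho> p v = c \<cdot> v" for v by blast
  have "p + h = h + p" if h: "h \<in> sym_grp l" for h
  proof -
    have hl: "\<rho> h (c \<cdot> v) = c \<cdot> \<rho> h v" for v
      using rho_linear[OF h] by (simp add: lin_iff lin_on_def)
    have "\<rho> (p + h) = \<rho> (h + p)"
      using rho_comp[OF p(1) h] rho_comp[OF h p(1)] by (simp add: fun_eq_iff s hl)
    then have "\<rho> (p + h + - (h + p)) = \<rho> (h + p + - (h + p))"
      using rho_comp p(1) h by (simp only: sym_grp_plus sym_grp_uminus)
    also have "\<dots> = id" by (simp only: right_minus rho_id)
    finally have "p + h + - (h + p) = 0"
      using p(1) h by (intro rho_faithful) (simp_all only: sym_grp_plus sym_grp_uminus)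
    then show ?thesis by (simp only: add_uminus_conv_diff right_minus_eq)
  qed
  then show False using sym_grp_centerless[OF l p(1)] p(2) by blast
qed

lemma character_bound:
  assumes B: "finite B" "independent B" "span B = UNIV"
    and l: "l \<ge> 3" and p: "p \<in> sym_grp l" "p \<noteq> 0"
  shows "cmod (character B p) < real (dim UNIV)"
proof -
  have "\<exists>N>0. \<forall>v. (\<rho> p ^^ N) v = v" by (rule rho_order[OF p(1)]) blast
  then obtain N where "N > 0" "\<forall>v. (\<rho> p ^^ N) v = v" by blast
  then show ?thesis unfolding character_def
    using norm_trace_less[OF B rho_linear[OF p(1)], of N] rho_nonscalar[OF l p] by blast
qed

lemma dim_pos: "dim UNIV > 0"
proof (rule ccontr)
  assume "\<not> dim UNIV > 0"
  then have "(UNIV :: 'v set) = {0}" using dim_eq_0_fin[OF fin_dim_UNIV] by simp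
  then show False using nontrivial by auto
qed

definition len :: "galg set \<Rightarrow> nat \<Rightarrow> real" where
  "len E n = sym_rep.rep_length tensor_scale l (\<lambda>p. tensor_map scale (\<rho> p)) E (power n)"

lemma len_limit:
  assumes E: "primitive_family l E"
  shows "(\<lambda>n. len E n / real (dim UNIV) ^ n) \<longlonglongrightarrow> involution_sum l"
proof -
  let ?D = "real (dim UNIV)"
  have D: "?D > 0" using dim_pos by simp
  have cardE: "real (card E) = fact l * involution_sum l"
    using card_primitive_family[OF E] card_sym_grp_involutions[of l] by simp
  have prim: "primitive l e" if "e \<in> E" for e using E that by (simp add: primitive_family_def)
  show ?thesis
  proof (cases "l \<ge> 3")
    \<comment> \<open>For \<open>l \<le> 2\<close> a transposition can act as the scalar -1, so its
      character need not be small compared with the dimension. In this case the length is computed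
      exactly: it is the dimension of the tensor power.\<close>
    case False
    then have inv: "g + g = 0" if "g \<in> sym_grp l" for g using sym_grp_involutive[OF _ that] by simp
    have deg: "fact l * Re (coef e 0) = 1" if e: "e \<in> E" for e
    proof -
      have "complex_of_real (fact l) * coef e 0 = 1" using primitive_involutive[OF prim[OF e] inv] by simp
      then have "Re (complex_of_real (fact l) * coef e 0) = 1" by simp
      then show ?thesis by (simp only: Re_complex_of_real Im_complex_of_real mult_zero_left times_complex.sel diff_zero)
    qed
    have "len E n = ?D ^ n" for n
    proof -
      interpret R: unit_rep tensor_scale l "\<lambda>p. tensor_map scale (\<rho> p)" "power n" noninv
        by (rule unit_rep_power)
      have "len E n = (\<Sum>e\<in>E. real (tensor.dim (R.alg_act e ` power n)))"
        unfolding len_def R.rep_length_def using deg by (intro sum.cong refl) simp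
      also have "\<dots> = real (tensor.dim (power n))"
        using R.sum_dim_alg_act[OF E R.stable_W] by (simp flip: of_nat_sum)
      finally show ?thesis by (simp add: dim_power)
    qed
    moreover have "involution_sum l = 1"
    proof -
      have "{g \<in> sym_grp l. g + g = 0} = sym_grp l" using inv by auto
      then have "fact l * involution_sum l = fact l" using card_sym_grp_involutions[of l] by (simp add: card_sym_grp)
      then show ?thesis by simp
    qed
    ultimately show ?thesis using D by simp
  next
    case True
    obtain B where B: "finite B" "independent B" "span B = UNIV" using basis_UNIV .
    \<comment> \<open>The normalised character is 1 at the identity and has modulus below 1
      elsewhere, so only the identity survives in the limit.\<close>
    have lim: "(\<lambda>n. (character B g / of_nat (dim UNIV)) ^ n) \<longlonglongrightarrow> (if g = 0 then 1 else 0)"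
      if g: "g \<in> sym_grp l" for g
    proof (cases "g = 0")
      case True
      have "character B 0 = of_nat (dim UNIV)"
        using coord_base[OF B] dim_UNIV[OF B] by (simp add: character_def rho_id)
      then show ?thesis using True D by simp
    next
      case False
      have "cmod (character B g / of_nat (dim UNIV)) < 1"
        using character_bound[OF B True g False] D by (simp add: norm_divide)
      then show ?thesis using LIMSEQ_power_zero False by simp
    qed
    have len_eq: "complex_of_real (len E n / ?D ^ n) = (\<Sum>e\<in>E. (\<Sum>g\<in>sym_grp l. coef e g *
        (character B g / of_nat (dim UNIV)) ^ n) / complex_of_real (fact l * Re (coef e 0)))" for n
    proof -
      interpret R: unit_rep tensor_scale l "\<lambda>p. tensor_map scale (\<rho> p)" "power n" noninv
        by (rule unit_rep_power)
      have dim: "of_nat (tensor.dim (R.alg_act e ` power n)) = (\<Sum>g\<in>sym_grp l. coef e g * character B g ^ n)"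
        if e: "e \<in> E" for e
      proof -
        have "of_nat (tensor.dim (R.alg_act e ` power n)) = (\<Sum>g\<in>sym_grp l. coef e g *
            (\<Sum>cs\<in>words n B. tensor_map scale (\<rho> g) (pure cs) (map (coord B) cs)))"
          by (rule R.dim_alg_act_trace[OF prim[OF e] R.stable_W tensor_frame[OF B]])
        also have "\<dots> = (\<Sum>g\<in>sym_grp l. coef e g * character B g ^ n)"
          unfolding character_def using tensor_frame_trace[OF B rho_linear]
          by (intro sum.cong refl) simp
        finally show ?thesis .
      qed
      have "complex_of_real (len E n / ?D ^ n) =
        (\<Sum>e\<in>E. of_nat (tensor.dim (R.alg_act e ` power n)) / of_nat (dim UNIV) ^ n / complex_of_real (fact l * Re (coef e 0)))"
        unfolding len_def R.rep_length_def by (simp add: sum_divide_distrib field_simps)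
      also have "\<dots> = (\<Sum>e\<in>E. (\<Sum>g\<in>sym_grp l. coef e g *
        (character B g / of_nat (dim UNIV)) ^ n) / complex_of_real (fact l * Re (coef e 0)))"
      proof (intro sum.cong refl arg_cong2[where f = "(/)"])
        fix e assume "e \<in> E"
        then show "of_nat (tensor.dim (R.alg_act e ` power n)) / of_nat (dim UNIV) ^ n
          = (\<Sum>g\<in>sym_grp l. coef e g * (character B g / of_nat (dim UNIV)) ^ n)"
          by (simp add: dim sum_divide_distrib power_divide)
      qed
      finally show ?thesis .
    qed
    have "(\<lambda>n. complex_of_real (len E n / ?D ^ n)) \<longlonglongrightarrow>
      (\<Sum>e\<in>E. (\<Sum>g\<in>sym_grp l. coef e g * (if g = 0 then 1 else 0)) / complex_of_real (fact l * Re (coef e 0)))"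
      unfolding len_eq
    proof (intro tendsto_sum tendsto_divide tendsto_mult tendsto_const lim)
      fix e assume "e \<in> E"
      then obtain r where "r > 0" "coef e 0 = complex_of_real r" using primitive_coef_0[OF prim] by blast
      then show "complex_of_real (fact l * Re (coef e 0)) \<noteq> 0" by simp
    qed
    \<comment> \<open>What remains for each \<open>e\<close> is \<open>e(1) / (l! e(1))\<close>; the
      limit is therefore the number of idempotents over \<open>l!\<close>.\<close>
    also have "(\<Sum>e\<in>E. (\<Sum>g\<in>sym_grp l. coef e g * (if g = 0 then 1 else 0)) / complex_of_real (fact l * Re (coef e 0)))
      = (\<Sum>e\<in>E. complex_of_real (1 / fact l))"
    proof (intro sum.cong refl)
      fix e assume "e \<in> E"
      then obtain r where r: "r > 0" "coef e 0 = complex_of_real r" using primitive_coef_0[OF prim] by blast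
      have "(\<Sum>g\<in>sym_grp l. coef e g * (if g = 0 then 1 else 0)) = (\<Sum>g\<in>sym_grp l. if g = 0 then coef e 0 else 0)"
        by (intro sum.cong) auto
      also have "\<dots> = coef e 0" by simp
      finally show "(\<Sum>g\<in>sym_grp l. coef e g * (if g = 0 then 1 else 0)) / complex_of_real (fact l * Re (coef e 0))
        = complex_of_real (1 / fact l)" using r by simp
    qed
    also have "\<dots> = complex_of_real (real (card E) / fact l)" by simp
    also have "real (card E) / fact l = involution_sum l" using cardE by simp
    finally show ?thesis by (simp only: tendsto_of_real_iff)
  qed
qed

theorem decomposition_asymptotics:
  assumes d: "\<And>n. \<exists>X. unit_rep.decomposition tensor_scale l (\<lambda>p. tensor_map scale (\<rho> p)) (power n) noninv (power n) (b n) X"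
  shows "(\<lambda>n. real (b n) / real (dim UNIV) ^ n) \<longlonglongrightarrow> involution_sum l"
proof -
  let ?D = "real (dim UNIV)"
  have D: "?D > 0" using dim_pos by simp
  obtain E where E: "primitive_family l E" using primitive_family_exists by blast
  let ?c = "2 * (\<Sum>e\<in>E. 1 / (fact l * Re (coef e 0)))"
  have c0: "?c \<ge> 0"
  proof (rule mult_nonneg_nonneg[OF _ sum_nonneg])
    fix e assume "e \<in> E"
    then have "primitive l e" using E by (simp add: primitive_family_def)
    from primitive_coef_0[OF this] obtain r where "r > 0" "coef e 0 = complex_of_real r" .
    then show "0 \<le> 1 / (fact l * Re (coef e 0))" by simp
  qed simp
  have dims: "real (tensor.dim (t ` power n)) \<le> (?D - 1) ^ n" if t: "t \<in> noninv" for t n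
  proof -
    obtain g where g: "g \<in> Op" "\<not> inj g" "t = tensor_map scale g" using t by (auto simp: noninv_def)
    have "tensor.dim (t ` power n) \<le> dim (range g) ^ n"
      unfolding g(3) by (rule dim_tensor_map_le[OF Op_lin[OF g(1)]])
    also have "\<dots> \<le> (dim UNIV - 1) ^ n"
      using dim_range_less[OF Op_lin[OF g(1)] g(2)] by (intro power_mono) auto
    finally have "real (tensor.dim (t ` power n)) \<le> real ((dim UNIV - 1) ^ n)" by (simp only: of_nat_le_iff)
    then show ?thesis using dim_pos by (simp add: of_nat_diff)
  qed
  have up: "real (b n) \<le> len E n" and lo: "len E n \<le> real (b n) + ?c * (\<Sum>t\<in>noninv. (?D - 1) ^ n)" for n
  proof -
    interpret R: unit_rep tensor_scale l "\<lambda>p. tensor_map scale (\<rho> p)" "power n" noninv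
      by (rule unit_rep_power)
    obtain X where X: "R.decomposition (power n) (b n) X" using d by blast
    show "real (b n) \<le> len E n" unfolding len_def by (rule R.decomposition_bounds(1)[OF E X])
    have "len E n \<le> real (b n) + ?c * (\<Sum>t\<in>noninv. real (tensor.dim (t ` power n)))"
      unfolding len_def by (rule R.decomposition_bounds(2)[OF E X])
    also have "\<dots> \<le> real (b n) + ?c * (\<Sum>t\<in>noninv. (?D - 1) ^ n)"
      by (intro add_left_mono mult_left_mono[OF sum_mono c0] dims)
    finally show "len E n \<le> real (b n) + ?c * (\<Sum>t\<in>noninv. (?D - 1) ^ n)" .
  qed
  let ?K = "?c * real (card noninv)"
  \<comment> \<open>The limit also covers a one-dimensional \<open>V\<close>, where the ratio is
    0.\<close>
  have lim: "(\<lambda>n. len E n / ?D ^ n - ?K * ((?D - 1) / ?D) ^ n) \<longlonglongrightarrow> involution_sum l - ?K * 0"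
  proof (intro tendsto_diff len_limit[OF E] tendsto_mult tendsto_const LIMSEQ_power_zero)
    have "?D \<ge> 1" using dim_pos by simp
    then show "norm ((?D - 1) / ?D) < 1" by simp
  qed
  show ?thesis
  proof (rule tendsto_sandwich)
    show "(\<lambda>n. len E n / ?D ^ n - ?K * ((?D - 1) / ?D) ^ n) \<longlonglongrightarrow> involution_sum l" using lim by simp
    show "(\<lambda>n. len E n / ?D ^ n) \<longlonglongrightarrow> involution_sum l" by (rule len_limit[OF E])
    show "\<forall>\<^sub>F n in sequentially. real (b n) / ?D ^ n \<le> len E n / ?D ^ n"
      using up D by (intro always_eventually allI divide_right_mono) auto
    show "\<forall>\<^sub>F n in sequentially. len E n / ?D ^ n - ?K * ((?D - 1) / ?D) ^ n \<le> real (b n) / ?D ^ n"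
    proof (intro always_eventually allI)
      fix n
      have "len E n - ?K * (?D - 1) ^ n \<le> real (b n)" using lo[of n] by simp
      then have "(len E n - ?K * (?D - 1) ^ n) / ?D ^ n \<le> real (b n) / ?D ^ n"
        using D by (intro divide_right_mono) auto
      then show "len E n / ?D ^ n - ?K * ((?D - 1) / ?D) ^ n \<le> real (b n) / ?D ^ n"
        by (simp only: diff_divide_distrib[of "len E n"] power_divide times_divide_eq_right)
    qed
  qed
qed

end

section \<open>Diagram monoids\<close>

lemma stack_edges_sym: "(s, t) \<in> stack_edges x y \<Longrightarrow> (t, s) \<in> stack_edges x y"
  by (auto simp: stack_edges_def)

lemma stack_rtrancl_sym: "(s, t) \<in> (stack_edges x y)\<^sup>* \<Longrightarrow> (t, s) \<in> (stack_edges x y)\<^sup>*"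
  by (induction rule: rtrancl_induct) (auto intro: stack_edges_sym converse_rtrancl_into_rtrancl)

definition stack_rel :: "nat \<Rightarrow> diagram \<Rightarrow> diagram \<Rightarrow> (vertex \<times> vertex) set" where
  "stack_rel m x y = {(u, v). u \<in> vertices m \<and> v \<in> vertices m \<and>
     (outer u, outer v) \<in> (stack_edges x y)\<^sup>*}"

lemma diagram_mult_quotient: "diagram_mult m x y = vertices m // stack_rel m x y"
  by (simp add: diagram_mult_def stack_rel_def)

lemma equiv_stack_rel: "equiv (vertices m) (stack_rel m x y)"
proof (rule equivI)
  show "trans (stack_rel m x y)"
    by (rule transI) (auto simp: stack_rel_def intro: rtrancl_trans)
qed (auto simp: stack_rel_def refl_on_def sym_def intro: stack_rtrancl_sym)

lemma partition_diagram_mult: "partition_on (vertices m) (diagram_mult m x y)"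
  unfolding diagram_mult_quotient by (rule partition_on_quotient[OF equiv_stack_rel])

lemma diagram_mult_blockD:
  assumes "C \<in> diagram_mult m x y" "u \<in> C"
  shows "u \<in> vertices m" "C = {v \<in> vertices m. (outer u, outer v) \<in> (stack_edges x y)\<^sup>*}"
proof -
  obtain w where w: "w \<in> vertices m" "C = stack_rel m x y `` {w}"
    using assms(1) unfolding diagram_mult_quotient by (rule quotientE)
  have "(w, u) \<in> stack_rel m x y" using w assms(2) by auto
  then have "C = stack_rel m x y `` {u}"
    using equiv_class_eq[OF equiv_stack_rel] w(2) by metis
  then show "C = {v \<in> vertices m. (outer u, outer v) \<in> (stack_edges x y)\<^sup>*}"
    using \<open>(w, u) \<in> stack_rel m x y\<close> by (auto simp: stack_rel_def)
  show "u \<in> vertices m" using \<open>(w, u) \<in> stack_rel m x y\<close> by (auto simp: stack_rel_def)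
qed

lemma rtrancl_closed:
  assumes "(a, b) \<in> r\<^sup>*" "a \<in> S" "\<And>s t. (s, t) \<in> r \<Longrightarrow> s \<in> S \<Longrightarrow> t \<in> S"
  shows "b \<in> S"
  using assms by (induction rule: rtrancl_induct) auto

text \<open>A set that contains every block it meets contains the component of each of its points.
  Components are bounded from above by exhibiting such a set \<open>S\<close>.\<close>

lemma stack_closed:
  assumes "(a, b) \<in> (stack_edges x y)\<^sup>*" "a \<in> S"
    and "\<And>B v. B \<in> x \<Longrightarrow> v \<in> B \<Longrightarrow> upper_half v \<in> S \<Longrightarrow> upper_half ` B \<subseteq> S"
    and "\<And>B v. B \<in> y \<Longrightarrow> v \<in> B \<Longrightarrow> lower_half v \<in> S \<Longrightarrow> lower_half ` B \<subseteq> S"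
  shows "b \<in> S"
  using assms(1,2)
proof (rule rtrancl_closed)
  fix s t assume "(s, t) \<in> stack_edges x y" "s \<in> S"
  then show "t \<in> S" using assms(3,4) unfolding stack_edges_def by blast
qed

lemma upper_edge: "B \<in> x \<Longrightarrow> u \<in> B \<Longrightarrow> v \<in> B \<Longrightarrow> (upper_half u, upper_half v) \<in> stack_edges x y"
  and lower_edge: "B \<in> y \<Longrightarrow> u \<in> B \<Longrightarrow> v \<in> B \<Longrightarrow> (lower_half u, lower_half v) \<in> stack_edges x y"
  by (auto simp: stack_edges_def)

lemma inj_upper_half: "inj upper_half" and inj_lower_half: "inj lower_half" and inj_outer: "inj outer"
  by (auto simp: inj_def elim!: upper_half.elims lower_half.elims outer.elims)

lemma finite_vertices: "finite (vertices m)" by (simp add: vertices_def)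

lemma partition_on_same:
  "partition_on A P \<Longrightarrow> B \<in> P \<Longrightarrow> C \<in> P \<Longrightarrow> v \<in> B \<Longrightarrow> v \<in> C \<Longrightarrow> B = C"
  by (metis disjointD disjoint_iff partition_onD2)

lemma partition_on_obtain:
  assumes "partition_on A P" "v \<in> A"
  obtains B where "B \<in> P" "v \<in> B"
  using assms partition_onD1 by blast

lemma partition_on_block: "partition_on A P \<Longrightarrow> B \<in> P \<Longrightarrow> v \<in> B \<Longrightarrow> v \<in> A"
  using partition_onD1 by blast

lemma partition_on_finite_block: "partition_on (vertices m) x \<Longrightarrow> B \<in> x \<Longrightarrow> finite B"
  using finite_vertices partition_onD1 by (metis Union_upper finite_subset)

text \<open>
  Growing a set \<open>S\<close> from a single vertex along blocks of size at most \<open>2\<close>, the number of marked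
  vertices in \<open>S\<close> plus the number of blocks leaving \<open>S\<close> never exceeds \<open>2\<close>.
\<close>

lemma card_component_le_2:
  fixes \<B> :: "'a set set"
  assumes fin: "finite \<B>" "\<And>\<beta>. \<beta> \<in> \<B> \<Longrightarrow> finite \<beta>" and two: "\<And>\<beta>. \<beta> \<in> \<B> \<Longrightarrow> card \<beta> \<le> 2"
    and deg: "\<And>s. card {\<beta> \<in> \<B>. s \<in> \<beta>} + (if s \<in> P then 1 else 0) \<le> 2"
  shows "finite ({t. (a, t) \<in> (\<Union>\<beta>\<in>\<B>. \<beta> \<times> \<beta>)\<^sup>*} \<inter> P) \<and> card ({t. (a, t) \<in> (\<Union>\<beta>\<in>\<B>. \<beta> \<times> \<beta>)\<^sup>*} \<inter> P) \<le> 2"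
proof -
  define Opn where "Opn S = {\<beta> \<in> \<B>. \<beta> \<inter> S \<noteq> {} \<and> \<not> \<beta> \<subseteq> S}" for S
  let ?V = "insert a (\<Union>\<B>)"
  let ?Q = "\<lambda>S. a \<in> S \<and> S \<subseteq> ?V \<and> card (S \<inter> P) + card (Opn S) \<le> 2"
  have finV: "finite ?V" using fin by auto
  have "card (Opn {a}) \<le> card {\<beta> \<in> \<B>. a \<in> \<beta>}"
    using fin by (intro card_mono) (auto simp: Opn_def)
  moreover have "card ({a} \<inter> P) = (if a \<in> P then 1 else 0)" by simp
  ultimately have "?Q {a}" using deg[of a] by auto
  then obtain S where S: "?Q S" and max: "\<And>T. ?Q T \<Longrightarrow> card T \<le> card S"
    using ex_has_greatest_nat[of ?Q "{a}" card "Suc (card ?V)"] finV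
    by (metis (no_types, lifting) card_mono less_Suc_eq_le)
  have finS: "finite S" using S finV finite_subset by blast
  have "Opn S = {}"
  proof (rule ccontr)
    assume "Opn S \<noteq> {}"
    then obtain \<beta> where \<beta>: "\<beta> \<in> \<B>" "\<beta> \<inter> S \<noteq> {}" "\<not> \<beta> \<subseteq> S" by (auto simp: Opn_def)
    then obtain c b where cb: "c \<in> \<beta>" "c \<in> S" "b \<in> \<beta>" "b \<notin> S" by blast
    then have "b \<noteq> c" by blast
    then have "{b, c} \<subseteq> \<beta>" "card {b, c} = 2" using cb by auto
    then have eq: "\<beta> = {b, c}" using card_seteq[OF fin(2)[OF \<beta>(1)], of "{b, c}"] two[OF \<beta>(1)] by auto
    let ?N = "{\<gamma> \<in> \<B>. b \<in> \<gamma>}"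
    \<comment> \<open>Adding \<open>b\<close> closes the block \<open>\<beta>\<close>. By the degree
      bound it opens at most one other block, and none if \<open>b\<close> is marked, so the
      quantity does not increase.\<close>
    have "Opn (insert b S) \<subseteq> (Opn S - {\<beta>}) \<union> (?N - {\<beta>})"
      using eq cb by (auto simp: Opn_def)
    then have "card (Opn (insert b S)) \<le> card ((Opn S - {\<beta>}) \<union> (?N - {\<beta>}))"
      using fin by (intro card_mono) (auto simp: Opn_def)
    also have "\<dots> \<le> card (Opn S - {\<beta>}) + card (?N - {\<beta>})" by (rule card_Un_le)
    also have "card (Opn S - {\<beta>}) = card (Opn S) - 1" using \<beta> fin by (intro card_Diff_singleton) (auto simp: Opn_def)
    also have "card (?N - {\<beta>}) = card ?N - 1" using \<beta>(1) cb(3) by (intro card_Diff_singleton) auto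
    finally have o: "card (Opn (insert b S)) \<le> (card (Opn S) - 1) + (card ?N - 1)" .
    have pos: "card (Opn S) \<ge> 1" "card ?N \<ge> 1"
      using \<beta> cb(3) fin by (auto simp: Suc_le_eq card_gt_0_iff Opn_def)
    have p: "card (insert b S \<inter> P) = card (S \<inter> P) + (if b \<in> P then 1 else 0)"
      using cb(4) finS by (auto simp: Int_insert_left)
    have "card (insert b S \<inter> P) + card (Opn (insert b S)) \<le> 2"
      using o pos p deg[of b] S by (auto split: if_splits)
    moreover have "insert b S \<subseteq> ?V" using S \<beta>(1) cb(3) by blast
    ultimately have "?Q (insert b S)" using S by blast
    then have "card (insert b S) \<le> card S" by (rule max)
    then show False using cb(4) finS by simp
  qed
  then have closed: "t \<in> S" if "(s, t) \<in> (\<Union>\<beta>\<in>\<B>. \<beta> \<times> \<beta>)" "s \<in> S" for s t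
    using that unfolding Opn_def by blast
  have "{t. (a, t) \<in> (\<Union>\<beta>\<in>\<B>. \<beta> \<times> \<beta>)\<^sup>*} \<subseteq> S"
  proof clarify
    fix t assume "(a, t) \<in> (\<Union>\<beta>\<in>\<B>. \<beta> \<times> \<beta>)\<^sup>*"
    then show "t \<in> S" by (rule rtrancl_closed) (use S closed in blast)+
  qed
  then have "{t. (a, t) \<in> (\<Union>\<beta>\<in>\<B>. \<beta> \<times> \<beta>)\<^sup>*} \<inter> P \<subseteq> S \<inter> P" by blast
  moreover have "finite (S \<inter> P)" "card (S \<inter> P) \<le> 2" using S finS by auto
  ultimately show ?thesis by (meson card_mono finite_subset le_trans)
qed

section \<open>Products within the rook Brauer, Brauer and rook monoids\<close>

text \<open>In the stack, a middle vertex lies in at most one block of each diagram, hence in at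
  most two, while an outer vertex lies in at most one block altogether. With the outer vertices
  marked, \<open>card_component_le_2\<close> applies.\<close>

lemma diagram_mult_card_le_2:
  assumes x: "partition_on (vertices m) x" "\<And>B. B \<in> x \<Longrightarrow> card B \<le> 2"
    and y: "partition_on (vertices m) y" "\<And>B. B \<in> y \<Longrightarrow> card B \<le> 2"
    and C: "C \<in> diagram_mult m x y"
  shows "card C \<le> 2"
proof -
  let ?B = "(\<lambda>B. upper_half ` B) ` x \<union> (\<lambda>B. lower_half ` B) ` y"
  have edges: "stack_edges x y = (\<Union>\<beta>\<in>?B. \<beta> \<times> \<beta>)" by (simp add: stack_edges_def)
  have "C \<noteq> {}" using C partition_diagram_mult partition_onD3 by metis
  then obtain u where u: "u \<in> C" by blast
  have finx: "finite x" "finite y" using finite_elements[OF finite_vertices] x(1) y(1) by blast+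
  have one: "card {\<beta> \<in> (\<lambda>B. f ` B) ` z. s \<in> \<beta>} \<le> 1"
    if f: "inj f" and z: "partition_on (vertices m) z" for f :: "vertex \<Rightarrow> stack_vertex" and z s
  proof -
    have "\<beta> = \<gamma>" if bc: "\<beta> \<in> {\<beta> \<in> (\<lambda>B. f ` B) ` z. s \<in> \<beta>}" "\<gamma> \<in> {\<beta> \<in> (\<lambda>B. f ` B) ` z. s \<in> \<beta>}" for \<beta> \<gamma>
    proof -
      obtain B v D w where "B \<in> z" "v \<in> B" "s = f v" "\<beta> = f ` B" "D \<in> z" "w \<in> D" "s = f w" "\<gamma> = f ` D"
        using bc by blast
      then show ?thesis using injD[OF f] partition_on_same[OF z] by metis
    qed
    then have eq: "\<forall>\<beta>\<in>{\<beta> \<in> (\<lambda>B. f ` B) ` z. s \<in> \<beta>}. \<forall>\<gamma>\<in>{\<beta> \<in> (\<lambda>B. f ` B) ` z. s \<in> \<beta>}. \<beta> = \<gamma>"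
      by (intro ballI)
    have "finite {\<beta> \<in> (\<lambda>B. f ` B) ` z. s \<in> \<beta>}" using finite_elements[OF finite_vertices z] by simp
    from card_le_Suc0_iff_eq[OF this] eq show ?thesis unfolding One_nat_def by (rule iffD2)
  qed
  let ?P = "range outer"
  have deg: "card {\<beta> \<in> ?B. s \<in> \<beta>} + (if s \<in> ?P then 1 else 0) \<le> 2" for s
  proof -
    let ?X = "{\<beta> \<in> (\<lambda>B. upper_half ` B) ` x. s \<in> \<beta>}" and ?Y = "{\<beta> \<in> (\<lambda>B. lower_half ` B) ` y. s \<in> \<beta>}"
    have "{\<beta> \<in> ?B. s \<in> \<beta>} = ?X \<union> ?Y" by blast
    then have le: "card {\<beta> \<in> ?B. s \<in> \<beta>} \<le> card ?X + card ?Y" by (simp add: card_Un_le)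
    have 1: "card ?X \<le> 1" "card ?Y \<le> 1" using one inj_upper_half inj_lower_half x(1) y(1) by blast+
    have b1: "(if s \<in> ?P then 1 else 0) \<le> (1 :: nat)" by simp
    have up: "upper_half v \<noteq> Lower i" and lo: "lower_half v \<noteq> Upper i" for v i by (cases v; simp)+
    show ?thesis
    proof (cases s)
      case (Upper i)
      then have "?Y = {}" using lo by (auto simp: image_iff) metis
      then have "card ?Y = 0" by (simp only: card.empty)
      then show ?thesis using le 1 b1 by linarith
    next
      case (Lower i)
      then have "?X = {}" using up by (auto simp: image_iff) metis
      then have "card ?X = 0" by (simp only: card.empty)
      then show ?thesis using le 1 b1 by linarith
    next
      case (Middle i)
      have "outer v \<noteq> Middle i" for v by (cases v) auto
      then have "s \<notin> ?P" unfolding Middle image_iff by metis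
      then have "(if s \<in> ?P then 1 else 0) = (0 :: nat)" by (rule if_not_P)
      then show ?thesis using le 1 by linarith
    qed
  qed
  have "finite ({t. (outer u, t) \<in> (stack_edges x y)\<^sup>*} \<inter> ?P) \<and> card ({t. (outer u, t) \<in> (stack_edges x y)\<^sup>*} \<inter> ?P) \<le> 2"
    unfolding edges
  proof (rule card_component_le_2[OF _ _ _ deg])
    show "finite ?B" using finx by simp
    show "finite \<beta>" if "\<beta> \<in> ?B" for \<beta>
      using that partition_on_finite_block x(1) y(1) by blast
    show "card \<beta> \<le> 2" if "\<beta> \<in> ?B" for \<beta>
    proof -
      have "card (f ` B) \<le> 2" if "partition_on (vertices m) z" "\<And>B. B \<in> z \<Longrightarrow> card B \<le> 2" "B \<in> z"
        for z B and f :: "vertex \<Rightarrow> stack_vertex"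
        using card_image_le[OF partition_on_finite_block[OF that(1,3)], of f] that(2)[OF that(3)] by simp
      then show ?thesis using that x y by blast
    qed
  qed
  moreover have "outer ` C \<subseteq> {t. (outer u, t) \<in> (stack_edges x y)\<^sup>*} \<inter> ?P"
    using diagram_mult_blockD(2)[OF C u] by auto
  ultimately have "card (outer ` C) \<le> 2" by (meson card_mono le_trans)
  then show ?thesis using card_image[OF inj_on_subset[OF inj_outer subset_UNIV]] by metis
qed

lemma even_card_Union_pairs:
  assumes "finite P" "\<And>B. B \<in> P \<Longrightarrow> card B = 2" "\<And>B C. B \<in> P \<Longrightarrow> C \<in> P \<Longrightarrow> B \<noteq> C \<Longrightarrow> B \<inter> C = {}"
  shows "even (card (\<Union>P))"
proof -
  have "card (\<Union>P) = (\<Sum>B\<in>P. card B)"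
    using assms by (intro card_Union_disjoint) (auto simp: pairwise_def disjnt_def intro: card_ge_0_finite)
  then show ?thesis using assms(2) by simp
qed

text \<open>A parity argument: a component \<open>K\<close> contains an even number of vertices of
  either diagram, being a union of pairs there. Both counts include the middle vertices in
  \<open>K\<close>, so the number of outer vertices in \<open>K\<close> is even. As it is positive
  and at most 2, it is 2.\<close>

lemma diagram_mult_card_2:
  assumes x: "partition_on (vertices m) x" "\<And>B. B \<in> x \<Longrightarrow> card B = 2"
    and y: "partition_on (vertices m) y" "\<And>B. B \<in> y \<Longrightarrow> card B = 2"
    and C: "C \<in> diagram_mult m x y"
  shows "card C = 2"
proof -
  have "C \<noteq> {}" using C partition_diagram_mult partition_onD3 by metis
  then obtain u where u: "u \<in> C" by blast
  define K where "K = {t. (outer u, t) \<in> (stack_edges x y)\<^sup>*}"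
  have finC: "finite C" using diagram_mult_blockD(1)[OF C] finite_vertices finite_subset by (metis subsetI)
  have half: "even (card {v \<in> vertices m. f v \<in> K})"
    if z: "partition_on (vertices m) z" "\<And>B. B \<in> z \<Longrightarrow> card B = 2"
      and e: "\<And>B v w. B \<in> z \<Longrightarrow> v \<in> B \<Longrightarrow> w \<in> B \<Longrightarrow> (f v, f w) \<in> stack_edges x y" for f z
  proof -
    have "{v \<in> vertices m. f v \<in> K} = \<Union>{B \<in> z. f ` B \<subseteq> K}"
    proof (intro equalityI subsetI)
      fix v assume v: "v \<in> {v \<in> vertices m. f v \<in> K}"
      then obtain B where B: "B \<in> z" "v \<in> B" using partition_on_obtain[OF z(1)] by blast
      have "f w \<in> K" if "w \<in> B" for w
        using v e[OF B that] unfolding K_def by (auto intro: rtrancl_into_rtrancl)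
      then show "v \<in> \<Union>{B \<in> z. f ` B \<subseteq> K}" using B by blast
    next
      fix v assume "v \<in> \<Union>{B \<in> z. f ` B \<subseteq> K}"
      then show "v \<in> {v \<in> vertices m. f v \<in> K}" using partition_on_block[OF z(1)] by blast
    qed
    moreover have "even (card (\<Union>{B \<in> z. f ` B \<subseteq> K}))"
      using z finite_elements[OF finite_vertices z(1)] partition_on_same[OF z(1)]
      by (intro even_card_Union_pairs) auto
    ultimately show ?thesis by simp
  qed
  have split: "card {v \<in> vertices m. f v \<in> K} = card {i \<in> {1..m}. f (Top i) \<in> K} + card {i \<in> {1..m}. f (Bot i) \<in> K}" for f
  proof -
    have "{v \<in> vertices m. f v \<in> K} = Top ` {i \<in> {1..m}. f (Top i) \<in> K} \<union> Bot ` {i \<in> {1..m}. f (Bot i) \<in> K}"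
      by (auto simp: vertices_def)
    also have "card \<dots> = card (Top ` {i \<in> {1..m}. f (Top i) \<in> K}) + card (Bot ` {i \<in> {1..m}. f (Bot i) \<in> K})"
      by (intro card_Un_disjoint) auto
    finally show ?thesis by (simp add: card_image inj_on_def)
  qed
  have "even (card {v \<in> vertices m. upper_half v \<in> K})" by (rule half[OF x upper_edge])
  moreover have "even (card {v \<in> vertices m. lower_half v \<in> K})" by (rule half[OF y lower_edge])
  ultimately have "even (card {v \<in> vertices m. outer v \<in> K})"
    unfolding split by simp
  moreover have "C = {v \<in> vertices m. outer v \<in> K}" using diagram_mult_blockD(2)[OF C u] by (simp add: K_def)
  ultimately have "even (card C)" by simp
  moreover have "card C \<le> 2" using diagram_mult_card_le_2[OF x(1) _ y(1) _ C] x(2) y(2) by simp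
  moreover have "card C > 0" using u finC by (auto simp: card_gt_0_iff)
  ultimately show ?thesis by (cases "card C = 1") auto
qed

lemma rook_block:
  assumes "\<And>B. B \<in> x \<Longrightarrow> card B \<le> 2 \<and> (card B = 2 \<longrightarrow> (\<exists>i j. B = {Top i, Bot j}))" "finite B" "B \<in> x"
  shows "Top i \<in> B \<Longrightarrow> B = {Top i} \<or> (\<exists>j. B = {Top i, Bot j})"
    and "Bot j \<in> B \<Longrightarrow> B = {Bot j} \<or> (\<exists>i. B = {Top i, Bot j})"
proof -
  have b: "card B \<le> 2 \<and> (card B = 2 \<longrightarrow> (\<exists>i j. B = {Top i, Bot j}))" using assms by blast
  have 1: "B = {v}" if "v \<in> B" "card B \<noteq> 2" for v
  proof -
    have "card B > 0" using that assms(2) by (auto simp: card_gt_0_iff)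
    then have "card B = 1" using that b by linarith
    then show ?thesis using that(1) by (auto simp: card_1_singleton_iff)
  qed
  show "Top i \<in> B \<Longrightarrow> B = {Top i} \<or> (\<exists>j. B = {Top i, Bot j})"
    using 1[of "Top i"] b by (cases "card B = 2") auto
  show "Bot j \<in> B \<Longrightarrow> B = {Bot j} \<or> (\<exists>i. B = {Top i, Bot j})"
    using 1[of "Bot j"] b by (cases "card B = 2") auto
qed

text \<open>A component that starts at the top follows at most one block to the middle and one to
  the bottom; it never returns to the top row. The same holds upwards.\<close>

lemma diagram_mult_rook:
  assumes x: "partition_on (vertices m) x" "\<And>B. B \<in> x \<Longrightarrow> card B \<le> 2 \<and> (card B = 2 \<longrightarrow> (\<exists>i j. B = {Top i, Bot j}))"
    and y: "partition_on (vertices m) y" "\<And>B. B \<in> y \<Longrightarrow> card B \<le> 2 \<and> (card B = 2 \<longrightarrow> (\<exists>i j. B = {Top i, Bot j}))"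
    and C: "C \<in> diagram_mult m x y"
  shows "card C = 2 \<longrightarrow> (\<exists>i j. C = {Top i, Bot j})"
proof
  assume c2: "card C = 2"
  have bx: "Top i \<in> B \<Longrightarrow> B = {Top i} \<or> (\<exists>j. B = {Top i, Bot j})"
    "Bot j \<in> B \<Longrightarrow> B = {Bot j} \<or> (\<exists>i. B = {Top i, Bot j})" if "B \<in> x" for B i j
    using rook_block[OF x(2) partition_on_finite_block[OF x(1) that] that] by blast+
  have byy: "Top i \<in> B \<Longrightarrow> B = {Top i} \<or> (\<exists>j. B = {Top i, Bot j})"
    "Bot j \<in> B \<Longrightarrow> B = {Bot j} \<or> (\<exists>i. B = {Top i, Bot j})" if "B \<in> y" for B i j
    using rook_block[OF y(2) partition_on_finite_block[OF y(1) that] that] by blast+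
  note same = partition_on_same[OF x(1)] partition_on_same[OF y(1)]
  have top: "i = i'" if "(Upper i, Upper i') \<in> (stack_edges x y)\<^sup>*" for i i'
  proof -
    let ?S = "{Upper i} \<union> {Middle j |j. {Top i, Bot j} \<in> x} \<union>
      {Lower k |j k. {Top i, Bot j} \<in> x \<and> {Top j, Bot k} \<in> y}"
    have "Upper i' \<in> ?S" using that
    proof (rule stack_closed)
      fix B v assume B: "B \<in> x" "v \<in> B" "upper_half v \<in> ?S"
      show "upper_half ` B \<subseteq> ?S"
      proof (cases v)
        case (Top k)
        then have "k = i" using B(3) by auto
        then show ?thesis using bx(1)[OF B(1), of i] B(1,2) Top by auto
      next
        case (Bot j)
        then have "{Top i, Bot j} \<in> x" using B(3) by auto
        then have "B = {Top i, Bot j}" using same(1)[OF B(1)] B(2) Bot by blast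
        then show ?thesis using B(1) by auto
      qed
    next
      fix B v assume B: "B \<in> y" "v \<in> B" "lower_half v \<in> ?S"
      show "lower_half ` B \<subseteq> ?S"
      proof (cases v)
        case (Top j)
        then have j: "{Top i, Bot j} \<in> x" using B(3) by auto
        then show ?thesis using byy(1)[OF B(1), of j] B(1,2) Top by auto
      next
        case (Bot k)
        then obtain j where j: "{Top i, Bot j} \<in> x" "{Top j, Bot k} \<in> y" using B(3) by auto
        then have "B = {Top j, Bot k}" using same(2)[OF B(1)] B(2) Bot by blast
        then show ?thesis using j by auto
      qed
    qed simp
    then show ?thesis by auto
  qed
  have bot: "k = k'" if "(Lower k, Lower k') \<in> (stack_edges x y)\<^sup>*" for k k'
  proof -
    let ?S = "{Lower k} \<union> {Middle j |j. {Top j, Bot k} \<in> y} \<union>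
      {Upper i |i j. {Top i, Bot j} \<in> x \<and> {Top j, Bot k} \<in> y}"
    have "Lower k' \<in> ?S" using that
    proof (rule stack_closed)
      fix B v assume B: "B \<in> y" "v \<in> B" "lower_half v \<in> ?S"
      show "lower_half ` B \<subseteq> ?S"
      proof (cases v)
        case (Bot i)
        then have "i = k" using B(3) by auto
        then show ?thesis using byy(2)[OF B(1), of k] B(1,2) Bot by auto
      next
        case (Top j)
        then have "{Top j, Bot k} \<in> y" using B(3) by auto
        then have "B = {Top j, Bot k}" using same(2)[OF B(1)] B(2) Top by blast
        then show ?thesis using B(1) by auto
      qed
    next
      fix B v assume B: "B \<in> x" "v \<in> B" "upper_half v \<in> ?S"
      show "upper_half ` B \<subseteq> ?S"
      proof (cases v)
        case (Bot j)
        then have j: "{Top j, Bot k} \<in> y" using B(3) by auto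
        then show ?thesis using bx(2)[OF B(1), of j] B(1,2) Bot by auto
      next
        case (Top i)
        then obtain j where j: "{Top i, Bot j} \<in> x" "{Top j, Bot k} \<in> y" using B(3) by auto
        then have "B = {Top i, Bot j}" using same(1)[OF B(1)] B(2) Top by blast
        then show ?thesis using j by auto
      qed
    qed simp
    then show ?thesis by auto
  qed
  obtain u v where uv: "C = {u, v}" "u \<noteq> v" using c2 by (auto simp: card_2_iff)
  have "(outer u, outer v) \<in> (stack_edges x y)\<^sup>*"
    using diagram_mult_blockD(2)[OF C, of u] uv by auto
  then show "\<exists>i j. C = {Top i, Bot j}"
    using top bot uv by (cases u; cases v) (auto simp: insert_commute)
qed

section \<open>Permutation diagrams and units\<close>

definition perm_diagram :: "nat \<Rightarrow> (nat \<Rightarrow> nat) \<Rightarrow> diagram" where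
  "perm_diagram m \<sigma> = (\<lambda>i. {Top i, Bot (\<sigma> i)}) ` {1..m}"

lemma partition_perm_diagram:
  assumes "\<sigma> permutes {1..m}"
  shows "partition_on (vertices m) (perm_diagram m \<sigma>)"
proof (rule partition_onI)
  have "\<sigma> ` {1..m} = {1..m}" by (rule permutes_image[OF assms])
  then show "\<Union>(perm_diagram m \<sigma>) = vertices m"
    unfolding perm_diagram_def vertices_def by (auto simp: image_iff)
  show "disjnt p q" if "p \<in> perm_diagram m \<sigma>" "q \<in> perm_diagram m \<sigma>" "p \<noteq> q" for p q
    using that permutes_inj[OF assms] by (auto simp: perm_diagram_def disjnt_def inj_eq)
qed (auto simp: perm_diagram_def)

lemma perm_diagram_inj:
  assumes "perm_diagram m \<sigma> = perm_diagram m \<tau>" "\<sigma> permutes {1..m}" "\<tau> permutes {1..m}"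
  shows "\<sigma> = \<tau>"
proof
  fix i
  show "\<sigma> i = \<tau> i"
  proof (cases "i \<in> {1..m}")
    case True
    then have "{Top i, Bot (\<sigma> i)} \<in> perm_diagram m \<sigma>" unfolding perm_diagram_def by (rule imageI)
    then have "{Top i, Bot (\<sigma> i)} \<in> perm_diagram m \<tau>" by (simp only: assms(1))
    then show ?thesis by (auto simp: perm_diagram_def doubleton_eq_iff)
  next
    case False
    then show ?thesis using assms(2,3) by (simp add: permutes_not_in)
  qed
qed

text \<open>A block of \<open>Q\<close> meets some block of \<open>P\<close>; this is also a block
  of \<open>Q\<close>, hence the same one. It reduces equality of diagrams to one inclusion.\<close>

lemma partition_on_mono_eq:
  assumes "partition_on A P" "partition_on A Q" "P \<subseteq> Q"
  shows "P = Q"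
proof (intro equalityI subsetI)
  fix B assume B: "B \<in> Q"
  then obtain v where v: "v \<in> B" using partition_onD3[OF assms(2)] by (metis ex_in_conv)
  then obtain C where C: "C \<in> P" "v \<in> C" using partition_on_obtain[OF assms(1)] partition_on_block[OF assms(2) B] by metis
  then have "C = B" using partition_on_same[OF assms(2)] B v assms(3) by blast
  then show "B \<in> P" using C by simp
qed (use assms in blast)

text \<open>The strand from \<open>i\<close> passes through the middle vertex
  \<open>\<sigma> i\<close> and ends at \<open>\<tau> (\<sigma> i)\<close>, so stacking composes
  permutations in reverse order.\<close>

lemma perm_diagram_mult:
  assumes s: "\<sigma> permutes {1..m}" and t: "\<tau> permutes {1..m}"
  shows "diagram_mult m (perm_diagram m \<sigma>) (perm_diagram m \<tau>) = perm_diagram m (\<tau> \<circ> \<sigma>)"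
proof (rule sym, rule partition_on_mono_eq[OF partition_perm_diagram partition_diagram_mult])
  show "(\<tau> \<circ> \<sigma>) permutes {1..m}" using permutes_compose[OF s t] .
  let ?x = "perm_diagram m \<sigma>" and ?y = "perm_diagram m \<tau>"
  show "perm_diagram m (\<tau> \<circ> \<sigma>) \<subseteq> diagram_mult m ?x ?y"
  proof
    fix B assume "B \<in> perm_diagram m (\<tau> \<circ> \<sigma>)"
    then obtain i where i: "i \<in> {1..m}" "B = {Top i, Bot (\<tau> (\<sigma> i))}" by (auto simp: perm_diagram_def)
    have si: "\<sigma> i \<in> {1..m}" "\<tau> (\<sigma> i) \<in> {1..m}" using i s t permutes_in_image by metis+
    have "Top i \<in> vertices m" using i by (simp add: vertices_def)
    then obtain C where C: "C \<in> diagram_mult m ?x ?y" "Top i \<in> C"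
      using partition_on_obtain[OF partition_diagram_mult] by metis
    have Ceq: "C = {v \<in> vertices m. (outer (Top i), outer v) \<in> (stack_edges ?x ?y)\<^sup>*}"
      by (rule diagram_mult_blockD(2)[OF C])
    have "(upper_half (Top i), upper_half (Bot (\<sigma> i))) \<in> stack_edges ?x ?y"
      using i by (intro upper_edge[of "{Top i, Bot (\<sigma> i)}"]) (auto simp: perm_diagram_def)
    moreover have "(lower_half (Top (\<sigma> i)), lower_half (Bot (\<tau> (\<sigma> i)))) \<in> stack_edges ?x ?y"
      using si by (intro lower_edge[of "{Top (\<sigma> i), Bot (\<tau> (\<sigma> i))}"]) (auto simp: perm_diagram_def)
    ultimately have "(Upper i, Lower (\<tau> (\<sigma> i))) \<in> (stack_edges ?x ?y)\<^sup>*"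
      by (simp add: rtrancl_into_rtrancl r_into_rtrancl)
    then have "B \<subseteq> C" unfolding Ceq i(2) using i(1) si by (auto simp: vertices_def)
    moreover have "C \<subseteq> B"
    proof
      fix v assume "v \<in> C"
      then have "(Upper i, outer v) \<in> (stack_edges ?x ?y)\<^sup>*" using Ceq by auto
      then have "outer v \<in> {Upper i, Middle (\<sigma> i), Lower (\<tau> (\<sigma> i))}"
        by (rule stack_closed) (auto simp: perm_diagram_def dest: permutes_inj[OF s, THEN injD] permutes_inj[OF t, THEN injD])
      then show "v \<in> B" using i(2) by (cases v) auto
    qed
    ultimately have "B = C" by (rule subset_antisym)
    then show "B \<in> diagram_mult m ?x ?y" using C(1) by (simp only:)
  qed
qed

text \<open>In \<open>x\<close>, no block contains two top vertices, since these would be joined in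
  the identity diagram, and no top vertex is cut off from the bottom row. Choosing a bottom vertex
  in the block of each top vertex gives an injection of \<open>{1..m}\<close>, hence a permutation;
  all bottom vertices are then used, so the blocks are exactly pairs.\<close>

lemma right_invertible_perm_diagram:
  assumes x: "partition_on (vertices m) x" and y: "partition_on (vertices m) y"
    and xy: "diagram_mult m x y = perm_diagram m id"
  obtains \<sigma> where "\<sigma> permutes {1..m}" "x = perm_diagram m \<sigma>"
proof -
  have block: "{v \<in> vertices m. (Upper i, outer v) \<in> (stack_edges x y)\<^sup>*} = {Top i, Bot i}" if i: "i \<in> {1..m}" for i
  proof -
    have "{Top i, Bot i} \<in> diagram_mult m x y" unfolding xy using i by (auto simp: perm_diagram_def)
    from diagram_mult_blockD(2)[OF this, of "Top i"] show ?thesis by simp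
  qed
  have sep: "i = i'" if "i \<in> {1..m}" "i' \<in> {1..m}" "B \<in> x" "Top i \<in> B" "Top i' \<in> B" for i i' B
  proof -
    have "(Upper i, Upper i') \<in> stack_edges x y" using upper_edge[OF that(3-5)] by simp
    then have "Top i' \<in> {v \<in> vertices m. (Upper i, outer v) \<in> (stack_edges x y)\<^sup>*}"
      using that(2) by (auto simp: vertices_def)
    then show ?thesis unfolding block[OF that(1)] by simp
  qed
  have mem: "i \<in> {1..m}" if "B \<in> x" "Top i \<in> B \<or> Bot i \<in> B" for i B
    using partition_on_block[OF x that(1), of "Top i"] partition_on_block[OF x that(1), of "Bot i"] that(2)
    by (auto simp: vertices_def)
  have "\<exists>B j. B \<in> x \<and> Top i \<in> B \<and> Bot j \<in> B" if i: "i \<in> {1..m}" for i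
  proof -
    have "Top i \<in> vertices m" using i by (simp add: vertices_def)
    then obtain B where B: "B \<in> x" "Top i \<in> B" using partition_on_obtain[OF x] by metis
    have "\<exists>j. Bot j \<in> B"
    proof (rule ccontr)
      assume no: "\<nexists>j. Bot j \<in> B"
      have "B = {Top i}"
      proof (intro equalityI subsetI)
        fix v assume v: "v \<in> B"
        then obtain k where "v = Top k" using no by (cases v) auto
        then show "v \<in> {Top i}" using sep[OF i mem B(1) B(2)] B(1) v by auto
      qed (use B in auto)
      have "Bot i \<in> {v \<in> vertices m. (Upper i, outer v) \<in> (stack_edges x y)\<^sup>*}" using block[OF i] by blast
      then have "(Upper i, Lower i) \<in> (stack_edges x y)\<^sup>*" by simp
      then have "Lower i \<in> {Upper i}"
      proof (rule stack_closed)
        fix A v assume A: "A \<in> x" "v \<in> A" "upper_half v \<in> {Upper i}"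
        then have "v = Top i" by (cases v) auto
        then have "A = {Top i}" using partition_on_same[OF x A(1) B(1)] A(2) B(2) \<open>B = {Top i}\<close> by simp
        then show "upper_half ` A \<subseteq> {Upper i}" by simp
      next
        fix A v assume "lower_half v \<in> {Upper i}"
        then show "lower_half ` A \<subseteq> {Upper i}" by (cases v) auto
      qed simp
      then show False by simp
    qed
    then show ?thesis using B by blast
  qed
  then obtain Bl s where Bs: "\<And>i. i \<in> {1..m} \<Longrightarrow> Bl i \<in> x \<and> Top i \<in> Bl i \<and> Bot (s i) \<in> Bl i" by metis
  define \<sigma> where "\<sigma> i = (if i \<in> {1..m} then s i else i)" for i
  have inj: "inj_on \<sigma> {1..m}"
  proof (rule inj_onI)
    fix i j assume ij: "i \<in> {1..m}" "j \<in> {1..m}" "\<sigma> i = \<sigma> j"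
    then have "Bl i = Bl j" using Bs partition_on_same[OF x] unfolding \<sigma>_def by metis
    then show "i = j" using sep[OF ij(1,2), of "Bl i"] Bs ij by metis
  qed
  have into: "\<sigma> ` {1..m} \<subseteq> {1..m}" using Bs mem by (auto simp: \<sigma>_def simp del: atLeastAtMost_iff)
  have perm: "\<sigma> permutes {1..m}"
    using endo_inj_surj[OF _ into inj] inj by (intro bij_imp_permutes) (auto simp: bij_betw_def \<sigma>_def)
  have Bl: "Bl i = {Top i, Bot (\<sigma> i)}" if i: "i \<in> {1..m}" for i
  proof (intro equalityI subsetI)
    fix v assume v: "v \<in> Bl i"
    have Bi: "Bl i \<in> x" "Top i \<in> Bl i" using Bs[OF i] by auto
    show "v \<in> {Top i, Bot (\<sigma> i)}"
    proof (cases v)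
      case (Top k)
      then show ?thesis using sep[OF i mem[OF Bi(1)] Bi] v by auto
    next
      case (Bot k)
      then have "k \<in> {1..m}" using mem[OF Bi(1)] v by auto
      then obtain j where j: "j \<in> {1..m}" "k = \<sigma> j" using permutes_image[OF perm] by (metis imageE)
      then have "Bot k \<in> Bl j" "Bl j \<in> x" using Bs by (auto simp: \<sigma>_def)
      then have eq: "Bl j = Bl i" using partition_on_same[OF x _ Bi(1)] v Bot by blast
      have "Top j \<in> Bl j" using Bs[OF j(1)] by blast
      then have "Top j \<in> Bl i" unfolding eq .
      then have "i = j" by (rule sep[OF i j(1) Bi])
      then show ?thesis using j(2) Bot by (simp only: insert_iff simp_thms)
    qed
  qed (use Bs[OF i] i in \<open>auto simp: \<sigma>_def\<close>)
  have "perm_diagram m \<sigma> \<subseteq> x" using Bl Bs by (auto simp: perm_diagram_def simp del: atLeastAtMost_iff)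
  then have "perm_diagram m \<sigma> = x" by (rule partition_on_mono_eq[OF partition_perm_diagram[OF perm] x])
  then show ?thesis using that perm by blast
qed

section \<open>Planarity of products\<close>

fun stack_position :: "stack_vertex \<Rightarrow> real \<times> real" where
  "stack_position (Upper i) = (real i, 1)"
| "stack_position (Middle i) = (real i, 1/2)"
| "stack_position (Lower i) = (real i, 0)"

definition upper_map :: "real \<times> real \<Rightarrow> real \<times> real" where
  "upper_map p = (fst p, (snd p + 1) / 2)"

definition lower_map :: "real \<times> real \<Rightarrow> real \<times> real" where
  "lower_map p = (fst p, snd p / 2)"

lemma stack_position_half:
  "stack_position (upper_half v) = upper_map (position v)"
  "stack_position (lower_half v) = lower_map (position v)"
  "stack_position (outer v) = position v"
  by (cases v; simp add: upper_map_def lower_map_def)+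

lemma path_connected_half_maps:
  "path_connected S \<Longrightarrow> path_connected (upper_map ` S)"
  "path_connected S \<Longrightarrow> path_connected (lower_map ` S)"
  unfolding upper_map_def[abs_def] lower_map_def[abs_def]
  by (intro path_connected_continuous_image continuous_intros; simp)+

text \<open>
  The drawing of a product is the stack of the two drawings, each squeezed to half its height; a
  block of the product is drawn as the union of the pieces in its connected component. Pieces of
  different halves meet only in middle vertices.
\<close>

lemma planar_diagram_mult:
  assumes px: "partition_on (vertices m) x" and py: "partition_on (vertices m) y"
    and plx: "planar_diagram m x" and ply: "planar_diagram m y"
  shows "planar_diagram m (diagram_mult m x y)"
proof -
  let ?R = "{0<..<real m + 1} \<times> {0<..<1::real}"
  obtain Dx where Dx: "\<And>B. B \<in> x \<Longrightarrow> path_connected (Dx B) \<and> position ` B \<subseteq> Dx B \<and> Dx B \<subseteq> position ` B \<union> ?R"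
    "\<And>B C. B \<in> x \<Longrightarrow> C \<in> x \<Longrightarrow> B \<noteq> C \<Longrightarrow> Dx B \<inter> Dx C = {}"
    using plx unfolding planar_diagram_def by metis
  obtain Dy where Dy: "\<And>B. B \<in> y \<Longrightarrow> path_connected (Dy B) \<and> position ` B \<subseteq> Dy B \<and> Dy B \<subseteq> position ` B \<union> ?R"
    "\<And>B C. B \<in> y \<Longrightarrow> C \<in> y \<Longrightarrow> B \<noteq> C \<Longrightarrow> Dy B \<inter> Dy C = {}"
    using ply unfolding planar_diagram_def by metis
  let ?E = "(stack_edges x y)\<^sup>*"
  \<comment> \<open>\<open>K C\<close> is the component of the stack that meets the outer rows in
    \<open>C\<close>; \<open>X C\<close> and \<open>Y C\<close> are the blocks of the two diagrams
    inside it.\<close>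
  define K where "K C = {s. \<exists>u\<in>C. (outer u, s) \<in> ?E}" for C :: "vertex set"
  define X where "X C = {B \<in> x. \<exists>v\<in>B. upper_half v \<in> K C}" for C
  define Y where "Y C = {B \<in> y. \<exists>v\<in>B. lower_half v \<in> K C}" for C
  define D where "D C = (\<Union>B\<in>X C. upper_map ` Dx B) \<union> (\<Union>B\<in>Y C. lower_map ` Dy B)" for C
  have K_step: "t \<in> K C" if "s \<in> K C" "(s, t) \<in> stack_edges x y" for s t C
    using that unfolding K_def by (auto intro: rtrancl_into_rtrancl)
  have KX: "upper_half w \<in> K C" if B: "B \<in> X C" and w: "w \<in> B" for B w C
  proof -
    obtain v where v: "B \<in> x" "v \<in> B" "upper_half v \<in> K C" using B unfolding X_def by blast
    show ?thesis by (rule K_step[OF v(3) upper_edge[OF v(1,2) w]])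
  qed
  have KY: "lower_half w \<in> K C" if B: "B \<in> Y C" and w: "w \<in> B" for B w C
  proof -
    obtain v where v: "B \<in> y" "v \<in> B" "lower_half v \<in> K C" using B unfolding Y_def by blast
    show ?thesis by (rule K_step[OF v(3) lower_edge[OF v(1,2) w]])
  qed
  have K_outer: "v \<in> C" if C: "C \<in> diagram_mult m x y" and v: "v \<in> vertices m" "outer v \<in> K C" for v C
  proof -
    obtain u where u: "u \<in> C" "(outer u, outer v) \<in> ?E" using v(2) unfolding K_def by blast
    show ?thesis using diagram_mult_blockD(2)[OF C u(1)] u(2) v(1) by blast
  qed
  have K_disj: "C = C'" if C: "C \<in> diagram_mult m x y" "C' \<in> diagram_mult m x y" and s: "s \<in> K C" "s \<in> K C'" for C C' s
  proof -
    obtain u u' where u: "u \<in> C" "(outer u, s) \<in> ?E" "u' \<in> C'" "(outer u', s) \<in> ?E"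
      using s unfolding K_def by blast
    then have "outer u' \<in> K C" unfolding K_def by (blast intro: rtrancl_trans stack_rtrancl_sym)
    then have "u' \<in> C" using K_outer[OF C(1)] diagram_mult_blockD(1)[OF C(2) u(3)] by blast
    then show ?thesis using partition_on_same[OF partition_diagram_mult C] u(3) by blast
  qed
  have XE: "path_component (D C) (upper_map p) (upper_map q)" if "B \<in> X C" "p \<in> Dx B" "q \<in> Dx B" for B C p q
  proof -
    have "B \<in> x" using that(1) by (simp add: X_def)
    then have "path_connected (upper_map ` Dx B)" using Dx(1) path_connected_half_maps(1) by blast
    then have "path_component (upper_map ` Dx B) (upper_map p) (upper_map q)"
      using that(2,3) unfolding path_connected_component by blast
    moreover have "upper_map ` Dx B \<subseteq> D C" using that(1) unfolding D_def by blast
    ultimately show ?thesis using path_component_of_subset by blast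
  qed
  have YE: "path_component (D C) (lower_map p) (lower_map q)" if "B \<in> Y C" "p \<in> Dy B" "q \<in> Dy B" for B C p q
  proof -
    have "B \<in> y" using that(1) by (simp add: Y_def)
    then have "path_connected (lower_map ` Dy B)" using Dy(1) path_connected_half_maps(2) by blast
    then have "path_component (lower_map ` Dy B) (lower_map p) (lower_map q)"
      using that(2,3) unfolding path_connected_component by blast
    moreover have "lower_map ` Dy B \<subseteq> D C" using that(1) unfolding D_def by blast
    ultimately show ?thesis using path_component_of_subset by blast
  qed
  have posx: "position v \<in> Dx B" if "B \<in> x" "v \<in> B" for B v using Dx(1)[OF that(1)] that(2) by blast
  have posy: "position v \<in> Dy B" if "B \<in> y" "v \<in> B" for B v using Dy(1)[OF that(1)] that(2) by blast
  have outer_D: "position v \<in> D C" if C: "C \<in> diagram_mult m x y" and v: "v \<in> C" for v C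
  proof -
    have vK: "outer v \<in> K C" using v unfolding K_def by blast
    have vm: "v \<in> vertices m" by (rule diagram_mult_blockD(1)[OF C v])
    show ?thesis
    proof (cases v)
      case (Top i)
      obtain B where B: "B \<in> x" "v \<in> B" using partition_on_obtain[OF px vm] .
      have "outer v = upper_half v" using Top by simp
      then have "B \<in> X C" using B vK unfolding X_def by auto
      moreover have "position v = upper_map (position v)" using Top by (simp add: upper_map_def)
      ultimately show ?thesis using posx[OF B] unfolding D_def by blast
    next
      case (Bot i)
      obtain B where B: "B \<in> y" "v \<in> B" using partition_on_obtain[OF py vm] .
      have "outer v = lower_half v" using Bot by simp
      then have "B \<in> Y C" using B vK unfolding Y_def by auto
      moreover have "position v = lower_map (position v)" using Bot by (simp add: lower_map_def)
      ultimately show ?thesis using posy[OF B] unfolding D_def by blast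
    qed
  qed
  \<comment> \<open>Consecutive vertices of a path in the stack lie in a common block, hence in a
    common path-connected piece of the drawing.\<close>
  have chain: "path_component (D C) (stack_position s) (stack_position t)"
    if C: "C \<in> diagram_mult m x y" and u: "u \<in> C" and st: "(outer u, t) \<in> ?E" and s: "s = outer u" for C u s t
    using st unfolding s
  proof (induction rule: rtrancl_induct)
    case base
    show ?case using outer_D[OF C u] by (simp add: stack_position_half path_component_refl)
  next
    case (step a b)
    have aK: "a \<in> K C" using step(1) u unfolding K_def by blast
    from step(2) consider B v w where "B \<in> x" "v \<in> B" "w \<in> B" "a = upper_half v" "b = upper_half w"
      | B v w where "B \<in> y" "v \<in> B" "w \<in> B" "a = lower_half v" "b = lower_half w"
      unfolding stack_edges_def by blast
    then have "path_component (D C) (stack_position a) (stack_position b)"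
    proof cases
      case (1 B v w)
      have "B \<in> X C" using 1 aK unfolding X_def by blast
      then show ?thesis unfolding 1(4,5) stack_position_half using posx 1 by (intro XE) auto
    next
      case (2 B v w)
      have "B \<in> Y C" using 2 aK unfolding Y_def by blast
      then show ?thesis unfolding 2(4,5) stack_position_half using posy 2 by (intro YE) auto
    qed
    then show ?case using step.IH path_component_trans by blast
  qed
  have base: "path_component (D C) p (position u)"
    if C: "C \<in> diagram_mult m x y" and u: "u \<in> C" and p: "p \<in> D C" for C u p
  proof -
    have to_u: "path_component (D C) (stack_position s) (position u)" if s: "s \<in> K C" for s
    proof -
      obtain w where w: "w \<in> C" "(outer w, s) \<in> ?E" using s unfolding K_def by blast
      have "(outer u, outer w) \<in> ?E" using diagram_mult_blockD(2)[OF C u] w(1) by blast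
      then have "(outer u, s) \<in> ?E" using w(2) by (rule rtrancl_trans)
      from chain[OF C u this refl] show ?thesis
        unfolding stack_position_half using path_component_sym by blast
    qed
    from p consider B q where "B \<in> X C" "q \<in> Dx B" "p = upper_map q" | B q where "B \<in> Y C" "q \<in> Dy B" "p = lower_map q"
      unfolding D_def by blast
    then show ?thesis
    proof cases
      case (1 B q)
      then obtain v where v: "B \<in> x" "v \<in> B" unfolding X_def by blast
      have "path_component (D C) p (stack_position (upper_half v))"
        unfolding 1(3) stack_position_half by (rule XE[OF 1(1,2) posx[OF v]])
      then show ?thesis using to_u[OF KX[OF 1(1) v(2)]] path_component_trans by blast
    next
      case (2 B q)
      then obtain v where v: "B \<in> y" "v \<in> B" unfolding Y_def by blast
      have "path_component (D C) p (stack_position (lower_half v))"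
        unfolding 2(3) stack_position_half by (rule YE[OF 2(1,2) posy[OF v]])
      then show ?thesis using to_u[OF KY[OF 2(1) v(2)]] path_component_trans by blast
    qed
  qed
  \<comment> \<open>Middle vertices, now at height 1/2, must lie in the open rectangle; this uses
    \<open>0 < i < m + 1\<close>.\<close>
  have vm: "1 \<le> i \<and> i \<le> m" if "Top i \<in> vertices m \<or> Bot i \<in> vertices m" for i
    using that by (auto simp: vertices_def)
  have bound: "p \<in> position ` C \<union> ?R" if C: "C \<in> diagram_mult m x y" and p: "p \<in> D C" for C p
  proof -
    from p consider B q where "B \<in> X C" "q \<in> Dx B" "p = upper_map q" | B q where "B \<in> Y C" "q \<in> Dy B" "p = lower_map q"
      unfolding D_def by blast
    then show ?thesis
    proof cases
      case (1 B q)
      then have B: "B \<in> x" by (simp add: X_def)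
      then consider w where "w \<in> B" "q = position w" | "q \<in> ?R" using Dx(1)[OF B] 1(2) by blast
      then show ?thesis
      proof cases
        case (1 w)
        have w: "w \<in> vertices m" by (rule partition_on_block[OF px B 1(1)])
        show ?thesis
        proof (cases w)
          case (Top i)
          have "outer w \<in> K C" using KX[OF \<open>B \<in> X C\<close> 1(1)] Top by simp
          then have "w \<in> C" by (rule K_outer[OF C w])
          then show ?thesis using \<open>p = upper_map q\<close> 1(2) Top by (auto simp: upper_map_def image_iff intro!: bexI[of _ w])
        next
          case (Bot i)
          then show ?thesis using \<open>p = upper_map q\<close> 1(2) vm[of i] w by (simp add: upper_map_def)
        qed
      next
        case 2
        then show ?thesis using \<open>p = upper_map q\<close> by (auto simp: upper_map_def)
      qed
    next
      case (2 B q)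
      then have B: "B \<in> y" by (simp add: Y_def)
      then consider w where "w \<in> B" "q = position w" | "q \<in> ?R" using Dy(1)[OF B] 2(2) by blast
      then show ?thesis
      proof cases
        case (1 w)
        have w: "w \<in> vertices m" by (rule partition_on_block[OF py B 1(1)])
        show ?thesis
        proof (cases w)
          case (Bot i)
          have "outer w \<in> K C" using KY[OF \<open>B \<in> Y C\<close> 1(1)] Bot by simp
          then have "w \<in> C" by (rule K_outer[OF C w])
          then show ?thesis using \<open>p = lower_map q\<close> 1(2) Bot by (auto simp: lower_map_def image_iff intro!: bexI[of _ w])
        next
          case (Top i)
          then show ?thesis using \<open>p = lower_map q\<close> 1(2) vm[of i] w by (simp add: lower_map_def)
        qed
      next
        case 2
        then show ?thesis using \<open>p = lower_map q\<close> by (auto simp: lower_map_def)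
      qed
    qed
  qed
  have mixed: "C = C'" if C: "C \<in> diagram_mult m x y" "C' \<in> diagram_mult m x y"
    and B: "B \<in> X C" "q \<in> Dx B" "B' \<in> Y C'" "q' \<in> Dy B'" and eq: "upper_map q = lower_map q'" for C C' B B' q q'
  proof -
    have Bx: "B \<in> x" and By: "B' \<in> y" using B by (auto simp: X_def Y_def)
    have q: "q \<in> position ` B \<union> ?R" and q': "q' \<in> position ` B' \<union> ?R" using Dx(1)[OF Bx] Dy(1)[OF By] B by blast+
    have pos: "snd (position v) = 0 \<or> snd (position v) = 1" for v by (cases v) auto
    \<comment> \<open>The upper piece has height at least 1/2 and the lower one at most 1/2. A
      common point has height exactly 1/2, and there both original drawings contain only
      vertices.\<close>
    have "snd q \<ge> 0" using q pos by (auto simp: less_imp_le) (metis order_refl zero_le_one)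
    moreover have "snd q' \<le> 1" using q' pos by (auto simp: less_imp_le) (metis order_refl zero_le_one)
    moreover have f: "fst q = fst q'" "(snd q + 1) / 2 = snd q' / 2" using eq by (auto simp: upper_map_def lower_map_def)
    ultimately have "snd q = 0" "snd q' = 1" by auto
    then obtain v w where vw: "v \<in> B" "q = position v" "w \<in> B'" "q' = position w" using q q' by auto
    then obtain i j where "v = Bot i" "w = Top j" using \<open>snd q = 0\<close> \<open>snd q' = 1\<close> by (cases v; cases w) auto
    moreover then have "i = j" using f(1) vw by simp
    ultimately have "Middle i \<in> K C" "Middle i \<in> K C'" using KX[OF B(1) vw(1)] KY[OF B(3) vw(3)] by auto
    then show ?thesis by (rule K_disj[OF C])
  qed
  have disj: "C = C'" if C: "C \<in> diagram_mult m x y" "C' \<in> diagram_mult m x y" and p: "p \<in> D C" "p \<in> D C'" for C C' p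
  proof -
    have injs: "upper_map a = upper_map b \<Longrightarrow> a = b" "lower_map a = lower_map b \<Longrightarrow> a = b" for a b
      by (auto simp: upper_map_def lower_map_def prod_eq_iff)
    from p consider
        B q B' q' where "B \<in> X C" "q \<in> Dx B" "p = upper_map q" "B' \<in> X C'" "q' \<in> Dx B'" "p = upper_map q'"
      | B q B' q' where "B \<in> Y C" "q \<in> Dy B" "p = lower_map q" "B' \<in> Y C'" "q' \<in> Dy B'" "p = lower_map q'"
      | B q B' q' where "B \<in> X C" "q \<in> Dx B" "p = upper_map q" "B' \<in> Y C'" "q' \<in> Dy B'" "p = lower_map q'"
      | B q B' q' where "B \<in> Y C" "q \<in> Dy B" "p = lower_map q" "B' \<in> X C'" "q' \<in> Dx B'" "p = upper_map q'"
      unfolding D_def by blast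
    then show ?thesis
    proof cases
      case (1 B q B' q')
      have "q = q'" using injs(1) 1(3,6) by simp
      moreover have "B \<in> x" "B' \<in> x" using 1 by (auto simp: X_def)
      ultimately have "B = B'" using Dx(2) 1(2,5) by blast
      moreover obtain v where "v \<in> B" using 1(1) by (auto simp: X_def)
      ultimately show ?thesis using K_disj[OF C] KX[OF 1(1)] KX[OF 1(4)] by blast
    next
      case (2 B q B' q')
      have "q = q'" using injs(2) 2(3,6) by simp
      moreover have "B \<in> y" "B' \<in> y" using 2 by (auto simp: Y_def)
      ultimately have "B = B'" using Dy(2) 2(2,5) by blast
      moreover obtain v where "v \<in> B" using 2(1) by (auto simp: Y_def)
      ultimately show ?thesis using K_disj[OF C] KY[OF 2(1)] KY[OF 2(4)] by blast
    next
      case (3 B q B' q')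
      show ?thesis by (rule mixed[OF C 3(1,2,4,5)]) (use 3 in simp)
    next
      case (4 B q B' q')
      show ?thesis by (rule mixed[OF C(2,1) 4(4,5,1,2), symmetric]) (use 4 in simp)
    qed
  qed
  show ?thesis unfolding planar_diagram_def
  proof (intro exI[of _ D] conjI ballI impI)
    fix C assume C: "C \<in> diagram_mult m x y"
    then obtain u where u: "u \<in> C" using partition_onD3[OF partition_diagram_mult] by (metis ex_in_conv)
    show "path_connected (D C)" unfolding path_connected_component
    proof (intro ballI)
      fix p q assume pq: "p \<in> D C" "q \<in> D C"
      show "path_component (D C) p q"
        by (rule path_component_trans[OF base[OF C u pq(1)] path_component_sym[OF base[OF C u pq(2)]]])
    qed
    show "position ` C \<subseteq> D C" using outer_D[OF C] by blast
    show "D C \<subseteq> position ` C \<union> ?R" using bound[OF C] by blast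
    fix C' assume "C' \<in> diagram_mult m x y" "C \<noteq> C'"
    then show "D C \<inter> D C' = {}" using disj[OF C] by blast
  qed
qed

section \<open>Planar permutation diagrams are trivial\<close>

text \<open>Drawings consist of pairs of reals, whereas the crossing theorem \<open>fashoda\<close>
  is stated for \<open>real ^ 2\<close>.\<close>

definition to_vec :: "real \<times> real \<Rightarrow> real ^ 2" where
  "to_vec p = vector [fst p, snd p]"

lemma to_vec_component [simp]: "to_vec p $ 1 = fst p" "to_vec p $ 2 = snd p"
  by (simp_all add: to_vec_def)

lemma to_vec_inj: "to_vec p = to_vec q \<Longrightarrow> p = q"
  by (metis prod_eq_iff to_vec_component)

lemma path_to_vec: "path f \<Longrightarrow> path (to_vec \<circ> f)"
proof -
  assume f: "path f"
  have "to_vec \<circ> f = (\<lambda>t. \<chi> k. if k = 1 then fst (f t) else snd (f t))"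
    by (auto simp: fun_eq_iff vec_eq_iff forall_2)
  moreover have "continuous_on {0..1} (\<lambda>t. \<chi> k. if k = (1::2) then fst (f t) else snd (f t))"
  proof (rule continuous_on_vec_lambda)
    fix k :: 2
    show "continuous_on {0..1} (\<lambda>t. if k = 1 then fst (f t) else snd (f t))"
      using f by (cases "k = 1") (auto simp: path_def intro!: continuous_intros)
  qed
  ultimately show ?thesis by (simp add: path_def)
qed

text \<open>If the strands of \<open>i < j\<close> were inverted, the strand of \<open>i\<close>,
  prolonged along the top edge to the left side and along the bottom edge to the right side, would
  run across the rectangle from left to right, while the strand of \<open>j\<close> joins bottom and
  top. The two must meet.\<close>

lemma planar_no_inversion:
  assumes pl: "planar_diagram m (perm_diagram m \<sigma>)" and \<sigma>: "\<sigma> permutes {1..m}"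
    and ij: "i \<in> {1..m}" "j \<in> {1..m}" "i < j"
  shows "\<sigma> i < \<sigma> j"
proof (rule ccontr)
  assume "\<not> \<sigma> i < \<sigma> j"
  moreover have "\<sigma> i \<noteq> \<sigma> j" using permutes_inj[OF \<sigma>] ij(3) by (auto dest: injD)
  ultimately have lt: "\<sigma> j < \<sigma> i" by simp
  have s: "\<sigma> i \<in> {1..m}" "\<sigma> j \<in> {1..m}" using permutes_in_image[OF \<sigma>] ij by blast+
  let ?B = "{Top i, Bot (\<sigma> i)}" and ?C = "{Top j, Bot (\<sigma> j)}"
  let ?R = "{0<..<real m + 1} \<times> {0<..<1::real}"
  have B: "?B \<in> perm_diagram m \<sigma>" "?C \<in> perm_diagram m \<sigma>" using ij unfolding perm_diagram_def by blast+
  have BC: "?B \<noteq> ?C" using ij(3) by (auto simp: doubleton_eq_iff)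
  obtain D where D: "\<And>A. A \<in> perm_diagram m \<sigma> \<Longrightarrow> path_connected (D A) \<and> position ` A \<subseteq> D A \<and> D A \<subseteq> position ` A \<union> ?R"
    "\<And>A A'. A \<in> perm_diagram m \<sigma> \<Longrightarrow> A' \<in> perm_diagram m \<sigma> \<Longrightarrow> A \<noteq> A' \<Longrightarrow> D A \<inter> D A' = {}"
    using pl unfolding planar_diagram_def by metis
  have DB: "(real i, 1) \<in> D ?B" "(real (\<sigma> i), 0) \<in> D ?B" "D ?B \<subseteq> {(real i, 1), (real (\<sigma> i), 0)} \<union> ?R"
    using D(1)[OF B(1)] by auto
  have DC: "(real j, 1) \<in> D ?C" "(real (\<sigma> j), 0) \<in> D ?C" "D ?C \<subseteq> {(real j, 1), (real (\<sigma> j), 0)} \<union> ?R"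
    using D(1)[OF B(2)] by auto
  obtain f where f: "path f" "path_image f \<subseteq> D ?B" "pathstart f = (real i, 1)" "pathfinish f = (real (\<sigma> i), 0)"
    using D(1)[OF B(1)] DB unfolding path_connected_def by metis
  obtain g where g: "path g" "path_image g \<subseteq> D ?C" "pathstart g = (real (\<sigma> j), 0)" "pathfinish g = (real j, 1)"
    using D(1)[OF B(2)] DC unfolding path_connected_def by metis
  define F where "F = linepath (0, 1) (real i, 1) +++ f +++ linepath (real (\<sigma> i), 0) (real m + 1, 0)"
  have F: "path F" "pathstart F = (0, 1)" "pathfinish F = (real m + 1, 0)"
    unfolding F_def using f by (auto intro!: path_join_imp)
  have seg: "closed_segment (0, 1) (real i, 1) \<subseteq> {p. 0 \<le> fst p \<and> fst p \<le> real i \<and> snd p = 1}"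
    "closed_segment (real (\<sigma> i), 0) (real m + 1, 0) \<subseteq> {p. real (\<sigma> i) \<le> fst p \<and> fst p \<le> real m + 1 \<and> snd p = (0::real)}"
  proof -
    have "closed_segment (0, 1) (real i, 1) \<subseteq> {0..real i} \<times> {1}"
      by (intro closed_segment_subset convex_Times) auto
    then show "closed_segment (0, 1) (real i, 1) \<subseteq> {p. 0 \<le> fst p \<and> fst p \<le> real i \<and> snd p = 1}" by auto
    have "closed_segment (real (\<sigma> i), 0) (real m + 1, 0) \<subseteq> {real (\<sigma> i)..real m + 1} \<times> {0}"
      using s(1) by (intro closed_segment_subset convex_Times) auto
    then show "closed_segment (real (\<sigma> i), 0) (real m + 1, 0) \<subseteq>
        {p. real (\<sigma> i) \<le> fst p \<and> fst p \<le> real m + 1 \<and> snd p = 0}" by auto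
  qed
  have Fim: "path_image F \<subseteq> {p. 0 \<le> fst p \<and> fst p \<le> real i \<and> snd p = 1} \<union> D ?B \<union>
      {p. real (\<sigma> i) \<le> fst p \<and> fst p \<le> real m + 1 \<and> snd p = 0}"
  proof -
    have "path_image F = closed_segment (0, 1) (real i, 1) \<union>
        (path_image f \<union> closed_segment (real (\<sigma> i), 0) (real m + 1, 0))"
      unfolding F_def using f by (simp add: path_image_join)
    then show ?thesis using seg f(2) by blast
  qed
  let ?a = "vector [0, 0] :: real ^ 2" and ?b = "vector [real m + 1, 1] :: real ^ 2"
  have box: "to_vec p \<in> cbox ?a ?b \<longleftrightarrow> 0 \<le> fst p \<and> fst p \<le> real m + 1 \<and> 0 \<le> snd p \<and> snd p \<le> 1" for p
    by (auto simp: mem_box_cart forall_2)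
  have im: "real i \<le> real m + 1" "real j \<le> real m + 1" "real (\<sigma> i) \<le> real m + 1" "real (\<sigma> j) \<le> real m + 1"
    using ij s by auto
  have Dbox: "0 \<le> fst p \<and> fst p \<le> real m + 1 \<and> 0 \<le> snd p \<and> snd p \<le> 1" if "p \<in> D ?B \<or> p \<in> D ?C" for p
  proof -
    have "p \<in> {(real i, 1), (real (\<sigma> i), 0), (real j, 1), (real (\<sigma> j), 0)} \<union> ?R" using that DB(3) DC(3) by blast
    then show ?thesis using im by auto
  qed
  have "\<exists>z. z \<in> path_image (to_vec \<circ> F) \<and> z \<in> path_image (to_vec \<circ> g)"
  proof (rule fashoda[of "to_vec \<circ> F" "to_vec \<circ> g" ?a ?b])
    show "path (to_vec \<circ> F)" "path (to_vec \<circ> g)" using path_to_vec F(1) g(1) by blast+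
    show "path_image (to_vec \<circ> F) \<subseteq> cbox ?a ?b"
    proof -
      have "to_vec p \<in> cbox ?a ?b" if "p \<in> path_image F" for p
      proof -
        have "p \<in> D ?B \<or> (0 \<le> fst p \<and> fst p \<le> real i \<and> snd p = 1) \<or> (real (\<sigma> i) \<le> fst p \<and> fst p \<le> real m + 1 \<and> snd p = 0)"
          using that Fim by blast
        then show ?thesis unfolding box using Dbox[of p] im(1) s(1) by fastforce
      qed
      then show ?thesis by (auto simp: path_image_compose)
    qed
    show "path_image (to_vec \<circ> g) \<subseteq> cbox ?a ?b"
    proof -
      have "to_vec p \<in> cbox ?a ?b" if "p \<in> path_image g" for p
        unfolding box by (rule Dbox) (use that g(2) in blast)
      then show ?thesis by (auto simp: path_image_compose)
    qed
  qed (auto simp: pathstart_compose pathfinish_compose F g)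
  then obtain p q where pq: "p \<in> path_image F" "q \<in> path_image g" "to_vec p = to_vec q"
    unfolding path_image_compose by blast
  then have "p = q" using to_vec_inj by blast
  then have pC: "p \<in> D ?C" using pq(2) g(2) by blast
  then have pB: "p \<notin> D ?B" using D(2)[OF B BC] by blast
  \<comment> \<open>The meeting point lies on a prolongation. At height 1 that reaches only to
    \<open>i < j\<close>, at height 0 it starts at \<open>\<sigma> i > \<sigma> j\<close>, and the
    strand of \<open>j\<close> touches these edges only at \<open>j\<close> and
    \<open>\<sigma> j\<close>.\<close>
  have "p \<in> {(real j, 1), (real (\<sigma> j), 0)} \<union> ?R" using pC DC(3) by blast
  moreover have "(fst p \<le> real i \<and> snd p = 1) \<or> (real (\<sigma> i) \<le> fst p \<and> snd p = 0)"
    using pq(1) Fim pB by blast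
  ultimately show False using ij(3) lt by auto
qed

text \<open>Without inversions \<open>\<sigma>\<close> is increasing, so
  \<open>i \<le> \<sigma> i\<close> throughout; comparing the sums over \<open>{1..m}\<close> forces
  equality.\<close>

lemma planar_perm_diagram:
  assumes pl: "planar_diagram m (perm_diagram m \<sigma>)" and \<sigma>: "\<sigma> permutes {1..m}"
  shows "\<sigma> = id"
proof -
  have le: "i \<le> \<sigma> i" if "i \<in> {1..m}" for i
    using that
  proof (induction i rule: less_induct)
    case (less i)
    show ?case
    proof (cases "i = 1")
      case True
      then show ?thesis using permutes_in_image[OF \<sigma>] less.prems by auto
    next
      case False
      then have i: "i - 1 \<in> {1..m}" "i - 1 < i" using less.prems by auto
      then have "i - 1 \<le> \<sigma> (i - 1)" using less.IH by blast
      moreover have "\<sigma> (i - 1) < \<sigma> i" using planar_no_inversion[OF pl \<sigma> i(1) less.prems i(2)] .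
      ultimately show ?thesis by linarith
    qed
  qed
  have "\<sigma> i = i" if i: "i \<in> {1..m}" for i
  proof (rule ccontr)
    assume ne: "\<sigma> i \<noteq> i"
    have "(\<Sum>i\<in>{1..m}. i) < (\<Sum>i\<in>{1..m}. \<sigma> i)"
      using le i ne by (intro sum_strict_mono_ex1) (auto intro!: bexI[of _ i] simp: le_neq_implies_less)
    also have "(\<Sum>i\<in>{1..m}. \<sigma> i) = (\<Sum>i\<in>{1..m}. i)"
      using sum.permute[OF \<sigma>, of "\<lambda>i. i"] by (simp add: comp_def)
    finally show False by simp
  qed
  then show ?thesis using permutes_not_in[OF \<sigma>] by (metis eq_id_iff)
qed

section \<open>Modules over diagram monoids\<close>

lemma submodule_iff:
  "submodule sc M act U \<longleftrightarrow> module.subspace sc U \<and> (\<forall>x\<in>carrier M. act x ` U \<subseteq> U)"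
  by (auto simp: submodule_def)

section \<open>Diagram modules as operator monoids\<close>

text \<open>\<open>l\<close> is the degree of the unit group. The axiom \<open>units_M\<close>
  offers two cases: all permutation diagrams belong to \<open>M\<close>, or no permutation diagram
  other than the identity does.\<close>

locale diagram_module =
  fixes m :: nat and M :: "diagram monoid" and sc :: "complex \<Rightarrow> 'v::ab_group_add \<Rightarrow> 'v"
    and act :: "diagram \<Rightarrow> 'v \<Rightarrow> 'v" and l :: nat
  assumes module: "monoid_module sc M act"
    and nonzero: "\<exists>v::'v. v \<noteq> 0"
    and faithful: "\<And>x. x \<in> carrier M \<Longrightarrow> (\<And>v. act x v = v) \<Longrightarrow> x = perm_diagram m id"
    and mult_M: "x \<otimes>\<^bsub>M\<^esub> y = diagram_mult m x y"
    and one_M: "\<one>\<^bsub>M\<^esub> = perm_diagram m id"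
    and partition_M: "x \<in> carrier M \<Longrightarrow> partition_on (vertices m) x"
    and closed_M: "x \<in> carrier M \<Longrightarrow> y \<in> carrier M \<Longrightarrow> diagram_mult m x y \<in> carrier M"
    and units_M: "l = m \<and> (\<forall>\<sigma>. \<sigma> permutes {1..m} \<longrightarrow> perm_diagram m \<sigma> \<in> carrier M) \<or>
      l = 0 \<and> (\<forall>\<sigma>. \<sigma> permutes {1..m} \<and> perm_diagram m \<sigma> \<in> carrier M \<longrightarrow> \<sigma> = id)"
begin

sublocale monoid_module sc M act by (rule module)

lemma act_mult': "x \<in> carrier M \<Longrightarrow> y \<in> carrier M \<Longrightarrow> act (diagram_mult m x y) = act x \<circ> act y"
  using act_mult mult_M by (simp add: fun_eq_iff)

lemma act_id: "act (perm_diagram m id) = id"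
  using act_one one_M by (simp add: fun_eq_iff)

lemma finite_carrier: "finite (carrier M)"
proof (rule finite_subset)
  show "carrier M \<subseteq> Pow (Pow (vertices m))"
    using partition_M partition_onD1 by fastforce
qed (simp add: finite_vertices)

text \<open>Some power of an element acting injectively acts as the identity, hence equals \<open>1\<close>.\<close>

lemma injective_perm_diagram:
  assumes x: "x \<in> carrier M" and inj: "inj (act x)"
  obtains \<sigma> where "\<sigma> permutes {1..m}" "x = perm_diagram m \<sigma>"
proof -
  \<comment> \<open>\<open>pw k\<close> is \<open>x^(k + 1)\<close>; starting from \<open>x\<close>
    keeps all powers in the carrier by \<open>closed_M\<close> alone.\<close>
  define pw where "pw k = (diagram_mult m x ^^ k) x" for k
  have pw_Suc: "pw (Suc k) = diagram_mult m x (pw k)" for k by (simp add: pw_def)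
  have pwM: "pw k \<in> carrier M" for k
    by (induction k) (use x closed_M in \<open>auto simp: pw_def\<close>)
  have act_pw: "act (pw k) = act x ^^ Suc k" for k
  proof (induction k)
    case (Suc k)
    then show ?case unfolding pw_Suc act_mult'[OF x pwM] by simp
  qed (simp add: pw_def)
  have "\<not> inj pw"
  proof
    assume "inj pw"
    moreover have "finite (range pw)" using finite_subset[OF _ finite_carrier] pwM by blast
    ultimately show False using finite_imageD infinite_UNIV_nat by blast
  qed
  then obtain i j where ij: "pw i = pw j" "i < j" unfolding inj_def by (metis linorder_neqE_nat)
  obtain k where k: "j = Suc (i + k)" using less_imp_Suc_add[OF ij(2)] by blast
  have "act (pw k) v = v" for v
  proof (rule injD[OF inj_fn[OF inj, of "Suc i"]])
    have "(act x ^^ Suc i) (act (pw k) v) = (act x ^^ (Suc i + Suc k)) v"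
      unfolding act_pw by (simp only: funpow_add comp_def)
    also have "\<dots> = act (pw j) v" unfolding act_pw k by simp
    also have "\<dots> = (act x ^^ Suc i) v" unfolding ij(1)[symmetric] act_pw ..
    finally show "(act x ^^ Suc i) (act (pw k) v) = (act x ^^ Suc i) v" .
  qed
  then have one: "pw k = perm_diagram m id" by (rule faithful[OF pwM])
  \<comment> \<open>For \<open>k = 0\<close> the diagram \<open>x\<close> is itself the identity;
    otherwise \<open>x^k\<close> is a right inverse of \<open>x\<close>.\<close>
  show ?thesis
  proof (cases k)
    case 0
    then show ?thesis using that[of id] one permutes_id by (simp add: pw_def)
  next
    case (Suc k')
    then have "diagram_mult m x (pw k') = perm_diagram m id" using one pw_Suc by simp
    then show ?thesis
      using right_invertible_perm_diagram[OF partition_M[OF x] partition_M[OF pwM]] that by blast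
  qed
qed

text \<open>The inverse compensates for the reversed composition of stacked permutation diagrams, so
  that \<open>unit_act\<close> is a homomorphism.\<close>

definition unit_act :: "nat perm \<Rightarrow> 'v \<Rightarrow> 'v" where
  "unit_act p = act (perm_diagram m (apply (- p)))"

lemma apply_permutes: "p \<in> sym_grp m \<Longrightarrow> apply p permutes {1..m}"
  using bij_betw_sym_grp_permutes[of m] by (auto simp: bij_betw_def)

lemma apply_zero: "apply (0 :: nat perm) = id"
  by (simp add: fun_eq_iff)

lemma unit_act_0: "unit_act 0 = id"
  by (simp add: unit_act_def apply_zero act_id)

lemma sym_grp_zero: "p \<in> sym_grp 0 \<Longrightarrow> p = 0"
  by (simp add: sym_grp_def zero_perm_def)

lemma fin_dim_space: "fin_dim_space sc"
proof -
  interpret V: complex_vector_space sc by unfold_locales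
  obtain B where "finite B" "span B = UNIV" using finite_dimensional by blast
  then show ?thesis by unfold_locales (auto simp: V.fin_dim_def)
qed

sublocale ops: operator_monoid sc l unit_act "act ` carrier M"
proof (intro operator_monoid.intro operator_monoid_axioms.intro, goal_cases)
  case 1
  show ?case by (rule fin_dim_space)
next
  case 2
  show ?case by (rule nonzero)
next
  case 3
  show ?case using finite_carrier by simp
next
  case (4 g)
  then obtain x where "g = act x" "x \<in> carrier M" by (rule imageE)
  then show ?case by (simp only: act_linear)
next
  case (5 g h)
  from 5(1) obtain x where x: "g = act x" "x \<in> carrier M" by (rule imageE)
  from 5(2) obtain y where y: "h = act y" "y \<in> carrier M" by (rule imageE)
  have "g \<circ> h = act (diagram_mult m x y)" unfolding x(1) y(1) by (rule act_mult'[OF x(2) y(2), symmetric])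
  then show ?case by (rule image_eqI) (rule closed_M[OF x(2) y(2)])
next
  case (6 p)
  show ?case
  proof (cases "l = 0")
    case True
    then have "p = 0" using 6 by (intro sym_grp_zero) simp
    then show ?thesis by (simp add: unit_act_0)
  next
    case False
    then have "perm_diagram m (apply (- p)) \<in> carrier M"
      using units_M apply_permutes[of "- p"] 6 by simp
    then show ?thesis by (simp add: unit_act_def)
  qed
next
  case (7 p q)
  show ?case
  proof (cases "l = 0")
    case True
    then have "p \<in> sym_grp 0" "q \<in> sym_grp 0" using 7 by simp_all
    then have "p = 0" "q = 0" by - (erule sym_grp_zero)+
    then show ?thesis by (simp add: unit_act_0)
  next
    case False
    then have pq: "apply (- p) permutes {1..m}" "apply (- q) permutes {1..m}"
      "perm_diagram m (apply (- p)) \<in> carrier M" "perm_diagram m (apply (- q)) \<in> carrier M"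
      using units_M apply_permutes[of "- p"] apply_permutes[of "- q"] 7 by auto
    have "apply (- (p + q)) = apply (- q) \<circ> apply (- p)"
      unfolding minus_add by (simp only: fun_eq_iff apply_plus comp_def simp_thms)
    then show ?thesis
      unfolding unit_act_def using perm_diagram_mult[OF pq(1,2)] act_mult'[OF pq(3,4)] by simp
  qed
next
  case 8
  show ?case by (rule unit_act_0)
next
  case (9 p)
  show ?case
  proof (cases "l = 0")
    case True
    then show ?thesis using 9(1) by (intro sym_grp_zero) simp
  next
    case False
    then have p: "apply (- p) permutes {1..m}" "perm_diagram m (apply (- p)) \<in> carrier M"
      using units_M apply_permutes[of "- p"] 9 by auto
    have "perm_diagram m (apply (- p)) = perm_diagram m id"
      using 9(2) by (intro faithful p) (simp add: unit_act_def)
    then have "apply (- p) = id" by (rule perm_diagram_inj[OF _ p(1) permutes_id])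
    then have "- p = 0" by (intro perm_eqI) simp
    then show ?thesis by simp
  qed
next
  case (10 g)
  then obtain x where x: "x \<in> carrier M" "g = act x" by blast
  then obtain \<sigma> where \<sigma>: "\<sigma> permutes {1..m}" "x = perm_diagram m \<sigma>"
    using injective_perm_diagram 10(2) by blast
  from units_M show ?case
  proof
    assume "l = m \<and> (\<forall>\<sigma>. \<sigma> permutes {1..m} \<longrightarrow> perm_diagram m \<sigma> \<in> carrier M)"
    moreover obtain p where "p \<in> sym_grp m" "\<sigma> = apply p"
      using bij_betw_sym_grp_permutes[of m] \<sigma>(1) unfolding bij_betw_def by blast
    ultimately show ?thesis using x \<sigma> by (intro bexI[of _ "- p"]) (auto simp: unit_act_def)
  next
    assume "l = 0 \<and> (\<forall>\<sigma>. \<sigma> permutes {1..m} \<and> perm_diagram m \<sigma> \<in> carrier M \<longrightarrow> \<sigma> = id)"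
    then have "\<sigma> = id" using \<sigma> x(1) by blast
    then show ?thesis using x(2) \<sigma>(2) act_id unit_act_0 by (intro bexI[of _ 0]) auto
  qed
qed

text \<open>Every element of \<open>M\<close> acts on tensors either as a unit or through
  \<open>noninv\<close>. Inside the tensor power, submodules, indecomposables and decompositions
  therefore agree with those of the \<open>unit_rep\<close>. As some decomposition exists, the
  number selected by the choice operator belongs to a decomposition.\<close>

lemma decomposition_exists:
  fixes n
  defines "k \<equiv> num_indecomposable_summands tensor_scale M (tensor_act sc act) (tensor_power sc n)"
  shows "\<exists>X. unit_rep.decomposition tensor_scale l (\<lambda>p. tensor_map sc (unit_act p)) (tensor_power sc n) ops.noninv
    (tensor_power sc n) k X"
proof -
  let ?W = "tensor_power sc n" and ?act = "tensor_act sc act"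
  interpret R: unit_rep tensor_scale l "\<lambda>p. tensor_map sc (unit_act p)" ?W ops.noninv
    by (rule ops.unit_rep_power)
  have sub: "submodule tensor_scale M ?act U \<longleftrightarrow> R.msub U" if UW: "U \<subseteq> ?W" for U
  proof
    assume "submodule tensor_scale M ?act U"
    then have s: "tensor.subspace U" and a: "\<And>x. x \<in> carrier M \<Longrightarrow> tensor_map sc (act x) ` U \<subseteq> U"
      unfolding submodule_iff tensor_act_eq_map by blast+
    have "tensor_map sc (unit_act p) ` U \<subseteq> U" if p: "p \<in> sym_grp l" for p
    proof -
      consider x where "x \<in> carrier M" "unit_act p = act x" | "unit_act p = id"
        using ops.rho_Op[OF p] by blast
      then show ?thesis
      proof cases
        case 2
        then show ?thesis using ops.tensor_map_id UW by (auto simp only:)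
      qed (use a in simp)
    qed
    moreover have "t ` U \<subseteq> U" if "t \<in> ops.noninv" for t
      using that a unfolding ops.noninv_def by blast
    ultimately show "R.msub U" unfolding R.msub_def R.stable_def using s UW by blast
  next
    assume U: "R.msub U"
    have "tensor_map sc (act x) ` U \<subseteq> U" if x: "x \<in> carrier M" for x
    proof (cases "inj (act x)")
      case True
      then obtain p where "p \<in> sym_grp l" "act x = unit_act p"
        using ops.Op_unit[OF imageI[OF x]] by blast
      then show ?thesis using U unfolding R.msub_def R.stable_def by simp
    next
      case False
      then have "tensor_map sc (act x) \<in> ops.noninv" using x unfolding ops.noninv_def by blast
      then show ?thesis using U unfolding R.msub_def by blast
    qed
    then show "submodule tensor_scale M ?act U"
      unfolding submodule_iff tensor_act_eq_map using R.msub_subspace[OF U] by blast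
  qed
  have ind: "indecomposable tensor_scale M ?act U \<longleftrightarrow> R.indec U" if UW: "U \<subseteq> ?W" for U
  proof -
    have "submodule tensor_scale M ?act A \<and> submodule tensor_scale M ?act B \<and>
        bij_betw (\<lambda>(u, v). u + v) (A \<times> B) U \<longleftrightarrow>
        R.msub A \<and> R.msub B \<and> bij_betw (\<lambda>(u, v). u + v) (A \<times> B) U" for A B
    proof -
      \<comment> \<open>Indecomposability quantifies over all subspaces of the type; the summands of
        \<open>U\<close> lie in \<open>U\<close>, hence in the range where the two notions of
        submodule agree.\<close>
      have "A \<subseteq> ?W \<and> B \<subseteq> ?W" if "tensor.subspace A" "tensor.subspace B"
        "bij_betw (\<lambda>(u, v). u + v) (A \<times> B) U"
        using tensor.bij_betw_sumD(2,3)[OF that] UW by blast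
      then show ?thesis using sub[of A] sub[of B] R.msub_subspace unfolding submodule_iff by blast
    qed
    then show ?thesis unfolding indecomposable_def R.indec_def using sub[OF UW] by blast
  qed
  have dec: "indecomposable_decomposition tensor_scale M ?act ?W j X \<longleftrightarrow> R.decomposition ?W j X" for j X
  proof (cases "bij_betw (\<lambda>u. \<Sum>i<j. u i) (\<Pi>\<^sub>E i\<in>{..<j}. X i) ?W \<and> (\<forall>i<j. tensor.subspace (X i))")
    case True
    then have d: "tensor.direct_sum {..<j} X ?W" by (simp add: tensor.direct_sum_def)
    have "X i \<subseteq> ?W" if "i < j" for i
      using tensor.direct_sum_subset[OF _ d, of i] True that by simp
    then have "(\<forall>i<j. indecomposable tensor_scale M ?act (X i)) \<longleftrightarrow> (\<forall>i<j. R.indec (X i))"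
      using ind by simp
    then show ?thesis
      unfolding indecomposable_decomposition_def R.decomposition_def tensor.direct_sum_def by (rule arg_cong2[OF _ refl])
  next
    \<comment> \<open>Either notion of decomposition forces the sum map to be bijective and the
      components to be subspaces, so both fail here.\<close>
    case False
    have "\<not> indecomposable_decomposition tensor_scale M ?act ?W j X"
    proof
      assume d: "indecomposable_decomposition tensor_scale M ?act ?W j X"
      have "tensor.subspace (X i)" if "i < j" for i
        using d that unfolding indecomposable_decomposition_def indecomposable_def submodule_iff by simp
      then show False using d False unfolding indecomposable_decomposition_def by simp
    qed
    moreover have "\<not> R.decomposition ?W j X"
    proof
      assume d: "R.decomposition ?W j X"
      have "tensor.subspace (X i)" if "i < j" for i
        using d that R.msub_subspace unfolding R.decomposition_def R.indec_def by simp
      then show False using d False unfolding R.decomposition_def tensor.direct_sum_def by simp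
    qed
    ultimately show ?thesis by simp
  qed
  have "\<exists>j X. R.decomposition ?W j X" by (rule R.decomposition_exists[OF R.msub_W])
  then have "\<exists>X. R.decomposition ?W (SOME j. \<exists>X. R.decomposition ?W j X) X" by (rule someI_ex)
  then show ?thesis unfolding k_def num_indecomposable_summands_def dec .
qed

lemma summands_limit:
  "(\<lambda>n. real (num_indecomposable_summands tensor_scale M (tensor_act sc act) (tensor_power sc n)) /
     real (dim UNIV) ^ n) \<longlonglongrightarrow> involution_sum l"
  by (rule ops.decomposition_asymptotics[OF decomposition_exists])

end

section \<open>The seven monoids\<close>

lemma involution_sum_pos: "involution_sum n > 0"
  unfolding involution_sum_def by (intro sum_pos) auto

lemmas monoid_defs = planar_rook_monoid_def temperley_lieb_monoid_def motzkin_monoid_def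
  rook_monoid_def brauer_monoid_def rook_brauer_monoid_def partition_monoid_def

lemma rook_brauer_closed:
  "x \<in> carrier (rook_brauer_monoid m) \<Longrightarrow> y \<in> carrier (rook_brauer_monoid m) \<Longrightarrow>
    diagram_mult m x y \<in> carrier (rook_brauer_monoid m)"
  using partition_diagram_mult diagram_mult_card_le_2[of m x y] by (simp add: monoid_defs)

lemma brauer_closed:
  "x \<in> carrier (brauer_monoid m) \<Longrightarrow> y \<in> carrier (brauer_monoid m) \<Longrightarrow>
    diagram_mult m x y \<in> carrier (brauer_monoid m)"
  using partition_diagram_mult diagram_mult_card_2[of m x y] by (simp add: monoid_defs)

lemma rook_closed:
  assumes "x \<in> carrier (rook_monoid m)" "y \<in> carrier (rook_monoid m)"
  shows "diagram_mult m x y \<in> carrier (rook_monoid m)"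
proof -
  have x: "partition_on (vertices m) x" "\<And>B. B \<in> x \<Longrightarrow> card B \<le> 2 \<and> (card B = 2 \<longrightarrow> (\<exists>i j. B = {Top i, Bot j}))"
    and y: "partition_on (vertices m) y" "\<And>B. B \<in> y \<Longrightarrow> card B \<le> 2 \<and> (card B = 2 \<longrightarrow> (\<exists>i j. B = {Top i, Bot j}))"
    using assms by (simp_all add: monoid_defs)
  have "card C \<le> 2 \<and> (card C = 2 \<longrightarrow> (\<exists>i j. C = {Top i, Bot j}))" if "C \<in> diagram_mult m x y" for C
    using diagram_mult_rook[OF x y that] diagram_mult_card_le_2[OF x(1) _ y(1) _ that] x(2) y(2) by blast
  then show ?thesis using partition_diagram_mult by (simp add: monoid_defs)
qed

theorem theorem3p1p7:
  fixes m :: nat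
    and M :: "diagram monoid"
    and sc :: "complex \<Rightarrow> 'v::ab_group_add \<Rightarrow> 'v"
    and act :: "diagram \<Rightarrow> 'v \<Rightarrow> 'v"
    and b :: "nat \<Rightarrow> nat"
  assumes "m \<ge> 1"
    and "monoid_module sc M act"
    and "\<exists>v::'v. v \<noteq> 0"
    and "\<And>x. x \<in> carrier M \<Longrightarrow> (\<And>v. act x v = v) \<Longrightarrow> x = \<one>\<^bsub>M\<^esub>"
    and "\<And>n. b n = num_indecomposable_summands tensor_scale M (tensor_act sc act) (tensor_power sc n)"
  shows
    "(M \<in> {planar_rook_monoid m, temperley_lieb_monoid m, motzkin_monoid m} \<longrightarrow>
       (\<lambda>n. real (b n)) \<sim>[at_top] (\<lambda>n. real (vector_space.dim sc (UNIV :: 'v set)) ^ n)) \<and>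
     (M \<in> {rook_monoid m, brauer_monoid m, rook_brauer_monoid m, partition_monoid m} \<longrightarrow>
       (\<lambda>n. real (b n)) \<sim>[at_top]
       (\<lambda>n. (\<Sum>z = 0..m div 2. 1 / (fact (m - 2 * z) * fact z * 2 ^ z)) *
            real (vector_space.dim sc (UNIV :: 'v set)) ^ n))"
proof -
  let ?D = "real (vector_space.dim sc (UNIV :: 'v set))"
  have asymp: "(\<lambda>n. real (b n)) \<sim>[at_top] (\<lambda>n. involution_sum l * ?D ^ n)"
    if "diagram_module m M sc act l" for l
  proof (rule asymp_equivI')
    interpret diagram_module m M sc act l by (rule that)
    have "(\<lambda>n. real (b n) / ?D ^ n / involution_sum l) \<longlonglongrightarrow> involution_sum l / involution_sum l"
      using summands_limit involution_sum_pos[of l] unfolding assms(5)[symmetric]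
      by (intro tendsto_divide tendsto_const) auto
    then show "(\<lambda>n. real (b n) / (involution_sum l * ?D ^ n)) \<longlonglongrightarrow> 1"
      using involution_sum_pos[of l] by (simp add: field_simps)
  qed
  have one: "\<one>\<^bsub>M\<^esub> = perm_diagram m id" and mult: "x \<otimes>\<^bsub>M\<^esub> y = diagram_mult m x y"
    and part: "x \<in> carrier M \<Longrightarrow> partition_on (vertices m) x"
    if "M \<in> {planar_rook_monoid m, temperley_lieb_monoid m, motzkin_monoid m,
      rook_monoid m, brauer_monoid m, rook_brauer_monoid m, partition_monoid m}" for x y
    using that by (auto simp: monoid_defs perm_diagram_def)
  have faithful: "x = perm_diagram m id"
    if "M \<in> {planar_rook_monoid m, temperley_lieb_monoid m, motzkin_monoid m,
      rook_monoid m, brauer_monoid m, rook_brauer_monoid m, partition_monoid m}"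
      "x \<in> carrier M" "\<And>v. act x v = v" for x
    using assms(4)[OF that(2,3)] one[OF that(1)] by simp
  show ?thesis
  proof (intro conjI impI)
    assume M: "M \<in> {planar_rook_monoid m, temperley_lieb_monoid m, motzkin_monoid m}"
    have pl: "planar_diagram m x" if "x \<in> carrier M" for x
      using M that unfolding planar_rook_monoid_def temperley_lieb_monoid_def motzkin_monoid_def by auto
    have "diagram_module m M sc act 0"
    proof (rule diagram_module.intro)
      show "monoid_module sc M act" "\<exists>v::'v. v \<noteq> 0" using assms by auto
      show "diagram_mult m x y \<in> carrier M" if xy: "x \<in> carrier M" "y \<in> carrier M" for x y
      proof -
        have "planar_diagram m (diagram_mult m x y)"
          using M part pl xy by (intro planar_diagram_mult) auto
        moreover have "\<exists>N\<in>{rook_monoid m, brauer_monoid m, rook_brauer_monoid m}.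
            carrier M = {x \<in> carrier N. planar_diagram m x}"
          using M by (elim insertE emptyE)
            (simp_all add: planar_rook_monoid_def temperley_lieb_monoid_def motzkin_monoid_def)
        then obtain N where N: "N \<in> {rook_monoid m, brauer_monoid m, rook_brauer_monoid m}"
          "carrier M = {x \<in> carrier N. planar_diagram m x}" by blast
        moreover have "diagram_mult m x y \<in> carrier N"
          using N xy rook_closed brauer_closed rook_brauer_closed by auto
        ultimately show ?thesis by simp
      qed
      show "0 = m \<and> (\<forall>\<sigma>. \<sigma> permutes {1..m} \<longrightarrow> perm_diagram m \<sigma> \<in> carrier M) \<or>
        (0::nat) = 0 \<and> (\<forall>\<sigma>. \<sigma> permutes {1..m} \<and> perm_diagram m \<sigma> \<in> carrier M \<longrightarrow> \<sigma> = id)"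
        using pl planar_perm_diagram by blast
    qed (use M one mult part faithful in auto)
    \<comment> \<open>For \<open>l = 0\<close> the sum consists of the term \<open>z = 0\<close>,
      which is 1.\<close>
    from asymp[OF this] show "(\<lambda>n. real (b n)) \<sim>[at_top] (\<lambda>n. ?D ^ n)"
      by (simp add: involution_sum_def)
  next
    assume M: "M \<in> {rook_monoid m, brauer_monoid m, rook_brauer_monoid m, partition_monoid m}"
    have "diagram_module m M sc act m"
    proof (rule diagram_module.intro)
      show "monoid_module sc M act" "\<exists>v::'v. v \<noteq> 0" using assms by auto
      show "diagram_mult m x y \<in> carrier M" if "x \<in> carrier M" "y \<in> carrier M" for x y
        using M that rook_closed brauer_closed rook_brauer_closed partition_diagram_mult
        by (auto simp: partition_monoid_def)
      have "perm_diagram m \<sigma> \<in> carrier M" if "\<sigma> permutes {1..m}" for \<sigma>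
      proof -
        have "card B = 2" "\<exists>i j. B = {Top i, Bot j}" if B: "B \<in> perm_diagram m \<sigma>" for B
        proof -
          obtain i where "B = {Top i, Bot (\<sigma> i)}" using B by (auto simp: perm_diagram_def)
          then show "card B = 2" "\<exists>i j. B = {Top i, Bot j}" by auto
        qed
        then show ?thesis using M partition_perm_diagram[OF that] by (auto simp: monoid_defs)
      qed
      then show "m = m \<and> (\<forall>\<sigma>. \<sigma> permutes {1..m} \<longrightarrow> perm_diagram m \<sigma> \<in> carrier M) \<or>
        m = 0 \<and> (\<forall>\<sigma>. \<sigma> permutes {1..m} \<and> perm_diagram m \<sigma> \<in> carrier M \<longrightarrow> \<sigma> = id)" by blast
    qed (use M one mult part faithful in auto)
    from asymp[OF this] show "(\<lambda>n. real (b n)) \<sim>[at_top]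
       (\<lambda>n. (\<Sum>z = 0..m div 2. 1 / (fact (m - 2 * z) * fact z * 2 ^ z)) * ?D ^ n)"
      by (simp only: involution_sum_def)
  qed
qed

end
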